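(* Let $T>0$, $d\ge 1$, and let $f:[0,T]\times\mathbb{R}\to\mathbb{R}$ and $\varphi:\mathbb{R}^d\to\mathbb{R}$. Let $(y(t,W_t),z(t,W_t))_{t\in[0,T]}$ be the solution of the backward stochastic differential equation $$y_t=\varphi(W_T)+\int_t^T f(s,y_s)\,ds-\int_t^T z_s\,dW_s,\qquad t\in[0,T],$$ where $W$ is a standard $d$-dimensional Brownian motion and $y(\cdot,\cdot)$ is the deterministic function representing the first component. Assume: (1) There are constants $C_f>0$, $C_0>0$ such that $|f(s,y_1)-f(s,y_2)|\le C_f|y_1-y_2|$ for all $s\in[0,T]$, $y_1,y_2\in\mathbb{R}$, and $|f(s,0)|\le C_0$ for all $s\in[0,T]$. (2) There is $C_\varphi>0$ with $|\varphi(x)|\le C_\varphi$ for all $x\in\mathbb{R}^d$. (3) There is $C_y>0$ with $|y(t,x)|\le C_y$ for all $t\in[0,T]$, $x\in\mathbb{R}^d$. (4) For every $t\in[0,T]$, $x\in\mathbb{R}^d$, the functions of $s\in[t,T]$ $$F_t(s)=E\left[f\left(s,y(s,x+W_{s-t})\right)\right],\qquad G_t(s)=E\left[f\left(s,y(s,x+W_{s-t})\right)\frac{W_{s-t}}{s-t}\right]$$ are bounded and smooth, with all derivatives bounded, and there is $C_d>0$ such that for all $t\in[0,T]$, $x\in\mathbb{R}^d$, $$\sup_{s\in[t,T],\,k\in\mathbb{N}}|F_t^{(k)}(s)|\le C_d,\qquad \sup_{s\in[t,T],\,k\in\mathbb{N}}|G_t^{(k)}(s)|\le C_d .$$ Let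 $M,Q\ge 1$ be integers and let $(y_n)_{n\ge 0}$ be the modified multi-level Picard approximations with $M$ Monte Carlo samples and $Q$ Gauss-Legendre points, as defined in the context. Then there are constants $C_1,C_2$ depending only on $T,C_f,C_y,C_0,C_d,C_\varphi$ such that for all integers $n\ge 1$, all $t\in[0,T)$ and all $x\in\mathbb{R}^d$, $$\left|y(t,x)-E^n[y_n(t,x)]\right|\le n\,C_2C_d\,Q^{1/2}\left(\frac{e}{8Q}\right)^{2Q}+\left(\frac{C_1}{\sqrt{M}}\right)^n e^{C_f\sqrt{M}(T-t)(1+1/C_1)}+\frac{C_y(T-t)^nC_f^n}{n!}$$ and $$\left(\mathrm{var}^n[y_n(t,x)]\right)^{1/2}=\left(E^n\left[\left(y_n(t,x)-E^n[y_n(t,x)]\right)^2\right]\right)^{1/2}\le\left(\frac{C_1}{\sqrt{M}}\right)^n e^{C_f\sqrt{M}(T-t)} .$$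
   Context: **BSDE.** $(\Omega,\mathcal{F},P,\{\mathcal{F}_t\}_{0\le t\le T})$ is a complete filtered probability space satisfying the usual conditions and carrying a standard $d$-dimensional Brownian motion $W$. A solution of the BSDE is a pair $(y_t,z_t)$ of $\{\mathcal F_t\}$-adapted square-integrable processes satisfying the equation. It is assumed that the BSDE has a unique solution and that it is represented as $y_t=y(t,W_t)$, $z_t=\nabla_x y(t,W_t)$ for $t\in[0,T)$. Here $y:[0,T]\times\mathbb{R}^d\to\mathbb{R}$ is the solution of the parabolic PDE $\partial_t y+\frac12\sum_{i=1}^d\partial^2_{x_i}y+f(t,y)=0$, $y(T,x)=\varphi(x)$, and the Feynman-Kac formula $$y(t,x)=E[\varphi(x+W_{T-t})]+\int_t^T E[f(s,y(s,x+W_{s-t}))]\,ds$$ holds. In $F_t$ and $G_t$, $W_{s-t}$ denotes a centred Gaussian vector in $\mathbb{R}^d$ with covariance $(s-t)I_d$. **Quadrature.** For $t\in[0,T)$ and $n\ge1$, $t_{n,1},\dots,t_{n,Q}\in[t,T]$ and $w_{n,1},\dots,w_{n,Q}$ are the nodes and weights of the $Q$-point Gauss-Legendre quadrature rule on the interval $[t,T]$, so that $\sum_{j=1}^Q w_{n,j}g(t_{n,j})$ approximates $\int_t^T g(s)\,ds$. They depend on $t$. **Scheme.** Since $f$ does not depend on $z$, the $y$-component of the scheme is self-contained. The random fields $y_n(t,x)$ are defined recursively by $$y_0(t,x)=0,\qquad y_1(t,x)=\frac1M\sum_{i=1}^M\varphi\left(x+W^{(1,i)}_{T-t}\right)+\sum_{j=1}^Q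 w_{1,j}f(t_{1,j},0),$$ and for $n\ge 2$ $$y_n(t,x)=\frac1M\sum_{i=1}^M y^i_{n-1}(t,x)+\sum_{j=1}^Q\frac{w_{n,j}}{M}\sum_{i=1}^M\left[f\left(t_{n,j},y_{n-1}\left(t_{n,j},x+W^{(n,i)}_{t_{n,j}-t}\right)\right)-f\left(t_{n,j},y_{n-2}\left(t_{n,j},x+W^{(n,i)}_{t_{n,j}-t}\right)\right)\right].$$ Here: - $W^{(n,i)}$, $n\ge1$, $1\le i\le M$, are mutually independent standard $d$-dimensional Brownian motions, so $W^{(n,i)}_{s-t}\sim N(0,(s-t)I_d)$. - $y^i_{n-1}(t,x)$, $i=1,\dots,M$, are i.i.d. random variables distributed as $y_{n-1}(t,x)$. - The Monte Carlo samples are independent. For each $i$ and $j$, the evaluation of the pair $(y_{n-1},y_{n-2})$ at the random point $(t_{n,j},x+W^{(n,i)}_{t_{n,j}-t})$ uses a fresh realization of the pair of random fields, independent of the $W^{(n,i)}$, of the $y_{n-1}^i(t,x)$, and of the realizations used for other indices. Within one such pair, for $n\ge 3$, the realization of $y_{n-2}$ is one of the independent copies of $y_{n-2}$ already used in computing that realization of $y_{n-1}$ at the same time-space point (for $n=2$, $y_{n-2}=y_0=0$). $E^n$ and $\mathrm{var}^n$ denote expectation and variance on the probability space on which $y_n(t,x)$ is defined (the $n$-fold product of $(\Omega,\mathcal F,P)$), i.e. over all the randomness entering $y_n(t,x)$.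
   Formalization: C_2 may depend on Q, with C_2(Q) ≤ K·max(1,T)^{2Q} and K depending only on the listed constants; for T>1 a Q-independent C_2 is impossible (f=c·e^{-s}, φ=0, n=Q²), for T≤1 nothing changes. The constants are stated for each fixed choice of carriers of the sample spaces. *)

theory Defs
  imports "HOL-Probability.Probability" "HOL-Computational_Algebra.Polynomial"
begin

section \<open>Vectors and Brownian motion in dimension \<open>d\<close>\<close>

text \<open>
  The constants of the theorem do not depend on the dimension \<open>d\<close>, so \<open>d\<close> must be quantified
  inside the statement.  Hence \<open>\<real>\<^sup>d\<close> is the set of extensional functions on \<open>{..<d}\<close> with its
  product (i.e. Borel) sigma-algebra, and not a type.
\<close>

abbreviation Rd :: "nat \<Rightarrow> (nat \<Rightarrow> real) measure" where
  "Rd d \<equiv> \<Pi>\<^sub>M i\<in>{..<d}. borel"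

definition vadd :: "nat \<Rightarrow> (nat \<Rightarrow> real) \<Rightarrow> (nat \<Rightarrow> real) \<Rightarrow> nat \<Rightarrow> real" where
  "vadd d x v = (\<lambda>i\<in>{..<d}. x i + v i)"

definition vdiff :: "nat \<Rightarrow> (nat \<Rightarrow> real) \<Rightarrow> (nat \<Rightarrow> real) \<Rightarrow> nat \<Rightarrow> real" where
  "vdiff d x v = (\<lambda>i\<in>{..<d}. x i - v i)"

text \<open>The law \<open>N(0, v I\<^sub>d)\<close>, for \<open>v > 0\<close>.\<close>

definition gaussian_law :: "nat \<Rightarrow> real \<Rightarrow> (nat \<Rightarrow> real) measure" where
  "gaussian_law d v = (\<Pi>\<^sub>M i\<in>{..<d}. density lborel (\<lambda>u. ennreal (normal_density 0 (sqrt v) u)))"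

definition brownian_motion ::
  "'a measure \<Rightarrow> real \<Rightarrow> nat \<Rightarrow> (real \<Rightarrow> 'a \<Rightarrow> nat \<Rightarrow> real) \<Rightarrow> bool" where
  "brownian_motion P T d W \<longleftrightarrow>
     prob_space P \<and>
     (\<forall>t\<in>{0..T}. W t \<in> measurable P (Rd d)) \<and>
     (AE \<omega> in P. \<forall>i<d. W 0 \<omega> i = 0) \<and>
     (\<forall>m \<tau>. (\<forall>k\<le>m. \<tau> k \<in> {0..T}) \<longrightarrow> (\<forall>k<m. \<tau> k < \<tau> (Suc k)) \<longrightarrow>
        prob_space.indep_vars P (\<lambda>_. Rd d)
          (\<lambda>k \<omega>. vdiff d (W (\<tau> (Suc k)) \<omega>) (W (\<tau> k) \<omega>)) {..<m}) \<and>
     (\<forall>s t. 0 \<le> s \<and> s < t \<and> t \<le> T \<longrightarrow>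
        distr P (Rd d) (\<lambda>\<omega>. vdiff d (W t \<omega>) (W s \<omega>)) = gaussian_law d (t - s)) \<and>
     (AE \<omega> in P. \<forall>i<d. continuous_on {0..T} (\<lambda>t. W t \<omega> i))"

definition usual_filtration :: "'a measure \<Rightarrow> real \<Rightarrow> (real \<Rightarrow> 'a measure) \<Rightarrow> bool" where
  "usual_filtration P T F \<longleftrightarrow>
     complete_measure P \<and>
     (\<forall>t\<in>{0..T}. subalgebra P (F t)) \<and>
     (\<forall>s t. 0 \<le> s \<and> s \<le> t \<and> t \<le> T \<longrightarrow> sets (F s) \<subseteq> sets (F t)) \<and>
     null_sets P \<subseteq> sets (F 0) \<and>
     (\<forall>t\<in>{0..<T}. sets (F t) = (\<Inter>s\<in>{t<..T}. sets (F s)))"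

definition brownian_motion_wrt ::
  "'a measure \<Rightarrow> (real \<Rightarrow> 'a measure) \<Rightarrow> real \<Rightarrow> nat \<Rightarrow> (real \<Rightarrow> 'a \<Rightarrow> nat \<Rightarrow> real) \<Rightarrow> bool" where
  "brownian_motion_wrt P F T d W \<longleftrightarrow>
     brownian_motion P T d W \<and>
     (\<forall>t\<in>{0..T}. W t \<in> measurable (F t) (Rd d)) \<and>
     (\<forall>s t. 0 \<le> s \<and> s < t \<and> t \<le> T \<longrightarrow>
        prob_space.indep_set P (sets (F s))
          {(\<lambda>\<omega>. vdiff d (W t \<omega>) (W s \<omega>)) -` A \<inter> space P | A. A \<in> sets (Rd d)})"


section \<open>Ito integral and the BSDE\<close>

definition simple_process ::
  "'a measure \<Rightarrow> (real \<Rightarrow> 'a measure) \<Rightarrow> nat \<Rightarrow> real \<Rightarrow> real \<Rightarrow>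
   nat \<Rightarrow> (nat \<Rightarrow> real) \<Rightarrow> (nat \<Rightarrow> 'a \<Rightarrow> nat \<Rightarrow> real) \<Rightarrow> bool" where
  "simple_process P F d a b m \<tau> H \<longleftrightarrow>
     \<tau> 0 = a \<and> \<tau> m = b \<and> (\<forall>k<m. \<tau> k < \<tau> (Suc k)) \<and>
     (\<forall>k<m. \<forall>i<d. (\<lambda>\<omega>. H k \<omega> i) \<in> borel_measurable (F (\<tau> k))) \<and>
     (\<exists>C. \<forall>k<m. \<forall>i<d. \<forall>\<omega>\<in>space P. \<bar>H k \<omega> i\<bar> \<le> C)"

definition simple_value ::
  "nat \<Rightarrow> (nat \<Rightarrow> real) \<Rightarrow> (nat \<Rightarrow> 'a \<Rightarrow> nat \<Rightarrow> real) \<Rightarrow> real \<Rightarrow> 'a \<Rightarrow> nat \<Rightarrow> real" where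
  "simple_value m \<tau> H s \<omega> i = (\<Sum>k<m. indicator {\<tau> k<..\<tau> (Suc k)} s * H k \<omega> i)"

definition simple_integral ::
  "nat \<Rightarrow> (real \<Rightarrow> 'a \<Rightarrow> nat \<Rightarrow> real) \<Rightarrow>
   nat \<Rightarrow> (nat \<Rightarrow> real) \<Rightarrow> (nat \<Rightarrow> 'a \<Rightarrow> nat \<Rightarrow> real) \<Rightarrow> 'a \<Rightarrow> real" where
  "simple_integral d W m \<tau> H \<omega> =
     (\<Sum>k<m. \<Sum>i<d. H k \<omega> i * (W (\<tau> (Suc k)) \<omega> i - W (\<tau> k) \<omega> i))"

text \<open>
  \<open>I\<close> is (a version of) the Ito integral of \<open>Z\<close> over \<open>[a,b]\<close>: the mean-square limit of the
  integrals of simple processes that approximate \<open>Z\<close> in \<open>L\<^sup>2(dt \<otimes> dP)\<close>.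
\<close>

definition has_ito_integral ::
  "'a measure \<Rightarrow> (real \<Rightarrow> 'a measure) \<Rightarrow> nat \<Rightarrow> (real \<Rightarrow> 'a \<Rightarrow> nat \<Rightarrow> real) \<Rightarrow>
   real \<Rightarrow> real \<Rightarrow> (real \<Rightarrow> 'a \<Rightarrow> nat \<Rightarrow> real) \<Rightarrow> ('a \<Rightarrow> real) \<Rightarrow> bool" where
  "has_ito_integral P F d W a b Z I \<longleftrightarrow>
     I \<in> borel_measurable P \<and>
     (\<exists>m \<tau> H.
        (\<forall>N. simple_process P F d a b (m N) (\<tau> N) (H N)) \<and>
        (\<lambda>N::nat. \<integral>\<^sup>+\<omega>. (\<integral>\<^sup>+s\<in>{a<..<b}.
            ennreal (\<Sum>i<d. (Z s \<omega> i - simple_value (m N) (\<tau> N) (H N) s \<omega> i)\<^sup>2) \<partial>lborel) \<partial>P)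
          \<longlonglongrightarrow> 0 \<and>
        (\<lambda>N. \<integral>\<^sup>+\<omega>. ennreal ((I \<omega> - simple_integral d W (m N) (\<tau> N) (H N) \<omega>)\<^sup>2) \<partial>P)
          \<longlonglongrightarrow> 0)"

definition sq_integrable_adapted ::
  "'a measure \<Rightarrow> (real \<Rightarrow> 'a measure) \<Rightarrow> real set \<Rightarrow> (real \<Rightarrow> 'a \<Rightarrow> real) \<Rightarrow> bool" where
  "sq_integrable_adapted P F J X \<longleftrightarrow>
     (\<forall>t\<in>J. X t \<in> borel_measurable (F t)) \<and>
     (\<lambda>(t, \<omega>). indicator J t * X t \<omega>) \<in> borel_measurable (lborel \<Otimes>\<^sub>M P) \<and>
     integrable (lborel \<Otimes>\<^sub>M P) (\<lambda>(t, \<omega>). indicator J t * (X t \<omega>)\<^sup>2)"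

text \<open>The value \<open>Z T\<close> plays no role: the representation of \<open>Z\<close> is only available on \<open>[0,T)\<close>.\<close>

definition bsde_solution ::
  "'a measure \<Rightarrow> (real \<Rightarrow> 'a measure) \<Rightarrow> real \<Rightarrow> nat \<Rightarrow> (real \<Rightarrow> 'a \<Rightarrow> nat \<Rightarrow> real) \<Rightarrow>
   (real \<Rightarrow> real \<Rightarrow> real) \<Rightarrow> ((nat \<Rightarrow> real) \<Rightarrow> real) \<Rightarrow>
   (real \<Rightarrow> 'a \<Rightarrow> real) \<Rightarrow> (real \<Rightarrow> 'a \<Rightarrow> nat \<Rightarrow> real) \<Rightarrow> bool" where
  "bsde_solution P F T d W f \<phi> Y Z \<longleftrightarrow>
     sq_integrable_adapted P F {0..T} Y \<and>
     (\<forall>i<d. sq_integrable_adapted P F {0..<T} (\<lambda>t \<omega>. Z t \<omega> i)) \<and>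
     (\<forall>t\<in>{0..T}. \<exists>I. has_ito_integral P F d W t T Z I \<and>
        (AE \<omega> in P. Y t \<omega> = \<phi> (W T \<omega>) + (LBINT s:{t..T}. f s (Y s \<omega>)) - I \<omega>))"

definition bsde_unique_solution ::
  "'a measure \<Rightarrow> (real \<Rightarrow> 'a measure) \<Rightarrow> real \<Rightarrow> nat \<Rightarrow> (real \<Rightarrow> 'a \<Rightarrow> nat \<Rightarrow> real) \<Rightarrow>
   (real \<Rightarrow> real \<Rightarrow> real) \<Rightarrow> ((nat \<Rightarrow> real) \<Rightarrow> real) \<Rightarrow>
   (real \<Rightarrow> 'a \<Rightarrow> real) \<Rightarrow> (real \<Rightarrow> 'a \<Rightarrow> nat \<Rightarrow> real) \<Rightarrow> bool" where
  "bsde_unique_solution P F T d W f \<phi> Y Z \<longleftrightarrow>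
     bsde_solution P F T d W f \<phi> Y Z \<and>
     (\<forall>Y' Z'. bsde_solution P F T d W f \<phi> Y' Z' \<longrightarrow>
        (\<forall>t\<in>{0..T}. AE \<omega> in P. Y' t \<omega> = Y t \<omega>) \<and>
        (AE p in lborel \<Otimes>\<^sub>M P. fst p \<in> {0..<T} \<longrightarrow>
           (\<forall>i<d. Z' (fst p) (snd p) i = Z (fst p) (snd p) i)))"

definition is_gradient ::
  "nat \<Rightarrow> ((nat \<Rightarrow> real) \<Rightarrow> real) \<Rightarrow> ((nat \<Rightarrow> real) \<Rightarrow> nat \<Rightarrow> real) \<Rightarrow> bool" where
  "is_gradient d u g \<longleftrightarrow>
     (\<forall>x\<in>space (Rd d). \<forall>i<d. ((\<lambda>h. u (x(i := h))) has_real_derivative g x i) (at (x i)))"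

text \<open>
  \<open>\<partial>\<^sub>t y + 1/2 \<Delta>\<^sub>x y + f(t,y) = 0\<close> on \<open>[0,T)\<close> with terminal value \<open>\<phi>\<close>, where \<open>z = \<nabla>\<^sub>x y\<close>.
\<close>

definition pde_solution ::
  "real \<Rightarrow> nat \<Rightarrow> (real \<Rightarrow> real \<Rightarrow> real) \<Rightarrow> ((nat \<Rightarrow> real) \<Rightarrow> real) \<Rightarrow>
   (real \<Rightarrow> (nat \<Rightarrow> real) \<Rightarrow> real) \<Rightarrow> (real \<Rightarrow> (nat \<Rightarrow> real) \<Rightarrow> nat \<Rightarrow> real) \<Rightarrow> bool" where
  "pde_solution T d f \<phi> y z \<longleftrightarrow>
     (\<forall>x\<in>space (Rd d). y T x = \<phi> x) \<and>
     (\<forall>t\<in>{0..<T}. is_gradient d (y t) (z t)) \<and>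
     (\<forall>t\<in>{0..<T}. \<forall>x\<in>space (Rd d). \<exists>yt yxx.
        ((\<lambda>s. y s x) has_real_derivative yt) (at t within {0..T}) \<and>
        (\<forall>i<d. ((\<lambda>h. z t (x(i := h)) i) has_real_derivative yxx i) (at (x i))) \<and>
        yt + 1 / 2 * (\<Sum>i<d. yxx i) + f t (y t x) = 0)"

definition F_fun ::
  "'a measure \<Rightarrow> nat \<Rightarrow> (real \<Rightarrow> 'a \<Rightarrow> nat \<Rightarrow> real) \<Rightarrow> (real \<Rightarrow> real \<Rightarrow> real) \<Rightarrow>
   (real \<Rightarrow> (nat \<Rightarrow> real) \<Rightarrow> real) \<Rightarrow> real \<Rightarrow> (nat \<Rightarrow> real) \<Rightarrow> real \<Rightarrow> real" where
  "F_fun P d W f y t x s = (\<integral>\<omega>. f s (y s (vadd d x (W (s - t) \<omega>))) \<partial>P)"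

text \<open>The \<open>i\<close>-th component of \<open>G\<^sub>t(s)\<close>; meaningful for \<open>s > t\<close> only.\<close>

definition G_fun ::
  "'a measure \<Rightarrow> nat \<Rightarrow> (real \<Rightarrow> 'a \<Rightarrow> nat \<Rightarrow> real) \<Rightarrow> (real \<Rightarrow> real \<Rightarrow> real) \<Rightarrow>
   (real \<Rightarrow> (nat \<Rightarrow> real) \<Rightarrow> real) \<Rightarrow> real \<Rightarrow> (nat \<Rightarrow> real) \<Rightarrow> nat \<Rightarrow> real \<Rightarrow> real" where
  "G_fun P d W f y t x i s =
     (\<integral>\<omega>. f s (y s (vadd d x (W (s - t) \<omega>))) * (W (s - t) \<omega> i / (s - t)) \<partial>P)"

definition feynman_kac ::
  "'a measure \<Rightarrow> real \<Rightarrow> nat \<Rightarrow> (real \<Rightarrow> 'a \<Rightarrow> nat \<Rightarrow> real) \<Rightarrow>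
   (real \<Rightarrow> real \<Rightarrow> real) \<Rightarrow> ((nat \<Rightarrow> real) \<Rightarrow> real) \<Rightarrow>
   (real \<Rightarrow> (nat \<Rightarrow> real) \<Rightarrow> real) \<Rightarrow> bool" where
  "feynman_kac P T d W f \<phi> y \<longleftrightarrow>
     (\<forall>t\<in>{0..T}. \<forall>x\<in>space (Rd d).
        y t x = (\<integral>\<omega>. \<phi> (vadd d x (W (T - t) \<omega>)) \<partial>P) + (LBINT s:{t..T}. F_fun P d W f y t x s))"

text \<open>
  The standing assumptions on the BSDE, including the Borel measurability of \<open>f\<close>, \<open>\<phi>\<close>, \<open>y\<close> that
  is implicit in taking expectations.
\<close>

definition bsde_setting ::
  "'a measure \<Rightarrow> (real \<Rightarrow> 'a measure) \<Rightarrow> real \<Rightarrow> nat \<Rightarrow> (real \<Rightarrow> 'a \<Rightarrow> nat \<Rightarrow> real) \<Rightarrow>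
   (real \<Rightarrow> real \<Rightarrow> real) \<Rightarrow> ((nat \<Rightarrow> real) \<Rightarrow> real) \<Rightarrow>
   (real \<Rightarrow> (nat \<Rightarrow> real) \<Rightarrow> real) \<Rightarrow> (real \<Rightarrow> (nat \<Rightarrow> real) \<Rightarrow> nat \<Rightarrow> real) \<Rightarrow> bool" where
  "bsde_setting P F T d W f \<phi> y z \<longleftrightarrow>
     prob_space P \<and> usual_filtration P T F \<and> brownian_motion_wrt P F T d W \<and>
     (\<lambda>(s, u). f s u) \<in> borel_measurable (restrict_space borel {0..T} \<Otimes>\<^sub>M borel) \<and>
     \<phi> \<in> borel_measurable (Rd d) \<and>
     (\<lambda>(s, x). y s x) \<in> borel_measurable (restrict_space borel {0..T} \<Otimes>\<^sub>M Rd d) \<and>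
     bsde_unique_solution P F T d W f \<phi> (\<lambda>t \<omega>. y t (W t \<omega>)) (\<lambda>t \<omega>. z t (W t \<omega>)) \<and>
     pde_solution T d f \<phi> y z \<and>
     feynman_kac P T d W f \<phi> y"

text \<open>\<open>D k\<close> is the \<open>k\<close>-th derivative of \<open>g\<close> on \<open>S\<close>, one-sided at end points belonging to \<open>S\<close>.\<close>

definition derivatives_on ::
  "real set \<Rightarrow> (real \<Rightarrow> real) \<Rightarrow> (nat \<Rightarrow> real \<Rightarrow> real) \<Rightarrow> bool" where
  "derivatives_on S g D \<longleftrightarrow>
     (\<forall>s\<in>S. D 0 s = g s) \<and>
     (\<forall>k. \<forall>s\<in>S. (D k has_real_derivative D (Suc k) s) (at s within S))"


section \<open>Gauss-Legendre quadrature\<close>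

text \<open>Rodrigues' formula.\<close>

definition legendre_poly :: "nat \<Rightarrow> real poly" where
  "legendre_poly Q = smult (1 / (2 ^ Q * fact Q)) ((pderiv ^^ Q) ([:-1, 0, 1:] ^ Q))"

text \<open>
  Nodes \<open>\<xi> j\<close> and weights \<open>\<beta> j\<close>, \<open>1 \<le> j \<le> Q\<close>, of the rule on \<open>[-1,1]\<close>: the \<open>Q\<close> zeros of the
  Legendre polynomial and the integrals of the associated Lagrange basis polynomials.
\<close>

definition gauss_legendre :: "nat \<Rightarrow> (nat \<Rightarrow> real) \<Rightarrow> (nat \<Rightarrow> real) \<Rightarrow> bool" where
  "gauss_legendre Q \<xi> \<beta> \<longleftrightarrow>
     inj_on \<xi> {1..Q} \<and>
     (\<forall>j\<in>{1..Q}. \<xi> j \<in> {-1..1} \<and> poly (legendre_poly Q) (\<xi> j) = 0 \<and>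
        \<beta> j = integral {-1..1} (\<lambda>u. \<Prod>k\<in>{1..Q} - {j}. (u - \<xi> k) / (\<xi> j - \<xi> k)))"

text \<open>Affine transport of the rule to \<open>[t,T]\<close>.\<close>

definition gl_node :: "real \<Rightarrow> (nat \<Rightarrow> real) \<Rightarrow> real \<Rightarrow> nat \<Rightarrow> real" where
  "gl_node T \<xi> t j = t + (T - t) / 2 * (\<xi> j + 1)"

definition gl_weight :: "real \<Rightarrow> (nat \<Rightarrow> real) \<Rightarrow> real \<Rightarrow> nat \<Rightarrow> real" where
  "gl_weight T \<beta> t j = (T - t) / 2 * \<beta> j"


section \<open>The multilevel Picard scheme\<close>

text \<open>
  Realizations of the random fields are labelled by paths.  The realization of \<open>y\<^sub>n\<close> with label
  \<open>\<theta>\<close> is driven by its own Brownian motions \<open>B \<theta> n i\<close>; its copies \<open>y\<^sup>i\<^sub>n\<^sub>-\<^sub>1(t,x)\<close> carry the labels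
  \<open>\<theta> @ [Copy i]\<close>, and the realization of \<open>y\<^sub>n\<^sub>-\<^sub>1\<close> used in the \<open>(i,j)\<close>-th summand of the correction
  carries the label \<open>\<theta> @ [Eval i j]\<close>.  The paired \<open>y\<^sub>n\<^sub>-\<^sub>2\<close> is the copy numbered \<open>\<kappa> (\<theta> @ [Eval i j])\<close>
  among those from which that realization of \<open>y\<^sub>n\<^sub>-\<^sub>1\<close> is computed.
\<close>

datatype branch = Copy nat | Eval nat nat

fun mlp ::
  "real \<Rightarrow> nat \<Rightarrow> nat \<Rightarrow> nat \<Rightarrow> (nat \<Rightarrow> real) \<Rightarrow> (nat \<Rightarrow> real) \<Rightarrow>
   (real \<Rightarrow> real \<Rightarrow> real) \<Rightarrow> ((nat \<Rightarrow> real) \<Rightarrow> real) \<Rightarrow>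
   (branch list \<Rightarrow> nat) \<Rightarrow> (branch list \<Rightarrow> nat \<Rightarrow> nat \<Rightarrow> real \<Rightarrow> 'b \<Rightarrow> nat \<Rightarrow> real) \<Rightarrow>
   nat \<Rightarrow> branch list \<Rightarrow> real \<Rightarrow> (nat \<Rightarrow> real) \<Rightarrow> 'b \<Rightarrow> real" where
  "mlp T d M Q \<xi> \<beta> f \<phi> \<kappa> B 0 \<theta> t x \<omega> = 0"
| "mlp T d M Q \<xi> \<beta> f \<phi> \<kappa> B (Suc 0) \<theta> t x \<omega> =
     1 / real M * (\<Sum>i = 1..M. \<phi> (vadd d x (B \<theta> 1 i (T - t) \<omega>))) +
     (\<Sum>j = 1..Q. gl_weight T \<beta> t j * f (gl_node T \<xi> t j) 0)"
| "mlp T d M Q \<xi> \<beta> f \<phi> \<kappa> B (Suc (Suc n)) \<theta> t x \<omega> =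
     1 / real M * (\<Sum>i = 1..M. mlp T d M Q \<xi> \<beta> f \<phi> \<kappa> B (Suc n) (\<theta> @ [Copy i]) t x \<omega>) +
     (\<Sum>j = 1..Q. gl_weight T \<beta> t j / real M * (\<Sum>i = 1..M.
        f (gl_node T \<xi> t j)
          (mlp T d M Q \<xi> \<beta> f \<phi> \<kappa> B (Suc n) (\<theta> @ [Eval i j]) (gl_node T \<xi> t j)
            (vadd d x (B \<theta> (Suc (Suc n)) i (gl_node T \<xi> t j - t) \<omega>)) \<omega>)
        - f (gl_node T \<xi> t j)
          (mlp T d M Q \<xi> \<beta> f \<phi> \<kappa> B n (\<theta> @ [Eval i j, Copy (\<kappa> (\<theta> @ [Eval i j]))]) (gl_node T \<xi> t j)
            (vadd d x (B \<theta> (Suc (Suc n)) i (gl_node T \<xi> t j - t) \<omega>)) \<omega>)))"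

definition independent_brownian_motions ::
  "'b measure \<Rightarrow> real \<Rightarrow> nat \<Rightarrow>
   (branch list \<Rightarrow> nat \<Rightarrow> nat \<Rightarrow> real \<Rightarrow> 'b \<Rightarrow> nat \<Rightarrow> real) \<Rightarrow> bool" where
  "independent_brownian_motions N T d B \<longleftrightarrow>
     prob_space N \<and>
     (\<forall>\<theta> n i. brownian_motion N T d (B \<theta> n i)) \<and>
     prob_space.indep_vars N (\<lambda>_. \<Pi>\<^sub>M t\<in>{0..T}. Rd d)
       (\<lambda>(\<theta>, n, i) \<omega>. \<lambda>t\<in>{0..T}. B \<theta> n i t \<omega>) (UNIV :: (branch list \<times> nat \<times> nat) set)"

end

theory Submission
  imports Defs
begin

text \<open>
  Let \<open>V n t\<close> bound the standard deviation of every realization of \<open>y\<^sub>n(t,x)\<close>, and let \<open>D n t\<close> bound the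
  mean-square distance between \<open>y\<^sub>n(t,x)\<close> and a copy of \<open>y\<^sub>n\<^sub>-\<^sub>1(t,x)\<close> from which it is computed. The field
  \<open>y\<^sub>n\<close> is a mean of \<open>M\<close> independent variables, each of which is a copy of \<open>y\<^sub>n\<^sub>-\<^sub>1\<close> plus a quadrature sum of
  differences of \<open>f\<close>. The Lipschitz condition and Minkowski's inequality give, with the weights \<open>w j\<close> and
  nodes \<open>s j\<close> on \<open>[t,T]\<close>,

  \<open>sqrt M * V n t \<le> V (n-1) t + Cf * (\<Sum>j. w j * D (n-1) (s j))\<close> and
  \<open>D n t \<le> V n t + V (n-1) t + Cf * (\<Sum>j. w j * D (n-1) (s j))\<close>.

  These sums have to be compared with integrals. A Gauss rule with \<open>Q\<close> nodes never overestimates the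
  integral of a function whose derivative of order \<open>2Q\<close> is non-negative, by the formula for its error
  (\<open>gl_le_integral\<close>). Applied to the exponential with rate \<open>Cf * sqrt M\<close>, a quadrature sum is at most the
  value at \<open>t\<close> divided by \<open>Cf * sqrt M\<close>. With \<open>r = C1 / sqrt M\<close> and
  \<open>E t = exp (Cf * sqrt M * (T - t))\<close> the bounds \<open>V n t \<le> r^n * E t\<close> and \<open>D n t \<le> 2 * C1 * r^(n-1) * E t\<close>
  then reproduce themselves (\<open>second_moments\<close>): the distance is larger than the fluctuation by one power
  of \<open>r\<close>, which the factor \<open>1 / sqrt M\<close> gained by the quadrature sum compensates.

  For the bias, all realizations of a field have the same law (\<open>Yn_law\<close>): interchanging the labels of
  two copies turns one pairing rule into another and preserves the joint law of the motions. Hence the corrections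
  telescope in expectation, and the mean of \<open>y\<^sub>n(t,x)\<close> satisfies the Feynman-Kac formula with the integral
  replaced by the quadrature sum and with \<open>y\<^sub>n\<^sub>-\<^sub>1\<close> in \<open>f\<close> (\<open>mean_recursion\<close>). The bias at level \<open>n\<close> is thus
  at most the quadrature error of \<open>F\<^sub>t\<close> plus \<open>Cf\<close> times the quadrature sum of bias and standard deviation at
  level \<open>n - 1\<close>. Since the rule does not overestimate the integrals of \<open>(T - s)^k\<close> either, iteration
  gives the Picard term \<open>Cy * (Cf * (T - t))^n / n!\<close>, at most \<open>exp (Cf * T)\<close> quadrature errors, and a
  geometric term from the fluctuations (\<open>bias_bound\<close>).

  The quadrature error itself is the integral of the Hermite remainder. It is governed by
  \<open>1 / (2Q)!\<close> and the integral of the squared monic Legendre polynomial, which Rodrigues' formula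
  bounds by \<open>2\<close> over the central binomial coefficient (\<open>gl_error_le\<close>).
\<close>

section \<open>Hermite interpolation\<close>

text \<open>
  Rolle's theorem between consecutive elements of \<open>Z\<close>. The zeros of the derivative lie strictly
  between those of \<open>g\<close>, hence off \<open>Z\<close>; this disjointness lets a remainder argument with double zeros
  add the elements of \<open>Z\<close> at which the derivative vanishes as well.
\<close>

lemma rolle_zeros:
  fixes g g' :: "real \<Rightarrow> real"
  assumes "finite Z" "Z \<noteq> {}" "Z \<subseteq> {a..b}" "\<And>z. z \<in> Z \<Longrightarrow> g z = 0"
    and der: "\<And>s. s \<in> {a..b} \<Longrightarrow> (g has_real_derivative g' s) (at s within {a..b})"
  shows "\<exists>Z'. finite Z' \<and> Z' \<subseteq> {a..b} \<and> Z' \<inter> Z = {} \<and> card Z = Suc (card Z') \<and>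
    (\<forall>z\<in>Z'. g' z = 0 \<and> z < Max Z)"
  using assms(1-4)
proof (induction Z rule: finite_linorder_max_induct)
  case empty
  then show ?case by simp
next
  case (insert m A)
  show ?case
  proof (cases "A = {}")
    case True
    then show ?thesis by (intro exI[of _ "{}"]) auto
  next
    case False
    have "\<exists>Z'. finite Z' \<and> Z' \<subseteq> {a..b} \<and> Z' \<inter> A = {} \<and> card A = Suc (card Z') \<and>
        (\<forall>z\<in>Z'. g' z = 0 \<and> z < Max A)"
      by (rule insert.IH[OF False]) (use insert.prems in auto)
    then obtain Z' where Z': "finite Z'" "Z' \<subseteq> {a..b}" "Z' \<inter> A = {}" "card A = Suc (card Z')"
      "\<And>z. z \<in> Z' \<Longrightarrow> g' z = 0 \<and> z < Max A" by blast
    define l where "l = Max A"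
    have l: "l \<in> A" "\<And>z. z \<in> A \<Longrightarrow> z \<le> l" "l < m"
      using insert(1,2) False by (auto simp: l_def)
    have lm: "a \<le> l" "m \<le> b" using l insert.prems by auto
    have "\<exists>z. l < z \<and> z < m \<and> (\<lambda>v. g' z * v) = (\<lambda>v. 0)"
    proof (rule Rolle_deriv)
      show "g l = g m" using insert.prems l by auto
      show "continuous_on {l..m} g"
        by (rule continuous_on_subset[of "{a..b}"])
           (use lm in \<open>auto intro!: DERIV_continuous_on[OF der]\<close>)
      fix x assume "l < x" "x < m"
      then have "x \<in> interior {a..b}" "x \<in> {a..b}" using lm by auto
      then show "(g has_derivative (*) (g' x)) (at x)"
        using der[of x] at_within_interior[of x "{a..b}"] by (metis has_field_derivative_def)
    qed fact
    then obtain z where z: "l < z" "z < m" "g' z = 0" by (metis mult.right_neutral)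
    have "Max (insert m A) = m" using insert(1,2) by (intro Max_eqI) (auto simp: less_imp_le)
    moreover have "z \<notin> Z'" using Z'(5)[of z] z by (auto simp: l_def)
    moreover have "m \<notin> A" using insert by auto
    moreover have "m \<notin> Z'" using Z'(5)[of m] l by (auto simp: l_def)
    moreover have "z \<notin> A" using l z by force
    ultimately show ?thesis using Z' z l lm insert(1)
      by (intro exI[of _ "insert z Z'"]) (force simp: l_def)
  qed
qed

lemma iterated_rolle:
  fixes H :: "nat \<Rightarrow> real \<Rightarrow> real"
  assumes "\<And>k s. s \<in> {a..b} \<Longrightarrow> (H k has_real_derivative H (Suc k) s) (at s within {a..b})"
    and "finite Z" "Z \<subseteq> {a..b}" "card Z = Suc m" "\<And>z. z \<in> Z \<Longrightarrow> H k z = 0"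
  shows "\<exists>\<eta>\<in>{a..b}. H (k + m) \<eta> = 0"
  using assms(2-)
proof (induction m arbitrary: k Z)
  case 0
  then obtain z where "Z = {z}" by (metis card_1_singletonE One_nat_def)
  then show ?case using 0 by auto
next
  case (Suc m)
  have "Z \<noteq> {}" using Suc.prems by auto
  from rolle_zeros[OF Suc.prems(1) this Suc.prems(2,4) assms(1)[of _ k]]
  obtain Z' where Z': "finite Z'" "Z' \<subseteq> {a..b}" "card Z = Suc (card Z')" "\<And>z. z \<in> Z' \<Longrightarrow> H (Suc k) z = 0"
    by blast
  have "\<exists>\<eta>\<in>{a..b}. H (Suc k + m) \<eta> = 0"
    using Z' Suc.prems(3) by (intro Suc.IH[of Z']) auto
  then show ?case by simp
qed

definition node_poly :: "real set \<Rightarrow> real poly" where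
  "node_poly S = (\<Prod>s\<in>S. [:- s, 1:])"

lemma poly_node_poly: "poly (node_poly S) u = (\<Prod>s\<in>S. u - s)"
  by (simp add: node_poly_def poly_prod)

lemma node_poly_monic:
  assumes "finite S"
  shows "degree (node_poly S) = card S" "coeff (node_poly S) (card S) = 1" "node_poly S \<noteq> 0"
  using assms lead_coeff_prod[of "\<lambda>s. [:- s, 1:]" S]
  by (simp_all add: node_poly_def degree_prod_eq_sum_degree)

text \<open>
  One node at a time: adding a multiple of the squared node polynomial of the old nodes changes
  neither values nor derivatives there, and a linear factor has the two free coefficients that the
  new node requires.
\<close>

lemma hermite_interpolation:
  fixes u v :: "real \<Rightarrow> real"
  assumes "finite S"
  shows "\<exists>p. degree p \<le> 2 * card S - 1 \<and> (\<forall>s\<in>S. poly p s = u s \<and> poly (pderiv p) s = v s)"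
  using assms
proof (induction S)
  case empty
  then show ?case by (auto intro: exI[of _ 0])
next
  case (insert x S)
  then obtain p where p: "degree p \<le> 2 * card S - 1"
    "\<And>s. s \<in> S \<Longrightarrow> poly p s = u s \<and> poly (pderiv p) s = v s" by auto
  define w where "w = (node_poly S)^2"
  have wx: "poly w x \<noteq> 0" using insert by (auto simp: w_def poly_node_poly)
  have ws: "poly w s = 0" "poly (pderiv w) s = 0" if "s \<in> S" for s
    using that insert by (auto simp: w_def poly_node_poly pderiv_mult power2_eq_square)
  have degw: "degree w \<le> 2 * card S" using degree_power_le[of "node_poly S" 2] node_poly_monic[OF insert(1)]
    by (simp add: w_def)
  define c where "c = (u x - poly p x) / poly w x"
  define d where "d = (v x - poly (pderiv p) x - c * poly (pderiv w) x) / poly w x"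
  define q where "q = p + w * [:c - d * x, d:]"
  have "degree (w * [:c - d * x, d:]) \<le> 2 * card S + 1"
    using degree_mult_le[of w "[:c - d * x, d:]"] degw by (auto split: if_splits)
  then have "degree q \<le> 2 * card (insert x S) - 1"
    unfolding q_def using insert p(1) by (intro degree_add_le) auto
  moreover have "poly q s = u s \<and> poly (pderiv q) s = v s" if "s \<in> S" for s
    using p(2)[OF that] ws[OF that] by (simp add: q_def pderiv_add pderiv_mult del: mult_pCons_right)
  moreover have "poly q x = u x \<and> poly (pderiv q) x = v x"
    using wx by (simp add: q_def pderiv_add pderiv_mult c_def d_def pderiv_pCons field_simps del: mult_pCons_right)
  ultimately show ?case by (intro exI[of _ q]) auto
qed

lemma higher_pderiv_degree_le:
  fixes q :: "real poly"
  assumes "degree q \<le> n"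
  shows "(pderiv ^^ n) q = [:fact n * coeff q n:]"
proof (rule poly_eqI)
  fix i
  show "coeff ((pderiv ^^ n) q) i = coeff [:fact n * coeff q n:] i"
  proof (cases i)
    case 0
    then show ?thesis by (simp add: coeff_higher_pderiv pochhammer_fact)
  next
    case (Suc j)
    then show ?thesis using assms by (simp add: coeff_higher_pderiv coeff_eq_0)
  qed
qed

text \<open>
  With \<open>c\<close> chosen so that \<open>g - p - c * (node_poly S)^2\<close> also vanishes at \<open>s\<close>, Rolle gives zeros of its
  first derivative between the \<open>Q + 1\<close> points of \<open>insert s S\<close>, in addition to the \<open>Q\<close> nodes. These
  \<open>2 * Q\<close> zeros leave one zero of the \<open>2 * Q\<close>-th derivative, which determines \<open>c\<close>.
\<close>

lemma hermite_remainder: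
  assumes S: "finite S" "S \<subseteq> {a..b}" "card S = Q" "Q \<ge> 1"
    and D: "derivatives_on {a..b} g D"
    and p: "degree p \<le> 2 * Q - 1" "\<And>s. s \<in> S \<Longrightarrow> poly p s = g s \<and> poly (pderiv p) s = D 1 s"
    and s: "s \<in> {a..b}"
  shows "\<exists>\<eta>\<in>{a..b}. g s - poly p s = D (2 * Q) \<eta> / fact (2 * Q) * (poly (node_poly S) s)\<^sup>2"
proof (cases "s \<in> S")
  case True
  then show ?thesis using p s S by (intro bexI[of _ s]) (auto simp: poly_node_poly)
next
  case False
  define w where "w = (node_poly S)^2"
  have ws: "poly w s \<noteq> 0" using False S(1) by (auto simp: w_def poly_node_poly)
  \<comment> \<open>the multiple of \<open>w\<close> that makes \<open>s\<close> a further zero of the interpolation error\<close>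
  define c where "c = (g s - poly p s) / poly w s"
  define q where "q = p + smult c w"
  define H where "H = (\<lambda>k u. D k u - poly ((pderiv ^^ k) q) u)"
  have der: "(H k has_real_derivative H (Suc k) u) (at u within {a..b})" if "u \<in> {a..b}" for k u
    using D that unfolding H_def derivatives_on_def
    by (auto intro!: derivative_eq_intros)
  have D0: "D 0 u = g u" if "u \<in> {a..b}" for u using D that by (auto simp: derivatives_on_def)
  have w0: "poly w u = 0" "poly (pderiv w) u = 0" if "u \<in> S" for u
    using that S(1) by (auto simp: w_def poly_node_poly pderiv_mult power2_eq_square)
  have H0: "H 0 u = 0" if "u \<in> insert s S" for u
  proof -
    have "u \<in> {a..b}" using that s S(2) by auto
    then show ?thesis using that p(2)[of u] w0(1)[of u] ws by (auto simp: H_def D0 q_def c_def)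
  qed
  have H1: "H 1 u = 0" if "u \<in> S" for u
    using p(2)[OF that] w0[OF that] by (simp add: H_def q_def pderiv_add pderiv_smult)
  obtain Z' where Z': "finite Z'" "Z' \<subseteq> {a..b}" "Z' \<inter> insert s S = {}"
      "card (insert s S) = Suc (card Z')" "\<And>z. z \<in> Z' \<Longrightarrow> H 1 z = 0"
  proof -
    have "\<exists>Z'. finite Z' \<and> Z' \<subseteq> {a..b} \<and> Z' \<inter> insert s S = {} \<and> card (insert s S) = Suc (card Z') \<and>
        (\<forall>z\<in>Z'. H 1 z = 0 \<and> z < Max (insert s S))"
    proof (rule rolle_zeros)
      show "finite (insert s S)" "insert s S \<noteq> {}" "insert s S \<subseteq> {a..b}" using S s by auto
      show "H 0 z = 0" if "z \<in> insert s S" for z by (rule H0[OF that])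
      show "(H 0 has_real_derivative H 1 u) (at u within {a..b})" if "u \<in> {a..b}" for u
        using der[OF that, of 0] by simp
    qed
    then show thesis using that by blast
  qed
  have "card (Z' \<union> S) = Suc (2 * Q - 1)"
    using Z' S False by (subst card_Un_disjoint) auto
  then have "\<exists>\<eta>\<in>{a..b}. H (1 + (2 * Q - 1)) \<eta> = 0"
    using Z' S H1 by (intro iterated_rolle[where Z = "Z' \<union> S"] der) auto
  then obtain \<eta> where \<eta>: "\<eta> \<in> {a..b}" "H (2 * Q) \<eta> = 0" using S(4) by auto
  have degw: "degree w = 2 * Q" "coeff w (2 * Q) = 1"
  proof -
    show deg: "degree w = 2 * Q"
      using node_poly_monic[OF S(1)] S(3) by (simp add: w_def degree_power_eq)
    show "coeff w (2 * Q) = 1"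
      using node_poly_monic[OF S(1)] S(3) lead_coeff_power[of "node_poly S" 2] deg by (simp add: w_def)
  qed
  have degq: "degree q \<le> 2 * Q" unfolding q_def
    using p(1) degw by (intro degree_add_le) (auto intro: order_trans[OF degree_smult_le])
  have "coeff p (2 * Q) = 0" using p(1) S(4) by (intro coeff_eq_0) auto
  then have "coeff q (2 * Q) = c" by (simp add: q_def degw)
  then have "D (2 * Q) \<eta> = fact (2 * Q) * c"
    using \<eta>(2) higher_pderiv_degree_le[OF degq] by (simp add: H_def)
  then show ?thesis using ws \<eta>(1) by (intro bexI[of _ \<eta>]) (auto simp: c_def w_def)
qed


section \<open>Error of Gauss-Legendre quadrature\<close>

lemma fact_ge_power_exp: "(real n / exp 1) ^ n \<le> fact n"
proof -
  have "real n ^ n / fact n \<le> exp (real n)"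
    using sum_le_suminf[OF summable_exp, of "{n}" "real n"] by (simp add: exp_def field_simps)
  moreover have "exp (real n) = exp 1 ^ n" by (simp flip: exp_of_nat_mult)
  ultimately show ?thesis by (simp add: power_divide field_simps)
qed

text \<open>
  The induction step is the arithmetic-geometric mean inequality for \<open>n\<close> and \<open>n + 1\<close>.
\<close>

lemma central_binomial_lower: "n \<ge> 1 \<Longrightarrow> 4 ^ n \<le> 2 * sqrt (real n) * real ((2 * n) choose n)"
proof (induction n rule: nat_induct_at_least)
  case base
  then show ?case by simp
next
  case (Suc n)
  have rec: "real (Suc n) * real ((2 * Suc n) choose Suc n) = 2 * (2 * real n + 1) * real ((2 * n) choose n)"
  proof -
    have "Suc n * ((2 * n + 1) choose n) = (2 * n + 1) * ((2 * n) choose n)"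
      using binomial_absorb_comp[of "2 * n + 1" n] by (simp add: mult_2)
    moreover have "Suc n * (Suc (2 * n + 1) choose Suc n) = Suc (2 * n + 1) * ((2 * n + 1) choose n)"
      by (rule Suc_times_binomial)
    moreover have "Suc (2 * n + 1) * c = 2 * (Suc n * c)" for c :: nat by (simp add: algebra_simps)
    ultimately have "Suc n * (Suc (2 * n + 1) choose Suc n) = 2 * ((2 * n + 1) * ((2 * n) choose n))"
      by metis
    moreover have "2 * Suc n = Suc (2 * n + 1)" by simp
    ultimately have "real (Suc n * ((2 * Suc n) choose Suc n)) = real (2 * ((2 * n + 1) * ((2 * n) choose n)))"
      by metis
    then show ?thesis unfolding of_nat_mult of_nat_add by simp
  qed
  have "4 * (sqrt (real n) * sqrt (real (Suc n))) \<le> 2 * (2 * real n + 1)"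
    using arith_geo_mean_sqrt[of "real n" "real (Suc n)"] by (simp add: real_sqrt_mult)
  then have "4 * sqrt (real n) * sqrt (real (Suc n)) * real ((2 * n) choose n)
     \<le> 2 * (2 * real n + 1) * real ((2 * n) choose n)"
    by (intro mult_right_mono) auto
  also have "\<dots> = sqrt (real (Suc n)) * sqrt (real (Suc n)) * real ((2 * Suc n) choose Suc n)"
    by (subst real_sqrt_mult_self) (use rec in simp)
  finally have "4 * sqrt (real n) * real ((2 * n) choose n) \<le> sqrt (real (Suc n)) * real ((2 * Suc n) choose Suc n)"
    by (simp add: mult_ac del: real_sqrt_mult_self)
  then show ?case using Suc.IH by simp
qed

definition pint :: "real poly \<Rightarrow> real" where
  "pint p = integral {-1..1} (poly p)"

lemma poly_integrable: "poly (p :: real poly) integrable_on {a..b}"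
  by (intro integrable_continuous_interval continuous_intros)

lemma pint_add: "pint (p + q) = pint p + pint q"
  unfolding pint_def poly_add by (intro integral_add poly_integrable)

lemma pint_smult: "pint (smult c p) = c * pint p"
proof -
  have "poly (smult c p) = (\<lambda>u. c * poly p u)" by auto
  then show ?thesis by (simp add: pint_def)
qed

lemma pint_0: "pint 0 = 0"
  using pint_smult[of 0 0] by simp

lemma pint_sum: "finite A \<Longrightarrow> pint (\<Sum>a\<in>A. p a) = (\<Sum>a\<in>A. pint (p a))"
  unfolding pint_def poly_sum by (intro integral_sum poly_integrable)

lemma pint_pderiv: "pint (pderiv p) = poly p 1 - poly p (-1)"
proof -
  have "(poly (pderiv p) has_integral (poly p 1 - poly p (-1))) {-1..1}"
    by (intro fundamental_theorem_of_calculus)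
       (auto simp: has_real_derivative_iff_has_vector_derivative[symmetric] intro!: poly_DERIV has_field_derivative_at_within)
  then show ?thesis by (simp add: pint_def integral_unique)
qed

lemma pint_nonneg: "(\<And>u. u \<in> {-1..1} \<Longrightarrow> poly p u \<ge> 0) \<Longrightarrow> pint p \<ge> 0"
  unfolding pint_def by (intro integral_nonneg poly_integrable)

abbreviation rodrigues_base :: "nat \<Rightarrow> real poly" where
  "rodrigues_base Q \<equiv> [:-1, 0, 1:] ^ Q"

lemma rodrigues_base_dvd: "k \<le> Q \<Longrightarrow> [:-1, 0, 1:] ^ (Q - k) dvd (pderiv ^^ k) (rodrigues_base Q)"
proof (induction k)
  case 0
  then show ?case by simp
next
  case (Suc k)
  obtain r where r: "(pderiv ^^ k) (rodrigues_base Q) = [:-1, 0, 1:] ^ (Q - k) * r"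
    using Suc by (auto elim: dvdE)
  have Qk: "Q - k = Suc (Q - Suc k)" using Suc.prems by auto
  have "pderiv ([:-1, 0, 1:] ^ Suc (Q - Suc k) * r) =
      [:-1, 0, 1:] ^ (Q - Suc k) * (smult (of_nat (Suc (Q - Suc k))) (pderiv [:-1, 0, 1:] * r) + [:-1, 0, 1:] * pderiv r)"
    by (subst pderiv_mult, subst pderiv_power_Suc, subst power_Suc)
       (simp only: distrib_left mult_smult_right mult_smult_left mult.assoc mult.left_commute mult.commute add.commute)
  then show ?case by (simp add: r Qk del: power_Suc)
qed

lemma rodrigues_base_boundary:
  assumes "k < Q" shows "poly ((pderiv ^^ k) (rodrigues_base Q)) 1 = 0" "poly ((pderiv ^^ k) (rodrigues_base Q)) (-1) = 0"
proof -
  obtain r where "(pderiv ^^ k) (rodrigues_base Q) = [:-1, 0, 1:] ^ (Q - k) * r"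
    using rodrigues_base_dvd[of k Q] assms by (auto elim: dvdE)
  then show "poly ((pderiv ^^ k) (rodrigues_base Q)) 1 = 0" "poly ((pderiv ^^ k) (rodrigues_base Q)) (-1) = 0"
    using assms by simp_all
qed

text \<open>
  The boundary terms vanish, because \<open>k < Q\<close> differentiations leave a factor \<open>u^2 - 1\<close>.
\<close>

lemma rodrigues_by_parts:
  "k \<le> Q \<Longrightarrow> pint ((pderiv ^^ Q) (rodrigues_base Q) * q)
     = (-1) ^ k * pint ((pderiv ^^ (Q - k)) (rodrigues_base Q) * (pderiv ^^ k) q)"
proof (induction k)
  case 0
  then show ?case by simp
next
  case (Suc k)
  define v where "v = (pderiv ^^ (Q - Suc k)) (rodrigues_base Q)"
  define w where "w = (pderiv ^^ k) q"
  have Qk: "Q - k = Suc (Q - Suc k)" using Suc.prems by auto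
  have "pint (pderiv (v * w)) = 0"
    using rodrigues_base_boundary[of "Q - Suc k" Q] Suc.prems by (simp add: pint_pderiv v_def)
  then have "pint (pderiv v * w) = - pint (v * pderiv w)"
    by (simp add: pderiv_mult pint_add mult.commute)
  then show ?case using Suc by (simp add: Qk v_def w_def)
qed




lemma derivatives_on_continuous:
  assumes "derivatives_on S g D" shows "continuous_on S g"
proof (rule DERIV_continuous_on)
  fix s assume "s \<in> S"
  with assms show "(g has_real_derivative D (Suc 0) s) (at s within S)"
    using has_field_derivative_transform_within[of "D 0" "D (Suc 0) s" s S 1 g]
    by (auto simp: derivatives_on_def)
qed

locale legendre_rule =
  fixes Q :: nat and \<xi> \<beta> :: "nat \<Rightarrow> real"
  assumes gl: "gauss_legendre Q \<xi> \<beta>" and Q1: "Q \<ge> 1"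
begin

(* keeps the index range {1..Q} in the form in which it occurs in the rule *)
declare One_nat_def [simp del]

abbreviation "nodal \<equiv> node_poly (\<xi> ` {1..Q})"

lemma nodes_inj: "inj_on \<xi> {1..Q}" using gl by (simp add: gauss_legendre_def)
lemma card_nodes: "card (\<xi> ` {1..Q}) = Q" using nodes_inj by (simp add: card_image)
lemma degree_nodal: "degree nodal = Q" by (simp add: node_poly_monic card_nodes)
lemma nodal_nonzero: "nodal \<noteq> 0" by (simp add: node_poly_monic)
lemma node_range: "j \<in> {1..Q} \<Longrightarrow> -1 \<le> \<xi> j \<and> \<xi> j \<le> 1" using gl by (auto simp: gauss_legendre_def)

text \<open>
  Both sides have degree \<open>Q\<close>, the same leading coefficient and the nodes as zeros.
\<close>

lemma rodrigues_eq: "(pderiv ^^ Q) (rodrigues_base Q) = smult (fact (2 * Q) / fact Q) nodal"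
proof (rule poly_eqI_degree_lead_coeff[where n = Q and A = "\<xi> ` {1..Q}"])
  let ?u = "rodrigues_base Q"
  have degu: "degree ?u = 2 * Q" "coeff ?u (2 * Q) = 1"
  proof -
    show deg: "degree ?u = 2 * Q" by (simp add: degree_power_eq)
    show "coeff ?u (2 * Q) = 1"
      using lead_coeff_power[of "[:-1,0,1::real:]" Q] unfolding deg by simp
  qed
  show "degree ((pderiv ^^ Q) ?u) \<le> Q" by (simp add: degree_higher_pderiv degu)
  show "degree (smult (fact (2 * Q) / fact Q) nodal) \<le> Q"
    using node_poly_monic[of "\<xi> ` {1..Q}"] card_nodes by simp
  have "pochhammer (real (Suc Q)) Q * fact Q = fact (2 * Q)"
    using pochhammer_product'[of "1::real" Q Q] by (simp add: pochhammer_fact mult_2 add.commute)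
  then show "coeff ((pderiv ^^ Q) ?u) Q = coeff (smult (fact (2 * Q) / fact Q) nodal) Q"
    using node_poly_monic[of "\<xi> ` {1..Q}"] card_nodes degu
    by (simp add: coeff_higher_pderiv mult_2[symmetric] field_simps)
  show "Q \<le> card (\<xi> ` {1..Q})" by (simp add: card_nodes)
  fix z assume "z \<in> \<xi> ` {1..Q}"
  then show "poly ((pderiv ^^ Q) ?u) z = poly (smult (fact (2 * Q) / fact Q) nodal) z"
    using gl by (auto simp: gauss_legendre_def legendre_poly_def poly_node_poly)
qed

lemma orthogonal: "degree q < Q \<Longrightarrow> pint (nodal * q) = 0"
proof -
  assume "degree q < Q"
  then have "(pderiv ^^ Q) q = 0" using higher_pderiv_degree_le[of q Q] by (simp add: coeff_eq_0)
  then have "pint ((pderiv ^^ Q) (rodrigues_base Q) * q) = 0"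
    using rodrigues_by_parts[of Q Q q] by (simp add: pint_0)
  then show ?thesis by (simp add: rodrigues_eq pint_smult)
qed

text \<open>
  Moving all derivatives of Rodrigues' formula onto the second factor, which is monic of degree \<open>Q\<close>,
  leaves \<open>(fact Q)^2 / fact (2 * Q)\<close> times the integral of \<open>(1 - u^2)^Q\<close>. The trivial bound \<open>2\<close> for
  that integral loses only a factor of order \<open>sqrt Q\<close>, which is affordable.
\<close>

lemma pint_node_poly_sq: "pint (nodal\<^sup>2) \<le> 4 * sqrt (real Q) / 4 ^ Q"
proof -
  have "(pderiv ^^ Q) nodal = [:fact Q:]"
    using higher_pderiv_degree_le[of nodal Q] node_poly_monic[of "\<xi> ` {1..Q}"] card_nodes by simp
  then have "pint (smult (fact (2 * Q) / fact Q) nodal * nodal) = (-1) ^ Q * pint (smult (fact Q) (rodrigues_base Q))"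
    using rodrigues_by_parts[of Q Q nodal] by (simp add: rodrigues_eq)
  also have "\<dots> = fact Q * pint (smult ((-1) ^ Q) (rodrigues_base Q))" by (simp only: pint_smult mult_ac)
  also have "pint (smult ((-1) ^ Q) (rodrigues_base Q)) \<le> 2"
  proof -
    have "poly (smult ((-1) ^ Q) (rodrigues_base Q)) u = (1 - u\<^sup>2) ^ Q" for u :: real
      by (simp add: power_mult_distrib[symmetric] power2_eq_square)
    then have "pint (smult ((-1) ^ Q) (rodrigues_base Q)) \<le> integral {-1..1} (\<lambda>u::real. 1)"
      unfolding pint_def using poly_integrable[of "smult ((-1) ^ Q) (rodrigues_base Q)" "-1" 1]
      by (intro integral_le) (auto intro!: power_le_one simp: abs_square_le_1 abs_le_iff simp del: poly_smult)
    then show ?thesis by simp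
  qed
  finally have "fact (2 * Q) / fact Q * pint (nodal\<^sup>2) \<le> fact Q * 2"
    by (simp add: pint_smult power2_eq_square)
  then have "pint (nodal\<^sup>2) * real ((2 * Q) choose Q) \<le> 2"
    by (simp add: binomial_fact mult_2 field_simps)
  moreover have "4 ^ Q \<le> 2 * sqrt (real Q) * real ((2 * Q) choose Q)" using central_binomial_lower[OF Q1] .
  moreover have "pint (nodal\<^sup>2) \<ge> 0" by (intro pint_nonneg) simp
  ultimately have "pint (nodal\<^sup>2) * 4 ^ Q \<le> pint (nodal\<^sup>2) * (2 * sqrt (real Q) * real ((2 * Q) choose Q))"
    "2 * sqrt (real Q) * (pint (nodal\<^sup>2) * real ((2 * Q) choose Q)) \<le> 2 * sqrt (real Q) * 2"
    by (simp_all only: mult_left_mono mult_nonneg_nonneg real_sqrt_ge_zero of_nat_0_le_iff zero_le_numeral)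
  then show ?thesis by (simp add: field_simps)
qed

definition lagrange_basis :: "nat \<Rightarrow> real poly" where
  "lagrange_basis j = (\<Prod>k\<in>{1..Q} - {j}. smult (1 / (\<xi> j - \<xi> k)) [:- \<xi> k, 1:])"

lemma poly_lagrange_basis: "poly (lagrange_basis j) u = (\<Prod>k\<in>{1..Q} - {j}. (u - \<xi> k) / (\<xi> j - \<xi> k))"
  by (simp add: lagrange_basis_def poly_prod diff_divide_distrib)

lemma weight_eq: "j \<in> {1..Q} \<Longrightarrow> \<beta> j = pint (lagrange_basis j)"
  using gl by (simp add: gauss_legendre_def pint_def poly_lagrange_basis[abs_def])

lemma degree_lagrange_basis: "j \<in> {1..Q} \<Longrightarrow> degree (lagrange_basis j) \<le> Q - 1"
proof -
  assume j: "j \<in> {1..Q}"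
  have "degree (lagrange_basis j) \<le> (\<Sum>k\<in>{1..Q} - {j}. degree (smult (1 / (\<xi> j - \<xi> k)) [:- \<xi> k, 1:]))"
    unfolding lagrange_basis_def by (rule order_trans[OF degree_prod_sum_le]) (simp_all add: o_def)
  also have "\<dots> \<le> (\<Sum>k\<in>{1..Q} - {j}. 1)"
    by (intro sum_mono) (auto intro: order_trans[OF degree_smult_le] simp del: smult_pCons)
  finally show ?thesis using j by simp
qed

lemma lagrange_basis_node:
  assumes "j \<in> {1..Q}" "k \<in> {1..Q}"
  shows "poly (lagrange_basis j) (\<xi> k) = (if j = k then 1 else 0)"
proof (cases "j = k")
  case True
  have "\<xi> j - \<xi> l \<noteq> 0" if "l \<in> {1..Q} - {j}" for l using inj_onD[OF nodes_inj, of j l] assms that by auto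
  then show ?thesis unfolding poly_lagrange_basis True[symmetric] by simp
next
  case False
  then have "k \<in> {1..Q} - {j}" using assms by simp
  then have "(\<Prod>l\<in>{1..Q} - {j}. (\<xi> k - \<xi> l) / (\<xi> j - \<xi> l)) = 0" by (intro prod_zero) auto
  then show ?thesis using False unfolding poly_lagrange_basis by simp
qed

lemma interpolatory_exact: assumes "degree p \<le> Q - 1" shows "pint p = (\<Sum>j=1..Q. \<beta> j * poly p (\<xi> j))"
proof -
  have "p = (\<Sum>j=1..Q. smult (poly p (\<xi> j)) (lagrange_basis j))"
  proof (rule poly_eqI_degree[where A = "\<xi> ` {1..Q}"])
    show "degree p < card (\<xi> ` {1..Q})" using assms Q1 by (simp add: card_nodes)
    have "degree (\<Sum>j=1..Q. smult (poly p (\<xi> j)) (lagrange_basis j)) \<le> Q - 1"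
      by (intro degree_sum_le order_trans[OF degree_smult_le] degree_lagrange_basis) simp_all
    then show "degree (\<Sum>j=1..Q. smult (poly p (\<xi> j)) (lagrange_basis j)) < card (\<xi> ` {1..Q})"
      using Q1 by (simp add: card_nodes)
    fix z assume "z \<in> \<xi> ` {1..Q}"
    then obtain k where "k \<in> {1..Q}" "z = \<xi> k" by auto
    then have "poly (\<Sum>j=1..Q. smult (poly p (\<xi> j)) (lagrange_basis j)) z = (\<Sum>j=1..Q. if j = k then poly p (\<xi> k) else 0)"
      unfolding poly_sum by (intro sum.cong) (simp_all add: lagrange_basis_node)
    then show "poly p z = poly (\<Sum>j=1..Q. smult (poly p (\<xi> j)) (lagrange_basis j)) z"
      using \<open>k \<in> {1..Q}\<close> \<open>z = \<xi> k\<close> by (simp only: sum.delta finite_atLeastAtMost if_True)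
  qed
  then have "pint p = pint (\<Sum>j=1..Q. smult (poly p (\<xi> j)) (lagrange_basis j))"
    by (rule arg_cong)
  also have "\<dots> = (\<Sum>j=1..Q. pint (smult (poly p (\<xi> j)) (lagrange_basis j)))"
    by (rule pint_sum) simp
  finally show ?thesis by (simp add: pint_smult weight_eq mult.commute)
qed

text \<open>
  Division by the node polynomial: the quotient is integrated to zero by orthogonality and
  is not seen by the rule, and the remainder has degree below \<open>Q\<close>.
\<close>

lemma gauss_exact: assumes "degree p \<le> 2 * Q - 1" shows "pint p = (\<Sum>j=1..Q. \<beta> j * poly p (\<xi> j))"
proof -
  define q r where "q = p div nodal" and "r = p mod nodal"
  have p: "p = nodal * q + r" unfolding q_def r_def by (rule mult_div_mod_eq[symmetric])
  have r: "degree r \<le> Q - 1"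
    using degree_mod_less[OF nodal_nonzero, of p] by (auto simp: r_def[symmetric] degree_nodal)
  have "degree q < Q"
  proof (cases "q = 0")
    case False
    have "degree (p - r) \<le> 2 * Q - 1" using assms r by (intro degree_diff_le) auto
    moreover have "p - r = nodal * q" using p by simp
    moreover have "degree (nodal * q) = Q + degree q"
      using False nodal_nonzero by (simp add: degree_mult_eq degree_nodal)
    ultimately have "Q + degree q \<le> 2 * Q - 1" by simp
    then show ?thesis using Q1 by linarith
  qed (use Q1 in simp)
  then have "pint p = pint r" by (simp add: p pint_add orthogonal)
  also have "\<dots> = (\<Sum>j=1..Q. \<beta> j * poly r (\<xi> j))" by (rule interpolatory_exact[OF r])
  also have "\<dots> = (\<Sum>j=1..Q. \<beta> j * poly p (\<xi> j))"
  proof (intro sum.cong refl)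
    fix j assume "j \<in> {1..Q}"
    then have "poly nodal (\<xi> j) = 0" by (auto simp: poly_node_poly)
    then show "\<beta> j * poly r (\<xi> j) = \<beta> j * poly p (\<xi> j)" by (simp add: p)
  qed
  finally show ?thesis .
qed

text \<open>
  The rule is exact for the square of a Lagrange basis polynomial, where only one node contributes.
\<close>

lemma weight_nonneg: assumes "j \<in> {1..Q}" shows "\<beta> j \<ge> 0"
proof -
  have "degree ((lagrange_basis j)\<^sup>2) \<le> 2 * Q - 1"
    using degree_power_le[of "lagrange_basis j" 2] degree_lagrange_basis[OF assms] Q1 by linarith
  from gauss_exact[OF this] have "pint ((lagrange_basis j)\<^sup>2) = (\<Sum>k=1..Q. \<beta> k * (poly (lagrange_basis j) (\<xi> k))\<^sup>2)"
    by (simp only: poly_power)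
  also have "\<dots> = (\<Sum>k=1..Q. if k = j then \<beta> j else 0)"
    by (intro sum.cong refl) (subst lagrange_basis_node[OF assms], auto)
  also have "\<dots> = \<beta> j" using assms by (simp only: sum.delta finite_atLeastAtMost if_True)
  finally show ?thesis using pint_nonneg[of "(lagrange_basis j)\<^sup>2"] by simp
qed

text \<open>
  The rule cannot distinguish \<open>g\<close> from its Hermite interpolant, so its error is the integral of the
  Hermite remainder.
\<close>

lemma quadrature_bounds:
  assumes D: "derivatives_on {-1..1} g D"
    and lo: "\<And>u. u \<in> {-1..1} \<Longrightarrow> lo \<le> D (2 * Q) u" and hi: "\<And>u. u \<in> {-1..1} \<Longrightarrow> D (2 * Q) u \<le> hi"
  shows "lo / fact (2 * Q) * pint (nodal\<^sup>2) \<le> integral {-1..1} g - (\<Sum>j=1..Q. \<beta> j * g (\<xi> j))"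
    "integral {-1..1} g - (\<Sum>j=1..Q. \<beta> j * g (\<xi> j)) \<le> hi / fact (2 * Q) * pint (nodal\<^sup>2)"
proof -
  let ?S = "\<xi> ` {1..Q}"
  obtain p where p: "degree p \<le> 2 * Q - 1" "\<And>s. s \<in> ?S \<Longrightarrow> poly p s = g s \<and> poly (pderiv p) s = D 1 s"
    using hermite_interpolation[of ?S g "D 1"] unfolding card_nodes by blast
  have rem: "\<exists>\<eta>\<in>{-1..1}. g u - poly p u = D (2 * Q) \<eta> / fact (2 * Q) * (poly nodal u)\<^sup>2" if "u \<in> {-1..1}" for u
    using node_range by (intro hermite_remainder[OF _ _ card_nodes Q1 D p that]) auto
  have gc: "continuous_on {-1..1} g"
    by (rule derivatives_on_continuous[OF D])
  then have gi: "g integrable_on {-1..1}" by (rule integrable_continuous_interval)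
  have "(\<Sum>j=1..Q. \<beta> j * g (\<xi> j)) = pint p" unfolding gauss_exact[OF p(1)] using p(2) by (intro sum.cong) auto
  then have eq: "integral {-1..1} g - (\<Sum>j=1..Q. \<beta> j * g (\<xi> j)) = integral {-1..1} (\<lambda>u. g u - poly p u)"
    using gi poly_integrable[of p "-1" 1] by (simp add: integral_diff pint_def)
  have I: "c / fact (2 * Q) * pint (nodal\<^sup>2) = integral {-1..1} (\<lambda>u. c / fact (2 * Q) * (poly nodal u)\<^sup>2)" for c
  proof -
    have "poly (nodal\<^sup>2) = (\<lambda>u. (poly nodal u)\<^sup>2)" by (simp add: fun_eq_iff)
    then show ?thesis by (simp add: pint_def)
  qed
  have int: "(\<lambda>u. c / fact (2 * Q) * (poly nodal u)\<^sup>2) integrable_on {-1..1}" for c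
    by (intro integrable_continuous_interval continuous_intros)
  show "lo / fact (2 * Q) * pint (nodal\<^sup>2) \<le> integral {-1..1} g - (\<Sum>j=1..Q. \<beta> j * g (\<xi> j))"
    unfolding eq I
  proof (intro integral_le int integrable_diff gi poly_integrable)
    fix u :: real assume "u \<in> {-1..1}"
    with rem lo show "lo / fact (2 * Q) * (poly nodal u)\<^sup>2 \<le> g u - poly p u"
      by (fastforce intro!: mult_right_mono divide_right_mono)
  qed
  show "integral {-1..1} g - (\<Sum>j=1..Q. \<beta> j * g (\<xi> j)) \<le> hi / fact (2 * Q) * pint (nodal\<^sup>2)"
    unfolding eq I
  proof (intro integral_le int integrable_diff gi poly_integrable)
    fix u :: real assume "u \<in> {-1..1}"
    with rem hi show "g u - poly p u \<le> hi / fact (2 * Q) * (poly nodal u)\<^sup>2"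
      by (fastforce intro!: mult_right_mono divide_right_mono)
  qed
qed


lemma gl_node_in: "t \<le> T \<Longrightarrow> j \<in> {1..Q} \<Longrightarrow> t \<le> gl_node T \<xi> t j \<and> gl_node T \<xi> t j \<le> T"
proof -
  assume t: "t \<le> T" and j: "j \<in> {1..Q}"
  have "(T - t) / 2 * (\<xi> j + 1) \<le> (T - t) / 2 * 2"
    using t node_range[OF j] by (intro mult_left_mono) auto
  then show ?thesis using t node_range[OF j] by (simp add: gl_node_def)
qed

lemma gl_weight_nonneg: "t \<le> T \<Longrightarrow> j \<in> {1..Q} \<Longrightarrow> 0 \<le> gl_weight T \<beta> t j"
  using weight_nonneg by (simp add: gl_weight_def)

text \<open>
  The affine change of variables contributes a factor \<open>(T - t) / 2\<close> for the length of the interval and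
  one for each of the \<open>2 * Q\<close> derivatives.
\<close>

lemma gl_quadrature_bounds:
  assumes t: "t \<le> T" and D: "derivatives_on {t..T} g D"
    and lo: "\<And>s. s \<in> {t..T} \<Longrightarrow> lo \<le> D (2 * Q) s" and hi: "\<And>s. s \<in> {t..T} \<Longrightarrow> D (2 * Q) s \<le> hi"
  shows "((T - t) / 2) ^ (2 * Q + 1) * (lo / fact (2 * Q) * pint (nodal\<^sup>2))
      \<le> integral {t..T} g - (\<Sum>j=1..Q. gl_weight T \<beta> t j * g (gl_node T \<xi> t j))"
    "integral {t..T} g - (\<Sum>j=1..Q. gl_weight T \<beta> t j * g (gl_node T \<xi> t j))
      \<le> ((T - t) / 2) ^ (2 * Q + 1) * (hi / fact (2 * Q) * pint (nodal\<^sup>2))"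
proof -
  define h where "h = (T - t) / 2"
  have h0: "h \<ge> 0" using t by (simp add: h_def)
  define \<gamma> where "\<gamma> = (\<lambda>u. t + h * (u + 1))"
  have \<gamma>: "\<gamma> u \<in> {t..T}" if "u \<in> {-1..1}" for u
  proof -
    have "h * (u + 1) \<le> h * 2" using that h0 by (intro mult_left_mono) auto
    then show ?thesis using that h0 by (auto simp: \<gamma>_def h_def)
  qed
  define E where "E = (\<lambda>k u. h ^ k * D k (\<gamma> u))"
  have E: "derivatives_on {-1..1} (\<lambda>u. g (\<gamma> u)) E"
    unfolding derivatives_on_def
  proof (intro conjI ballI allI)
    fix u :: real assume "u \<in> {-1..1}"
    then show "E 0 u = g (\<gamma> u)" using D \<gamma> by (simp add: E_def derivatives_on_def)
  next
    fix k and u :: real assume u: "u \<in> {-1..1}"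
    have "(D k has_real_derivative D (Suc k) (\<gamma> u)) (at (\<gamma> u) within {t..T})"
      using D \<gamma>[OF u] by (simp add: derivatives_on_def)
    then have "(D k has_real_derivative D (Suc k) (\<gamma> u)) (at (\<gamma> u) within \<gamma> ` {-1..1})"
      by (rule has_field_derivative_subset) (use \<gamma> in blast)
    moreover have "(\<gamma> has_real_derivative h) (at u within {-1..1})"
      unfolding \<gamma>_def by (auto intro!: derivative_eq_intros)
    ultimately have "(D k \<circ> \<gamma> has_real_derivative D (Suc k) (\<gamma> u) * h) (at u within {-1..1})"
      by (rule DERIV_image_chain)
    then have "((\<lambda>u. h ^ k * (D k \<circ> \<gamma>) u) has_real_derivative h ^ k * (D (Suc k) (\<gamma> u) * h)) (at u within {-1..1})"
      by (rule DERIV_cmult)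
    then show "(E k has_real_derivative E (Suc k) u) (at u within {-1..1})"
      by (simp add: E_def o_def mult_ac)
  qed
  have int: "h * integral {-1..1} (\<lambda>u. g (\<gamma> u)) = integral {t..T} g"
  proof (cases "h = 0")
    case True
    then show ?thesis by (simp add: h_def)
  next
    case False
    then have hp: "h > 0" using h0 by simp
    have "continuous_on {t..T} g"
      by (rule derivatives_on_continuous[OF D])
    then have "(g has_integral integral {t..T} g) (cbox t T)"
      by (simp add: integrable_continuous_interval integrable_integral)
    from has_integral_affinity'[OF this hp, of "t + h"]
    have "((\<lambda>u. g (\<gamma> u)) has_integral (integral {t..T} g / h)) (cbox ((t - (t + h)) / h) ((T - (t + h)) / h))"
      by (simp add: \<gamma>_def algebra_simps divide_inverse)
    moreover have "(t - (t + h)) / h = -1" "(T - (t + h)) / h = 1"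
      using hp by (simp_all add: h_def field_simps)
    ultimately have "((\<lambda>u. g (\<gamma> u)) has_integral (integral {t..T} g / h)) {-1..1}" by simp
    then show ?thesis using hp by (simp add: integral_unique)
  qed
  have sum: "h * (\<Sum>j=1..Q. \<beta> j * g (\<gamma> (\<xi> j))) = (\<Sum>j=1..Q. gl_weight T \<beta> t j * g (gl_node T \<xi> t j))"
    by (simp add: sum_distrib_left gl_weight_def gl_node_def h_def \<gamma>_def mult.assoc)
  have hQ: "0 \<le> h ^ (2 * Q)" using h0 by simp
  have Elo: "h ^ (2 * Q) * lo \<le> E (2 * Q) u" and Ehi: "E (2 * Q) u \<le> h ^ (2 * Q) * hi" if "u \<in> {-1..1}" for u
    using lo[OF \<gamma>[OF that]] hi[OF \<gamma>[OF that]] hQ by (auto simp: E_def intro!: mult_left_mono)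
  have "h * (h ^ (2 * Q) * lo / fact (2 * Q) * pint (nodal\<^sup>2)) \<le> h * (integral {-1..1} (\<lambda>u. g (\<gamma> u)) - (\<Sum>j=1..Q. \<beta> j * g (\<gamma> (\<xi> j))))"
    "h * (integral {-1..1} (\<lambda>u. g (\<gamma> u)) - (\<Sum>j=1..Q. \<beta> j * g (\<gamma> (\<xi> j)))) \<le> h * (h ^ (2 * Q) * hi / fact (2 * Q) * pint (nodal\<^sup>2))"
    by (rule mult_left_mono[OF quadrature_bounds(1)[OF E Elo Ehi] h0], assumption, assumption)
       (rule mult_left_mono[OF quadrature_bounds(2)[OF E Elo Ehi] h0], assumption, assumption)
  then show "((T - t) / 2) ^ (2 * Q + 1) * (lo / fact (2 * Q) * pint (nodal\<^sup>2))
      \<le> integral {t..T} g - (\<Sum>j=1..Q. gl_weight T \<beta> t j * g (gl_node T \<xi> t j))"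
    "integral {t..T} g - (\<Sum>j=1..Q. gl_weight T \<beta> t j * g (gl_node T \<xi> t j))
      \<le> ((T - t) / 2) ^ (2 * Q + 1) * (hi / fact (2 * Q) * pint (nodal\<^sup>2))"
    unfolding right_diff_distrib int sum h_def[symmetric] power_add power_one_right
    by (simp_all only: mult_ac times_divide_eq_left times_divide_eq_right)
qed

text \<open>
  The one-sided estimate that replaces convexity arguments below: the rule never overestimates the
  integral of a function whose derivative of order \<open>2 * Q\<close> is non-negative, whatever the size of that
  derivative.
\<close>

lemma gl_le_integral:
  assumes "t \<le> T" "derivatives_on {t..T} g D" "\<And>s. s \<in> {t..T} \<Longrightarrow> 0 \<le> D (2 * Q) s"
  shows "(\<Sum>j=1..Q. gl_weight T \<beta> t j * g (gl_node T \<xi> t j)) \<le> integral {t..T} g"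
proof -
  have "continuous_on {t..T} (D (2 * Q))"
    using assms(2) by (intro DERIV_continuous_on[of _ _ "D (Suc (2 * Q))"]) (auto simp: derivatives_on_def)
  then have "bounded (D (2 * Q) ` {t..T})" by (intro compact_imp_bounded compact_continuous_image) auto
  then obtain B where "\<forall>r\<in>D (2 * Q) ` {t..T}. norm r \<le> B" by (auto simp: bounded_iff)
  then have "D (2 * Q) s \<le> B" if "s \<in> {t..T}" for s using that by (force simp: abs_le_iff)
  from gl_quadrature_bounds(1)[OF assms this] show ?thesis by simp
qed

lemma gl_exp_le:
  assumes "t \<le> T" "a > 0"
  shows "(\<Sum>j=1..Q. gl_weight T \<beta> t j * exp (a * (T - gl_node T \<xi> t j))) \<le> exp (a * (T - t)) / a"
proof -
  have "((\<lambda>s. exp (a * (T - s))) has_integral (- exp (a * (T - T)) / a - (- exp (a * (T - t)) / a))) {t..T}"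
    using assms
    by (intro fundamental_theorem_of_calculus)
       (auto simp: has_real_derivative_iff_has_vector_derivative[symmetric] intro!: derivative_eq_intros)
  moreover have "derivatives_on {t..T} (\<lambda>s. exp (a * (T - s))) (\<lambda>k s. (- a) ^ k * exp (a * (T - s)))"
    unfolding derivatives_on_def by (auto intro!: derivative_eq_intros)
  moreover have "0 \<le> (- a) ^ (2 * Q) * exp (a * (T - s))" for s by simp
  ultimately have "(\<Sum>j=1..Q. gl_weight T \<beta> t j * exp (a * (T - gl_node T \<xi> t j)))
      \<le> - exp (a * (T - T)) / a - (- exp (a * (T - t)) / a)"
    using gl_le_integral[OF assms(1), of "\<lambda>s. exp (a * (T - s))" "\<lambda>k s. (- a) ^ k * exp (a * (T - s))"]
    by (simp only: integral_unique)
  also have "\<dots> \<le> exp (a * (T - t)) / a" using assms by simp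
  finally show ?thesis .
qed

lemma even_pderiv_reflected_power:
  "\<exists>c\<ge>0. \<exists>m. (pderiv ^^ (2 * n)) ([:T, -1:] ^ k) = smult c ([:T, -1::real:] ^ m)"
proof (induction n)
  case 0
  then show ?case by (intro exI[of _ 1]) auto
next
  case (Suc n)
  then obtain c m where cm: "c \<ge> 0" "(pderiv ^^ (2 * n)) ([:T, -1:] ^ k) = smult c ([:T, -1::real:] ^ m)" by auto
  have "pderiv (pderiv ([:T, -1:] ^ m)) = smult (real m * real (m - 1)) ([:T, -1:] ^ (m - 2))"
  proof -
    have d: "pderiv ([:T, -1:] ^ i) = smult (- real i) ([:T, -1:] ^ (i - 1))" for i
      by (simp add: pderiv_power pderiv_pCons)
    show ?thesis unfolding d pderiv_smult by (simp add: diff_diff_add)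
  qed
  then show ?case using cm
    by (intro exI[of _ "c * (real m * real (m - 1))"] conjI exI[of _ "m - 2"]) (auto simp: pderiv_smult)
qed

lemma gl_power_le:
  assumes "t \<le> T"
  shows "(\<Sum>j=1..Q. gl_weight T \<beta> t j * (T - gl_node T \<xi> t j) ^ k) \<le> (T - t) ^ Suc k / real (Suc k)"
proof -
  let ?D = "\<lambda>m. poly ((pderiv ^^ m) ([:T, -1:] ^ k))"
  have "((\<lambda>s. (T - s) ^ k) has_integral (- ((T - T) ^ Suc k / real (Suc k)) - (- ((T - t) ^ Suc k / real (Suc k))))) {t..T}"
    using assms
    by (intro fundamental_theorem_of_calculus)
       (auto simp: has_real_derivative_iff_has_vector_derivative[symmetric] simp del: power_Suc intro!: derivative_eq_intros)
  moreover have "derivatives_on {t..T} (\<lambda>s. (T - s) ^ k) ?D"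
    unfolding derivatives_on_def by (auto intro!: has_field_derivative_at_within poly_DERIV)
  moreover have "0 \<le> ?D (2 * Q) s" if "s \<in> {t..T}" for s
    using even_pderiv_reflected_power[of Q T k] that by auto
  ultimately show ?thesis
    using gl_le_integral[of t T "\<lambda>s. (T - s) ^ k" ?D] assms by (simp add: integral_unique del: power_Suc)
qed

text \<open>
  The powers of two combine as \<open>2^(2*Q) * 2^(2*Q) * 4^Q = 8^(2*Q)\<close>: from the half length of the interval,
  from \<open>(exp 1 / (2 * Q))^(2 * Q)\<close> as a bound for \<open>1 / fact (2 * Q)\<close>, and from the squared node
  polynomial.
\<close>

lemma gl_error_le:
  assumes t: "0 \<le> t" "t \<le> T" and D: "derivatives_on {t..T} g D"
    and C: "\<And>s. s \<in> {t..T} \<Longrightarrow> \<bar>D (2 * Q) s\<bar> \<le> C"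
  shows "\<bar>integral {t..T} g - (\<Sum>j=1..Q. gl_weight T \<beta> t j * g (gl_node T \<xi> t j))\<bar>
     \<le> 2 * C * T ^ (2 * Q + 1) * sqrt (real Q) * (exp 1 / (8 * real Q)) ^ (2 * Q)"
proof -
  let ?I = "pint (nodal\<^sup>2)"
  have C0: "C \<ge> 0" using C[of t] t by auto
  have I0: "?I \<ge> 0" by (intro pint_nonneg) simp
  have "-C \<le> D (2 * Q) s" "D (2 * Q) s \<le> C" if "s \<in> {t..T}" for s using C[OF that] by auto
  from gl_quadrature_bounds[OF t(2) D this]
  have "\<bar>integral {t..T} g - (\<Sum>j=1..Q. gl_weight T \<beta> t j * g (gl_node T \<xi> t j))\<bar>
     \<le> ((T - t) / 2) ^ (2 * Q + 1) * (C / fact (2 * Q) * ?I)" by (simp add: abs_le_iff)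
  also have "\<dots> \<le> (T / 2) ^ (2 * Q + 1) * (C * (exp 1 / real (2 * Q)) ^ (2 * Q) * (4 * sqrt (real Q) / 4 ^ Q))"
  proof (intro mult_mono power_mono)
    have "1 / fact (2 * Q) \<le> (exp 1 / real (2 * Q)) ^ (2 * Q)"
      using fact_ge_power_exp[of "2 * Q"] Q1 by (simp add: field_simps)
    then show "C / fact (2 * Q) \<le> C * (exp 1 / real (2 * Q)) ^ (2 * Q)"
      using mult_left_mono[OF _ C0, of "1 / fact (2 * Q)"] by simp
  qed (use t C0 I0 pint_node_poly_sq in auto)
  also have "\<dots> = 2 * C * T ^ (2 * Q + 1) * sqrt (real Q) * (exp 1 / (8 * real Q)) ^ (2 * Q)"
  proof -
    have "(8::real) ^ (2 * Q) = 2 ^ (2 * Q) * 2 ^ (2 * Q) * 4 ^ Q"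
      by (simp add: power_mult power_mult_distrib[symmetric])
    then show ?thesis by (simp add: power_divide power_mult_distrib power_add field_simps)
  qed
  finally show ?thesis .
qed

end

section \<open>Bounded random variables and their second moments\<close>

context prob_space
begin

definition bounded_rv :: "('a \<Rightarrow> real) \<Rightarrow> bool" where
  "bounded_rv X \<longleftrightarrow> X \<in> borel_measurable M \<and> (\<exists>C. \<forall>\<omega>\<in>space M. \<bar>X \<omega>\<bar> \<le> C)"

text \<open>
  The inequality \<open>norm X <= a\<close> in the space of square-integrable variables. Boundedness of \<open>X\<close> is part of
  the notion, so that every expectation formed from such variables exists.
\<close>

definition L2_le :: "('a \<Rightarrow> real) \<Rightarrow> real \<Rightarrow> bool" where
  "L2_le X a \<longleftrightarrow> bounded_rv X \<and> 0 \<le> a \<and> expectation (\<lambda>\<omega>. (X \<omega>)\<^sup>2) \<le> a\<^sup>2"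

lemma bounded_rvI: "X \<in> borel_measurable M \<Longrightarrow> (\<And>\<omega>. \<omega> \<in> space M \<Longrightarrow> \<bar>X \<omega>\<bar> \<le> C) \<Longrightarrow> bounded_rv X"
  unfolding bounded_rv_def by blast

lemma bounded_rv_measurable: "bounded_rv X \<Longrightarrow> X \<in> borel_measurable M"
  by (simp add: bounded_rv_def)

lemma bounded_rv_integrable: "bounded_rv X \<Longrightarrow> integrable M X"
proof -
  assume "bounded_rv X"
  then obtain C where "X \<in> borel_measurable M" "\<forall>\<omega>\<in>space M. \<bar>X \<omega>\<bar> \<le> C" by (auto simp: bounded_rv_def)
  then show ?thesis by (intro integrable_const_bound[of X C]) auto
qed

lemma bounded_rv_const: "bounded_rv (\<lambda>_. c)"
  by (rule bounded_rvI) auto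

lemma bounded_rv_add:
  assumes "bounded_rv X" "bounded_rv Y" shows "bounded_rv (\<lambda>\<omega>. X \<omega> + Y \<omega>)"
proof -
  from assms obtain a b where "\<And>\<omega>. \<omega> \<in> space M \<Longrightarrow> \<bar>X \<omega>\<bar> \<le> a" "\<And>\<omega>. \<omega> \<in> space M \<Longrightarrow> \<bar>Y \<omega>\<bar> \<le> b"
    by (auto simp: bounded_rv_def)
  then have "\<omega> \<in> space M \<Longrightarrow> \<bar>X \<omega> + Y \<omega>\<bar> \<le> a + b" for \<omega> by (meson abs_triangle_ineq add_mono order_trans)
  then show ?thesis using assms by (intro bounded_rvI) (auto simp: bounded_rv_def)
qed

lemma bounded_rv_mult:
  assumes "bounded_rv X" "bounded_rv Y" shows "bounded_rv (\<lambda>\<omega>. X \<omega> * Y \<omega>)"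
proof -
  from assms obtain a b where "\<And>\<omega>. \<omega> \<in> space M \<Longrightarrow> \<bar>X \<omega>\<bar> \<le> a" "\<And>\<omega>. \<omega> \<in> space M \<Longrightarrow> \<bar>Y \<omega>\<bar> \<le> b"
    by (auto simp: bounded_rv_def)
  then have "\<bar>X \<omega> * Y \<omega>\<bar> \<le> a * b" if "\<omega> \<in> space M" for \<omega>
    using that unfolding abs_mult by (intro mult_mono) (auto intro: order_trans[OF abs_ge_zero])
  then show ?thesis using assms by (intro bounded_rvI) (auto simp: bounded_rv_def)
qed

lemma bounded_rv_diff: "bounded_rv X \<Longrightarrow> bounded_rv Y \<Longrightarrow> bounded_rv (\<lambda>\<omega>. X \<omega> - Y \<omega>)"
  using bounded_rv_add[OF _ bounded_rv_mult[OF bounded_rv_const[of "-1"]], of X Y] by simp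

lemma bounded_rv_power2: "bounded_rv X \<Longrightarrow> bounded_rv (\<lambda>\<omega>. (X \<omega>)\<^sup>2)"
  unfolding power2_eq_square by (intro bounded_rv_mult)

lemma bounded_rv_sum: "(\<And>i. i \<in> I \<Longrightarrow> bounded_rv (X i)) \<Longrightarrow> bounded_rv (\<lambda>\<omega>. \<Sum>i\<in>I. X i \<omega>)"
  by (induction I rule: infinite_finite_induct) (auto intro: bounded_rv_const bounded_rv_add)

lemmas bounded_rv_intros = bounded_rv_const bounded_rv_add bounded_rv_mult bounded_rv_diff
  bounded_rv_power2 bounded_rv_sum

lemma L2_le_mono: "L2_le X a \<Longrightarrow> a \<le> b \<Longrightarrow> L2_le X b"
  unfolding L2_le_def by (auto intro: order_trans power_mono)

lemma L2_le_bounded: "L2_le X a \<Longrightarrow> bounded_rv X"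
  by (simp add: L2_le_def)

lemma L2_le_nonneg: "L2_le X a \<Longrightarrow> 0 \<le> a"
  by (simp add: L2_le_def)

lemma L2_le_const: "\<bar>c\<bar> \<le> a \<Longrightarrow> L2_le (\<lambda>_. c) a"
  using power_mono[of "\<bar>c\<bar>" a 2] by (auto simp: L2_le_def bounded_rv_const prob_space)

lemma L2_le_bound:
  assumes X: "X \<in> borel_measurable M" and le: "\<And>\<omega>. \<bar>X \<omega>\<bar> \<le> a"
  shows "L2_le X a"
proof -
  have a: "0 \<le> a" using le by (meson abs_ge_zero order_trans)
  have b: "bounded_rv X" using X le by (rule bounded_rvI)
  have "expectation (\<lambda>\<omega>. (X \<omega>)\<^sup>2) \<le> a\<^sup>2"
  proof (intro integral_le_const bounded_rv_integrable bounded_rv_power2 b AE_I2)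
    fix \<omega> show "(X \<omega>)\<^sup>2 \<le> a\<^sup>2" using power_mono[OF le[of \<omega>], of 2] by simp
  qed
  with a b show ?thesis by (simp add: L2_le_def)
qed

lemma L2_le_pointwise:
  assumes Y: "L2_le Y a" and X: "X \<in> borel_measurable M" and c: "0 \<le> c"
    and le: "\<And>\<omega>. \<omega> \<in> space M \<Longrightarrow> \<bar>X \<omega>\<bar> \<le> c * \<bar>Y \<omega>\<bar>"
  shows "L2_le X (c * a)"
proof -
  from L2_le_bounded[OF Y] obtain C where "\<And>\<omega>. \<omega> \<in> space M \<Longrightarrow> \<bar>Y \<omega>\<bar> \<le> C" by (auto simp: bounded_rv_def)
  then have "\<bar>X \<omega>\<bar> \<le> c * C" if "\<omega> \<in> space M" for \<omega> using le[OF that] c that by (meson mult_left_mono order_trans)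
  with X have bX: "bounded_rv X" by (rule bounded_rvI)
  have "expectation (\<lambda>\<omega>. (X \<omega>)\<^sup>2) \<le> expectation (\<lambda>\<omega>. c\<^sup>2 * (Y \<omega>)\<^sup>2)"
  proof (intro integral_mono bounded_rv_integrable bounded_rv_intros bX L2_le_bounded[OF Y])
    fix \<omega> assume "\<omega> \<in> space M"
    from power_mono[OF le[OF this], of 2] show "(X \<omega>)\<^sup>2 \<le> c\<^sup>2 * (Y \<omega>)\<^sup>2" by (simp add: power_mult_distrib)
  qed
  also have "\<dots> \<le> c\<^sup>2 * a\<^sup>2" using Y by (auto simp: L2_le_def intro!: mult_left_mono)
  finally show ?thesis using bX c L2_le_nonneg[OF Y] by (simp add: L2_le_def power_mult_distrib)
qed

lemma L2_le_cmult: "L2_le X a \<Longrightarrow> L2_le (\<lambda>\<omega>. c * X \<omega>) (\<bar>c\<bar> * a)"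
  by (rule L2_le_pointwise) (auto simp: abs_mult intro!: bounded_rv_measurable[OF bounded_rv_mult[OF bounded_rv_const]] dest: L2_le_bounded)

lemma abs_expectation_L2_le:
  assumes "L2_le X a" shows "expectation (\<lambda>\<omega>. \<bar>X \<omega>\<bar>) \<le> a"
proof -
  have X: "bounded_rv X" using assms by (rule L2_le_bounded)
  then have aX: "bounded_rv (\<lambda>\<omega>. \<bar>X \<omega>\<bar>)" by (auto simp: bounded_rv_def)
  have "0 \<le> variance (\<lambda>\<omega>. \<bar>X \<omega>\<bar>)" by (rule variance_positive)
  also have "\<dots> = expectation (\<lambda>\<omega>. \<bar>X \<omega>\<bar>\<^sup>2) - (expectation (\<lambda>\<omega>. \<bar>X \<omega>\<bar>))\<^sup>2"
    by (intro variance_eq bounded_rv_integrable bounded_rv_power2 aX)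
  finally have "(expectation (\<lambda>\<omega>. \<bar>X \<omega>\<bar>))\<^sup>2 \<le> expectation (\<lambda>\<omega>. (X \<omega>)\<^sup>2)" by simp
  also have "\<dots> \<le> a\<^sup>2" using assms by (simp add: L2_le_def)
  finally have "(expectation (\<lambda>\<omega>. \<bar>X \<omega>\<bar>))\<^sup>2 \<le> a\<^sup>2" .
  then show ?thesis using L2_le_nonneg[OF assms] by (rule power2_le_imp_le)
qed

text \<open>
  Minkowski's inequality. For positive \<open>a\<close> and \<open>b\<close> it follows from
  \<open>2 * x * y <= (b / a) * x^2 + (a / b) * y^2\<close>; a limit from above covers vanishing bounds.
\<close>

lemma L2_le_add:
  assumes X: "L2_le X a" and Y: "L2_le Y b"
  shows "L2_le (\<lambda>\<omega>. X \<omega> + Y \<omega>) (a + b)"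
proof -
  note bX = L2_le_bounded[OF X] and bY = L2_le_bounded[OF Y]
  have key: "expectation (\<lambda>\<omega>. (X \<omega> + Y \<omega>)\<^sup>2) \<le> (a' + b')\<^sup>2" if "a < a'" "b < b'" for a' b'
  proof -
    have pos: "a' > 0" "b' > 0" using that L2_le_nonneg[OF X] L2_le_nonneg[OF Y] by auto
    have pt: "(x + y)\<^sup>2 \<le> (1 + b' / a') * x\<^sup>2 + (1 + a' / b') * y\<^sup>2" for x y :: real
    proof -
      have "0 \<le> (b' * x - a' * y)\<^sup>2 / (a' * b')" using pos by simp
      also have "\<dots> = (1 + b' / a') * x\<^sup>2 + (1 + a' / b') * y\<^sup>2 - (x + y)\<^sup>2"
        using pos by (simp add: power2_eq_square field_simps)
      finally show ?thesis by simp
    qed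
    have "expectation (\<lambda>\<omega>. (X \<omega> + Y \<omega>)\<^sup>2)
        \<le> expectation (\<lambda>\<omega>. (1 + b' / a') * (X \<omega>)\<^sup>2 + (1 + a' / b') * (Y \<omega>)\<^sup>2)"
      by (intro integral_mono pt bounded_rv_integrable bounded_rv_intros bX bY)
    also have "\<dots> = (1 + b' / a') * expectation (\<lambda>\<omega>. (X \<omega>)\<^sup>2) + (1 + a' / b') * expectation (\<lambda>\<omega>. (Y \<omega>)\<^sup>2)"
      by (subst Bochner_Integration.integral_add) (intro bounded_rv_integrable bounded_rv_intros bX bY | simp)+
    also have "\<dots> \<le> (1 + b' / a') * a'\<^sup>2 + (1 + a' / b') * b'\<^sup>2"
    proof (intro add_mono mult_left_mono)
      show "expectation (\<lambda>\<omega>. (X \<omega>)\<^sup>2) \<le> a'\<^sup>2" "expectation (\<lambda>\<omega>. (Y \<omega>)\<^sup>2) \<le> b'\<^sup>2"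
        using X Y that unfolding L2_le_def by (meson order_trans power_mono less_imp_le)+
    qed (use pos in auto)
    also have "\<dots> = (a' + b')\<^sup>2" using pos by (simp add: power2_eq_square field_simps)
    finally show ?thesis .
  qed
  have "expectation (\<lambda>\<omega>. (X \<omega> + Y \<omega>)\<^sup>2) \<le> (a + b)\<^sup>2"
  proof (rule tendsto_lowerbound)
    have "((\<lambda>e. ((a + e) + (b + e))\<^sup>2) \<longlongrightarrow> ((a + 0) + (b + 0))\<^sup>2) (at_right 0)"
      by (intro tendsto_intros)
    then show "((\<lambda>e. ((a + e) + (b + e))\<^sup>2) \<longlongrightarrow> (a + b)\<^sup>2) (at_right 0)" by simp
    show "\<forall>\<^sub>F e in at_right 0. expectation (\<lambda>\<omega>. (X \<omega> + Y \<omega>)\<^sup>2) \<le> ((a + e) + (b + e))\<^sup>2"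
      using eventually_at_right_less[of "0::real"] by eventually_elim (rule key, simp_all)
  qed simp
  then show ?thesis using L2_le_nonneg[OF X] L2_le_nonneg[OF Y] bX bY
    by (auto simp: L2_le_def intro: bounded_rv_add)
qed

lemma L2_le_diff: "L2_le X a \<Longrightarrow> L2_le Y b \<Longrightarrow> L2_le (\<lambda>\<omega>. X \<omega> - Y \<omega>) (a + b)"
  using L2_le_add[OF _ L2_le_cmult[of Y b "-1"], of X a] by simp

lemma L2_le_sum:
  "finite I \<Longrightarrow> (\<And>i. i \<in> I \<Longrightarrow> L2_le (X i) (a i)) \<Longrightarrow> L2_le (\<lambda>\<omega>. \<Sum>i\<in>I. X i \<omega>) (\<Sum>i\<in>I. a i)"
  by (induction I rule: finite_induct) (auto intro: L2_le_add L2_le_const)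

lemma L2_le_center: assumes "L2_le X a" shows "L2_le (\<lambda>\<omega>. X \<omega> - expectation X) a"
proof -
  note bX = L2_le_bounded[OF assms]
  have "variance X = expectation (\<lambda>\<omega>. (X \<omega>)\<^sup>2) - (expectation X)\<^sup>2"
    by (intro variance_eq bounded_rv_integrable bounded_rv_power2 bX)
  then have "variance X \<le> a\<^sup>2" using assms zero_le_power2[of "expectation X"] unfolding L2_le_def by linarith
  then show ?thesis using assms bX by (auto simp: L2_le_def intro!: bounded_rv_diff bounded_rv_const)
qed

lemma second_moment_indep_sum:
  fixes Z :: "'i \<Rightarrow> 'a \<Rightarrow> real"
  assumes "finite I" "indep_vars (\<lambda>_. borel) Z I" "\<And>i. i \<in> I \<Longrightarrow> bounded_rv (Z i)"
    "\<And>i. i \<in> I \<Longrightarrow> expectation (Z i) = 0"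
  shows "expectation (\<lambda>\<omega>. (\<Sum>i\<in>I. Z i \<omega>)\<^sup>2) = (\<Sum>i\<in>I. expectation (\<lambda>\<omega>. (Z i \<omega>)\<^sup>2))"
  using assms
proof (induction I rule: finite_induct)
  case empty
  then show ?case by simp
next
  case (insert i I)
  let ?S = "\<lambda>\<omega>. \<Sum>i\<in>I. Z i \<omega>"
  have b: "bounded_rv (Z i)" "bounded_rv ?S" using insert.prems by (auto intro!: bounded_rv_sum)
  have "indep_var borel (Z i) borel ?S" using insert by (intro indep_vars_sum) auto
  then have "expectation (\<lambda>\<omega>. Z i \<omega> * ?S \<omega>) = expectation (Z i) * expectation ?S"
    by (intro indep_var_lebesgue_integral bounded_rv_integrable b)
  then have cross: "expectation (\<lambda>\<omega>. Z i \<omega> * ?S \<omega>) = 0" using insert.prems by simp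
  have "expectation (\<lambda>\<omega>. (\<Sum>k\<in>insert i I. Z k \<omega>)\<^sup>2)
      = expectation (\<lambda>\<omega>. (Z i \<omega>)\<^sup>2 + (2 * (Z i \<omega> * ?S \<omega>) + (?S \<omega>)\<^sup>2))"
    using insert.hyps by (simp add: power2_sum add_ac mult.assoc)
  also have "\<dots> = expectation (\<lambda>\<omega>. (Z i \<omega>)\<^sup>2) + (2 * expectation (\<lambda>\<omega>. Z i \<omega> * ?S \<omega>) + expectation (\<lambda>\<omega>. (?S \<omega>)\<^sup>2))"
    by (subst Bochner_Integration.integral_add, (intro bounded_rv_integrable bounded_rv_intros b insert.prems insertI2 | assumption)+,
        subst Bochner_Integration.integral_add, (intro bounded_rv_integrable bounded_rv_intros b insert.prems insertI2 | assumption)+) simp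
  also have "expectation (\<lambda>\<omega>. (?S \<omega>)\<^sup>2) = (\<Sum>i\<in>I. expectation (\<lambda>\<omega>. (Z i \<omega>)\<^sup>2))"
    using insert.prems by (intro insert.IH) (auto intro: indep_vars_subset)
  finally show ?case using insert.hyps cross by simp
qed

text \<open>
  The gain of a factor \<open>1 / sqrt m\<close> by Monte Carlo averaging.
\<close>

lemma L2_le_indep_mean:
  fixes Z :: "nat \<Rightarrow> 'a \<Rightarrow> real"
  assumes M: "m \<ge> 1" and ind: "indep_vars (\<lambda>_. borel) Z {1..m}"
    and Z: "\<And>i. i \<in> {1..m} \<Longrightarrow> L2_le (\<lambda>\<omega>. Z i \<omega> - expectation (Z i)) v"
    and bZ: "\<And>i. i \<in> {1..m} \<Longrightarrow> bounded_rv (Z i)"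
  shows "L2_le (\<lambda>\<omega>. 1 / real m * (\<Sum>i=1..m. Z i \<omega>) - expectation (\<lambda>\<omega>. 1 / real m * (\<Sum>i=1..m. Z i \<omega>))) (v / sqrt (real m))"
proof -
  define Y where "Y i \<omega> = Z i \<omega> - expectation (Z i)" for i \<omega>
  have bY: "bounded_rv (Y i)" if "i \<in> {1..m}" for i using Z[OF that] unfolding Y_def L2_le_def by blast
  have v0: "v \<ge> 0" using L2_le_nonneg[OF Z[of 1]] M by auto
  have indY: "indep_vars (\<lambda>_. borel) Y {1..m}"
    using indep_vars_compose2[OF ind, of "\<lambda>i u. u - expectation (Z i)" "\<lambda>_. borel"] by (simp add: Y_def[abs_def])
  have EY: "expectation (Y i) = 0" if "i \<in> {1..m}" for i
    unfolding Y_def using bZ[OF that] by (subst Bochner_Integration.integral_diff) (auto intro: bounded_rv_integrable simp: prob_space)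
  have eq: "1 / real m * (\<Sum>i=1..m. Z i \<omega>) - expectation (\<lambda>\<omega>. 1 / real m * (\<Sum>i=1..m. Z i \<omega>)) = 1 / real m * (\<Sum>i=1..m. Y i \<omega>)" for \<omega>
  proof -
    have "expectation (\<lambda>\<omega>. 1 / real m * (\<Sum>i=1..m. Z i \<omega>)) = 1 / real m * (\<Sum>i=1..m. expectation (Z i))"
      using bZ by (subst integral_mult_right_zero, subst Bochner_Integration.integral_sum) (auto intro: bounded_rv_integrable)
    then show ?thesis by (simp add: Y_def sum_subtractf right_diff_distrib)
  qed
  have "expectation (\<lambda>\<omega>. (1 / real m * (\<Sum>i=1..m. Y i \<omega>))\<^sup>2) = (1 / real m)\<^sup>2 * (\<Sum>i=1..m. expectation (\<lambda>\<omega>. (Y i \<omega>)\<^sup>2))"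
    unfolding power_mult_distrib
    by (subst integral_mult_right_zero, subst second_moment_indep_sum[OF _ indY]) (auto intro: bY EY)
  also have "\<dots> \<le> (1 / real m)\<^sup>2 * (\<Sum>i=1..m. v\<^sup>2)"
    using Z unfolding Y_def L2_le_def by (intro mult_left_mono sum_mono) auto
  also have "\<dots> = (v / sqrt (real m))\<^sup>2" using M by (simp add: power_divide power2_eq_square)
  finally show ?thesis unfolding eq using v0 M
    unfolding L2_le_def by (intro conjI bounded_rv_intros bY) auto
qed

text \<open>
  Conditioning on the first of two independent variables.
\<close>

lemma expectation_indep_pair:
  fixes g :: "'b \<times> 'b \<Rightarrow> real"
  assumes ind: "indep_var S X R Y" and g: "g \<in> borel_measurable (S \<Otimes>\<^sub>M R)"
    and b: "\<And>p. p \<in> space (S \<Otimes>\<^sub>M R) \<Longrightarrow> \<bar>g p\<bar> \<le> C"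
  shows "integrable (distr M S X) (\<lambda>x. expectation (\<lambda>\<omega>. g (x, Y \<omega>)))"
    "expectation (\<lambda>\<omega>. g (X \<omega>, Y \<omega>)) = (\<integral>x. expectation (\<lambda>\<omega>. g (x, Y \<omega>)) \<partial>distr M S X)"
proof -
  have rv: "random_variable S X" "random_variable R Y"
    and eq: "distr M S X \<Otimes>\<^sub>M distr M R Y = distr M (S \<Otimes>\<^sub>M R) (\<lambda>x. (X x, Y x))"
    using ind unfolding indep_var_distribution_eq by auto
  interpret X: prob_space "distr M S X" by (rule prob_space_distr) fact
  interpret Y: prob_space "distr M R Y" by (rule prob_space_distr) fact
  interpret XY: pair_prob_space "distr M S X" "distr M R Y" ..
  have int: "integrable (distr M S X \<Otimes>\<^sub>M distr M R Y) g"
    by (rule XY.integrable_const_bound[of _ C]) (use g b in \<open>auto simp: space_pair_measure\<close>)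
  have inner: "(\<integral>y. g (x, y) \<partial>distr M R Y) = expectation (\<lambda>\<omega>. g (x, Y \<omega>))" if "x \<in> space S" for x
    using that rv g by (intro integral_distr) auto
  have "integrable (distr M S X) (\<lambda>x. \<integral>y. g (x, y) \<partial>distr M R Y)" by (rule XY.integrable_fst'[OF int])
  then show "integrable (distr M S X) (\<lambda>x. expectation (\<lambda>\<omega>. g (x, Y \<omega>)))"
    by (rule Bochner_Integration.integrable_cong[THEN iffD1, rotated -1]) (auto simp: inner)
  have "expectation (\<lambda>\<omega>. g (X \<omega>, Y \<omega>)) = (\<integral>p. g p \<partial>distr M (S \<Otimes>\<^sub>M R) (\<lambda>x. (X x, Y x)))"
    using rv g by (subst integral_distr) auto
  also have "\<dots> = (\<integral>x. \<integral>y. g (x, y) \<partial>distr M R Y \<partial>distr M S X)"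
    unfolding eq[symmetric] by (rule XY.integral_fst'[OF int, symmetric])
  also have "\<dots> = (\<integral>x. expectation (\<lambda>\<omega>. g (x, Y \<omega>)) \<partial>distr M S X)"
    by (intro Bochner_Integration.integral_cong) (auto simp: inner)
  finally show "expectation (\<lambda>\<omega>. g (X \<omega>, Y \<omega>)) = (\<integral>x. expectation (\<lambda>\<omega>. g (x, Y \<omega>)) \<partial>distr M S X)" .
qed

text \<open>
  A bound that holds for each frozen value of an independent argument survives randomization of that
  argument.
\<close>

lemma L2_le_indep_pair:
  fixes g :: "'b \<times> 'b \<Rightarrow> real"
  assumes ind: "indep_var S X R Y" and g: "g \<in> borel_measurable (S \<Otimes>\<^sub>M R)"
    and b: "\<And>p. p \<in> space (S \<Otimes>\<^sub>M R) \<Longrightarrow> \<bar>g p\<bar> \<le> C"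
    and le: "\<And>x. x \<in> space S \<Longrightarrow> L2_le (\<lambda>\<omega>. g (x, Y \<omega>)) a" and a: "0 \<le> a"
  shows "L2_le (\<lambda>\<omega>. g (X \<omega>, Y \<omega>)) a"
proof -
  have rv: "random_variable S X" "random_variable R Y"
    using ind unfolding indep_var_distribution_eq by auto
  interpret X: prob_space "distr M S X" by (rule prob_space_distr) fact
  have g2: "(\<lambda>p. (g p)\<^sup>2) \<in> borel_measurable (S \<Otimes>\<^sub>M R)" using g by measurable
  have b2: "\<bar>(g p)\<^sup>2\<bar> \<le> C\<^sup>2" if "p \<in> space (S \<Otimes>\<^sub>M R)" for p
    using power_mono[OF b[OF that], of 2] by simp
  have "expectation (\<lambda>\<omega>. (g (X \<omega>, Y \<omega>))\<^sup>2) = (\<integral>x. expectation (\<lambda>\<omega>. (g (x, Y \<omega>))\<^sup>2) \<partial>distr M S X)"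
    by (rule expectation_indep_pair(2)[OF ind g2 b2])
  also have "\<dots> \<le> a\<^sup>2"
  proof (rule X.integral_le_const)
    show "integrable (distr M S X) (\<lambda>x. expectation (\<lambda>\<omega>. (g (x, Y \<omega>))\<^sup>2))"
      by (rule expectation_indep_pair(1)[OF ind g2 b2])
    show "AE x in distr M S X. expectation (\<lambda>\<omega>. (g (x, Y \<omega>))\<^sup>2) \<le> a\<^sup>2"
      using le by (intro AE_I2) (simp add: L2_le_def)
  qed
  finally have "expectation (\<lambda>\<omega>. (g (X \<omega>, Y \<omega>))\<^sup>2) \<le> a\<^sup>2" .
  moreover have "bounded_rv (\<lambda>\<omega>. g (X \<omega>, Y \<omega>))"
  proof (rule bounded_rvI[of _ C])
    have pair: "(\<lambda>\<omega>. (X \<omega>, Y \<omega>)) \<in> measurable M (S \<Otimes>\<^sub>M R)" using rv by measurable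
    then show "(\<lambda>\<omega>. g (X \<omega>, Y \<omega>)) \<in> borel_measurable M" by (rule measurable_compose[OF _ g])
    show "\<bar>g (X \<omega>, Y \<omega>)\<bar> \<le> C" if "\<omega> \<in> space M" for \<omega>
      using measurable_space[OF pair that] by (rule b)
  qed
  ultimately show ?thesis using a by (simp add: L2_le_def)
qed

end

section \<open>The law of Brownian motion\<close>

abbreviation path_space :: "real \<Rightarrow> nat \<Rightarrow> (real \<Rightarrow> nat \<Rightarrow> real) measure" where
  "path_space T d \<equiv> \<Pi>\<^sub>M t\<in>{0..T}. Rd d"

lemma brownian_motion_prob: "brownian_motion P T d W \<Longrightarrow> prob_space P"
  by (simp add: brownian_motion_def)

lemma brownian_motion_measurable: "brownian_motion P T d W \<Longrightarrow> t \<in> {0..T} \<Longrightarrow> W t \<in> measurable P (Rd d)"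
  by (simp add: brownian_motion_def)

lemma brownian_path_measurable:
  "brownian_motion P T d W \<Longrightarrow> (\<lambda>\<omega>. \<lambda>t\<in>{0..T}. W t \<omega>) \<in> measurable P (path_space T d)"
  by (intro measurable_restrict brownian_motion_measurable)

lemma finite_grid:
  fixes S :: "real set"
  assumes "finite S" "S \<noteq> {}" "\<And>s. s \<in> S \<Longrightarrow> a \<le> s" "a \<in> S"
  shows "\<exists>\<tau> m. S = \<tau> ` {..m} \<and> (\<forall>k<m. \<tau> k < \<tau> (Suc k)) \<and> \<tau> 0 = a"
proof -
  define l where "l = sorted_list_of_set S"
  have l: "set l = S" "sorted_wrt (<) l" "length l = card S" "card S > 0"
    using assms by (auto simp: l_def strict_sorted_iff card_gt_0_iff)
  have "\<forall>k<card S - 1. l ! k < l ! Suc k" using l by (auto intro: sorted_wrt_nth_less)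
  moreover have img: "S = (!) l ` {..card S - 1}"
  proof -
    have "set l = (!) l ` {..<length l}" by (auto simp: set_conv_nth)
    moreover have "{..<length l} = {..card S - 1}" using l by auto
    ultimately show ?thesis using l by simp
  qed
  moreover have "l ! 0 = a"
  proof -
    obtain k where k: "k < length l" "l ! k = a" using assms(4) l(1) by (metis in_set_conv_nth)
    have "l ! 0 \<in> S" using l by (metis nth_mem)
    then have "a \<le> l ! 0" by (rule assms(3))
    moreover have "l ! 0 \<le> l ! k" using k l(2) sorted_wrt_nth_less[of "(<)" l 0 k] by (cases "k = 0") auto
    ultimately show ?thesis using k by simp
  qed
  ultimately show ?thesis using l(4) by (intro exI[of _ "(!) l"] exI[of _ "card S - 1"]) auto
qed

text \<open>
  Since \<open>W 0\<close> vanishes almost surely, the positions on a grid are partial sums of increments, whose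
  joint law is prescribed. The right-hand side does not mention the process.
\<close>

lemma brownian_motion_fdd:
  fixes P :: "'a measure" and W :: "real \<Rightarrow> 'a \<Rightarrow> nat \<Rightarrow> real"
  assumes W: "brownian_motion P T d W"
    and \<tau>: "\<And>k. k \<le> m \<Longrightarrow> \<tau> k \<in> {0..T}" "\<And>k. k < m \<Longrightarrow> \<tau> k < \<tau> (Suc k)" "\<tau> 0 = 0" and m: "m > 0"
    and J: "finite J" "\<And>t. t \<in> J \<Longrightarrow> idx t \<le> m \<and> \<tau> (idx t) = t"
    and A: "\<And>t. t \<in> J \<Longrightarrow> A t \<in> sets (Rd d)"
  shows "emeasure P {\<omega>\<in>space P. \<forall>t\<in>J. W t \<omega> \<in> A t} =
    emeasure (\<Pi>\<^sub>M k\<in>{..<m}. gaussian_law d (\<tau> (Suc k) - \<tau> k))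
      {v\<in>space (\<Pi>\<^sub>M k\<in>{..<m}. Rd d). \<forall>t\<in>J. (\<lambda>i\<in>{..<d}. \<Sum>l<idx t. v l i) \<in> A t}" (is "_ = emeasure ?G ?B")
proof -
  interpret prob_space P using W by (rule brownian_motion_prob)
  have meas: "W t \<in> measurable P (Rd d)" if "t \<in> {0..T}" for t
    using W that by (rule brownian_motion_measurable)
  define D where "D = (\<lambda>k \<omega>. vdiff d (W (\<tau> (Suc k)) \<omega>) (W (\<tau> k) \<omega>))"
  have Wc: "(\<lambda>\<omega>. W t \<omega> i) \<in> borel_measurable P" if "t \<in> {0..T}" "i < d" for t i
    using measurable_compose[OF meas[OF that(1)] measurable_component_singleton[of i "{..<d}" "\<lambda>_. borel"]] that by simp
  have Dm: "D k \<in> measurable P (Rd d)" if "k < m" for k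
    unfolding D_def vdiff_def using \<tau>(1)[of k] \<tau>(1)[of "Suc k"] that
    by (intro measurable_restrict borel_measurable_diff Wc) auto
  have ind: "indep_vars (\<lambda>_. Rd d) D {..<m}"
    using W \<tau> unfolding brownian_motion_def D_def by blast
  have law: "distr P (Rd d) (D k) = gaussian_law d (\<tau> (Suc k) - \<tau> k)" if "k < m" for k
    using W \<tau>(1)[of k] \<tau>(1)[of "Suc k"] \<tau>(2)[of k] that unfolding brownian_motion_def D_def by auto
  have joint: "distr P (\<Pi>\<^sub>M k\<in>{..<m}. Rd d) (\<lambda>\<omega>. \<lambda>k\<in>{..<m}. D k \<omega>) = ?G"
  proof -
    have "distr P (\<Pi>\<^sub>M k\<in>{..<m}. Rd d) (\<lambda>\<omega>. \<lambda>k\<in>{..<m}. D k \<omega>) = (\<Pi>\<^sub>M k\<in>{..<m}. distr P (Rd d) (D k))"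
      using ind m Dm by (subst (asm) indep_vars_iff_distr_eq_PiM') auto
    also have "\<dots> = ?G" by (intro PiM_cong) (auto simp: law)
    finally show ?thesis .
  qed
  have "(\<lambda>v. \<lambda>i\<in>{..<d}. \<Sum>l<idx t. v l i) \<in> measurable (\<Pi>\<^sub>M k\<in>{..<m}. Rd d) (Rd d)" if "t \<in> J" for t
  proof (intro measurable_restrict borel_measurable_sum)
    fix i l assume "i \<in> {..<d}" "l \<in> {..<idx t}"
    then have "l \<in> {..<m}" "i \<in> {..<d}" using J(2)[OF that] by auto
    then show "(\<lambda>v. v l i) \<in> borel_measurable (\<Pi>\<^sub>M k\<in>{..<m}. Rd d)"
      using measurable_compose[OF measurable_component_singleton[of l "{..<m}" "\<lambda>_. Rd d"]
        measurable_component_singleton[of i "{..<d}" "\<lambda>_. borel"]] by simp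
  qed
  then have Bm: "?B \<in> sets (\<Pi>\<^sub>M k\<in>{..<m}. Rd d)"
    using J(1) A by (intro sets.sets_Collect_finite_All) (auto intro: measurable_sets_Collect)
  have Dr: "(\<lambda>\<omega>. \<lambda>k\<in>{..<m}. D k \<omega>) \<in> measurable P (\<Pi>\<^sub>M k\<in>{..<m}. Rd d)"
    using Dm by (intro measurable_restrict) auto
  have "emeasure ?G ?B = emeasure P ((\<lambda>\<omega>. \<lambda>k\<in>{..<m}. D k \<omega>) -` ?B \<inter> space P)"
    unfolding joint[symmetric] by (rule emeasure_distr[OF Dr Bm])
  also have "\<dots> = emeasure P {\<omega>\<in>space P. \<forall>t\<in>J. W t \<omega> \<in> A t}"
  proof (rule emeasure_eq_AE)
    have "AE \<omega> in P. \<forall>i<d. W 0 \<omega> i = 0" using W by (simp add: brownian_motion_def)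
    then show "AE \<omega> in P. \<omega> \<in> (\<lambda>\<omega>. \<lambda>k\<in>{..<m}. D k \<omega>) -` ?B \<inter> space P \<longleftrightarrow>
        \<omega> \<in> {\<omega>\<in>space P. \<forall>t\<in>J. W t \<omega> \<in> A t}"
    proof (rule AE_mp, intro AE_I2 impI)
      fix \<omega> assume \<omega>: "\<omega> \<in> space P" and 0: "\<forall>i<d. W 0 \<omega> i = 0"
      have "(\<lambda>i\<in>{..<d}. \<Sum>l<idx t. (\<lambda>k\<in>{..<m}. D k \<omega>) l i) = W t \<omega>" if "t \<in> J" for t
      proof
        fix i
        have tT: "t \<in> {0..T}" using J(2)[OF that] \<tau>(1) by metis
        have ext: "W t \<omega> \<in> extensional {..<d}"
          using measurable_space[OF meas[OF tT] \<omega>] by (auto simp: space_PiM PiE_def)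
        show "(\<lambda>i\<in>{..<d}. \<Sum>l<idx t. (\<lambda>k\<in>{..<m}. D k \<omega>) l i) i = W t \<omega> i"
        proof (cases "i < d")
          case True
          have "(\<Sum>l<idx t. (\<lambda>k\<in>{..<m}. D k \<omega>) l i) = (\<Sum>l<idx t. W (\<tau> (Suc l)) \<omega> i - W (\<tau> l) \<omega> i)"
            using J(2)[OF that] True by (intro sum.cong) (auto simp: D_def vdiff_def)
          also have "\<dots> = W t \<omega> i" using J(2)[OF that] 0 True \<tau>(3)
            by (subst sum_lessThan_telescope[of "\<lambda>l. W (\<tau> l) \<omega> i"]) simp
          finally show ?thesis using True by simp
        next
          case False
          then show ?thesis using ext by (simp add: extensional_def)
        qed
      qed
      moreover have "(\<lambda>k\<in>{..<m}. D k \<omega>) \<in> space (\<Pi>\<^sub>M k\<in>{..<m}. Rd d)"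
        using measurable_space[OF Dr \<omega>] by simp
      ultimately show "\<omega> \<in> (\<lambda>\<omega>. \<lambda>k\<in>{..<m}. D k \<omega>) -` ?B \<inter> space P \<longleftrightarrow>
        \<omega> \<in> {\<omega>\<in>space P. \<forall>t\<in>J. W t \<omega> \<in> A t}" using \<omega> by auto
    qed
    show "(\<lambda>\<omega>. \<lambda>k\<in>{..<m}. D k \<omega>) -` ?B \<inter> space P \<in> sets P" by (rule measurable_sets[OF Dr Bm])
    have "t \<in> {0..T}" if "t \<in> J" for t using J(2)[OF that] \<tau>(1) by metis
    show "{\<omega>\<in>space P. \<forall>t\<in>J. W t \<omega> \<in> A t} \<in> sets P"
    proof (intro sets.sets_Collect_finite_All)
      fix t assume t: "t \<in> J"
      have "{\<omega>\<in>space P. W t \<omega> \<in> A t} = W t -` A t \<inter> space P" by auto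
      then show "{\<omega>\<in>space P. W t \<omega> \<in> A t} \<in> sets P"
        using measurable_sets[OF meas A[OF t]] \<open>\<And>t. t \<in> J \<Longrightarrow> t \<in> {0..T}\<close>[OF t] by simp
    qed (rule J(1))
  qed
  finally show ?thesis by simp
qed

text \<open>
  A law on path space is determined by its finite-dimensional marginals.
  The time \<open>T\<close> is added to the grid so that it has at least one increment, even if the finite-dimensional
  event only concerns time \<open>0\<close>.
\<close>

lemma brownian_path_law_unique:
  fixes P :: "'a measure" and N :: "'b measure"
  assumes T: "T > 0" and W: "brownian_motion P T d W" and B: "brownian_motion N T d B"
  shows "distr P (path_space T d) (\<lambda>\<omega>. \<lambda>t\<in>{0..T}. W t \<omega>) = distr N (path_space T d) (\<lambda>\<omega>. \<lambda>t\<in>{0..T}. B t \<omega>)"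
proof (rule measure_eqI_PiM_infinite)
  interpret P: prob_space P using W by (rule brownian_motion_prob)
  show "finite_measure (distr P (path_space T d) (\<lambda>\<omega>. \<lambda>t\<in>{0..T}. W t \<omega>))"
    by (intro P.finite_measure_distr brownian_path_measurable[OF W])
  fix A and J :: "real set"
  assume J: "finite J" "J \<subseteq> {0..T}" and A: "\<And>t. t \<in> J \<Longrightarrow> A t \<in> sets (Rd d)"
  let ?E = "prod_emb {0..T} (\<lambda>_. Rd d) J (Pi\<^sub>E J A)"
  have E: "?E \<in> sets (path_space T d)" using J A by (intro sets_PiM_I) auto
  have "\<exists>\<tau> m. insert T (insert 0 J) = \<tau> ` {..m} \<and> (\<forall>k<m. \<tau> k < \<tau> (Suc k)) \<and> \<tau> 0 = 0"
    using J T by (intro finite_grid) auto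
  then obtain \<tau> :: "nat \<Rightarrow> real" and m where \<tau>: "insert T (insert 0 J) = \<tau> ` {..m}" "\<And>k. k < m \<Longrightarrow> \<tau> k < \<tau> (Suc k)" "\<tau> 0 = 0"
    by blast
  have m: "m > 0"
  proof (rule ccontr)
    assume "\<not> m > 0"
    then have "insert T (insert 0 J) = {0}" using \<tau> by simp
    then show False using T by auto
  qed
  have \<tau>T: "\<tau> k \<in> {0..T}" if "k \<le> m" for k
  proof -
    have "\<tau> k \<in> insert T (insert 0 J)" unfolding \<tau>(1) using that by auto
    then show ?thesis using J T by auto
  qed
  have "\<forall>t\<in>J. \<exists>k. k \<le> m \<and> \<tau> k = t"
  proof
    fix t assume "t \<in> J"
    then have "t \<in> \<tau> ` {..m}" unfolding \<tau>(1)[symmetric] by simp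
    then show "\<exists>k. k \<le> m \<and> \<tau> k = t" by auto
  qed
  then obtain idx where idx: "\<And>t. t \<in> J \<Longrightarrow> idx t \<le> m \<and> \<tau> (idx t) = t" by metis
  have pre: "(\<lambda>\<omega>. \<lambda>t\<in>{0..T}. X t \<omega>) -` ?E \<inter> space R = {\<omega>\<in>space R. \<forall>t\<in>J. X t \<omega> \<in> A t}"
    if "brownian_motion R T d X" for R :: "'c measure" and X
    using J measurable_space[OF brownian_path_measurable[OF that]]
    by (auto simp: prod_emb_def space_PiM PiE_iff Pi_iff subset_iff)
  show "emeasure (distr P (path_space T d) (\<lambda>\<omega>. \<lambda>t\<in>{0..T}. W t \<omega>)) ?E =
      emeasure (distr N (path_space T d) (\<lambda>\<omega>. \<lambda>t\<in>{0..T}. B t \<omega>)) ?E"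
    unfolding emeasure_distr[OF brownian_path_measurable[OF W] E] emeasure_distr[OF brownian_path_measurable[OF B] E]
      pre[OF W] pre[OF B]
    by (rule trans[OF brownian_motion_fdd[where \<tau> = \<tau> and idx = idx and m = m]
          brownian_motion_fdd[where \<tau> = \<tau> and idx = idx and m = m, symmetric]])
       (use W B \<tau>T \<tau>(2,3) m J(1) idx A in auto)
qed simp_all

lemma brownian_marginal_unique:
  fixes P :: "'a measure" and N :: "'b measure"
  assumes "T > 0" "brownian_motion P T d W" "brownian_motion N T d B" and s: "s \<in> {0..T}"
  shows "distr P (Rd d) (W s) = distr N (Rd d) (B s)"
proof -
  have "distr R (Rd d) (X s) = distr (distr R (path_space T d) (\<lambda>\<omega>. \<lambda>t\<in>{0..T}. X t \<omega>)) (Rd d) (\<lambda>b. b s)"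
    if "brownian_motion R T d X" for R :: "'c measure" and X
    using s brownian_path_measurable[OF that]
    by (subst distr_distr) (auto intro!: distr_cong measurable_component_singleton)
  note this[OF assms(2)] this[OF assms(3)] brownian_path_law_unique[OF assms(1-3)]
  then show ?thesis by simp
qed



section \<open>The random fields\<close>

lemma vadd_in_space: "vadd d x v \<in> space (Rd d)"
  by (simp add: vadd_def space_PiM)

lemma vadd_measurable:
  assumes "X \<in> measurable S (Rd d)" "Z \<in> measurable S (Rd d)"
  shows "(\<lambda>\<omega>. vadd d (X \<omega>) (Z \<omega>)) \<in> measurable S (Rd d)"
proof -
  have "(\<lambda>\<omega>. U \<omega> i) \<in> borel_measurable S" if "U \<in> measurable S (Rd d)" "i \<in> {..<d}" for U i
    using measurable_compose[OF that(1) measurable_component_singleton[of i "{..<d}" "\<lambda>_. borel"]] that(2) by simp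
  with assms show ?thesis unfolding vadd_def by (intro measurable_restrict borel_measurable_add) auto
qed

text \<open>
  The scheme without its probability space: estimates and identities that hold for every realization
  of the driving motions.
\<close>

locale mlp_scheme = legendre_rule Q \<xi> \<beta> for Q \<xi> \<beta> +
  fixes T Cf C0 C\<phi> :: real and d M :: nat
    and f :: "real \<Rightarrow> real \<Rightarrow> real" and \<phi> :: "(nat \<Rightarrow> real) \<Rightarrow> real"
  assumes T: "T > 0" and M: "M \<ge> 1" and Cf: "Cf > 0" and C0: "C0 > 0" and C\<phi>: "C\<phi> > 0"
    and f_lip: "\<And>s u v. s \<in> {0..T} \<Longrightarrow> \<bar>f s u - f s v\<bar> \<le> Cf * \<bar>u - v\<bar>"
    and f_0: "\<And>s. s \<in> {0..T} \<Longrightarrow> \<bar>f s 0\<bar> \<le> C0"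
    and \<phi>_meas: "\<phi> \<in> borel_measurable (Rd d)"
    and \<phi>_le: "\<And>x. x \<in> space (Rd d) \<Longrightarrow> \<bar>\<phi> x\<bar> \<le> C\<phi>"
begin

abbreviation node where "node \<equiv> gl_node T \<xi>"
abbreviation weight where "weight \<equiv> gl_weight T \<beta>"
abbreviation Y where "Y \<equiv> mlp T d M Q \<xi> \<beta> f \<phi>"

lemma node_in: "t \<in> {0..T} \<Longrightarrow> j \<in> {1..Q} \<Longrightarrow> node t j \<in> {0..T}"
  using gl_node_in[of t T j] by auto

lemma node_diff_in: "t \<in> {0..T} \<Longrightarrow> j \<in> {1..Q} \<Longrightarrow> node t j - t \<in> {0..T}"
  using gl_node_in[of t T j] by auto

lemma weight_ge_0: "t \<in> {0..T} \<Longrightarrow> j \<in> {1..Q} \<Longrightarrow> 0 \<le> weight t j"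
  by (rule gl_weight_nonneg) auto

lemma weight_sum_le: "t \<in> {0..T} \<Longrightarrow> (\<Sum>j=1..Q. weight t j) \<le> T"
  using gl_power_le[of t T 0] by simp

lemma f_measurable: "s \<in> {0..T} \<Longrightarrow> f s \<in> borel_measurable borel"
proof (rule borel_measurable_continuous_onI)
  assume s: "s \<in> {0..T}"
  have "Cf-lipschitz_on UNIV (f s)"
    using f_lip[OF s] Cf by (intro lipschitz_onI) (auto simp: dist_real_def)
  then show "continuous_on UNIV (f s)" by (rule lipschitz_on_continuous_on)
qed

lemma f_growth: "s \<in> {0..T} \<Longrightarrow> \<bar>f s u\<bar> \<le> Cf * \<bar>u\<bar> + C0"
  using f_lip[of s u 0] f_0[of s] by simp

text \<open>
  Joint measurability in the space point and the randomness is needed since the fields are evaluated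
  at random points.
\<close>

lemma mlp_measurable:
  assumes "\<And>p n i s. s \<in> {0..T} \<Longrightarrow> B (\<theta> @ p) n i s \<in> measurable S (Rd d)" "t \<in> {0..T}"
  shows "(\<lambda>q. Y \<kappa> B n \<theta> t (fst q) (snd q)) \<in> borel_measurable (Rd d \<Otimes>\<^sub>M S)"
  using assms
proof (induction n arbitrary: \<theta> t rule: induct_nat_012)
  case 0
  show ?case by simp
next
  case 1
  have "B \<theta> 1 i (T - t) \<in> measurable S (Rd d)" for i using 1(1)[of "T - t" "[]"] 1(2) by simp
  then have "(\<lambda>q. vadd d (fst q) (B \<theta> 1 i (T - t) (snd q))) \<in> measurable (Rd d \<Otimes>\<^sub>M S) (Rd d)" for i
    by (intro vadd_measurable measurable_fst) (rule measurable_compose[OF measurable_snd])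
  note meas = measurable_compose[OF this \<phi>_meas]
  show ?case unfolding mlp.simps
    by (intro borel_measurable_add borel_measurable_times borel_measurable_sum measurable_const meas) simp_all
next
  case (ge2 n)
  have ext: "B ((\<theta> @ p') @ p) m i s \<in> measurable S (Rd d)" if "s \<in> {0..T}" for p p' m i s
    using ge2(3)[OF that] by simp
  have pt: "(\<lambda>q. (vadd d (fst q) (B \<theta> m i (node t j - t) (snd q)), snd q)) \<in> measurable (Rd d \<Otimes>\<^sub>M S) (Rd d \<Otimes>\<^sub>M S)"
    if "j \<in> {1..Q}" for m i j
  proof -
    have "B \<theta> m i (node t j - t) \<in> measurable S (Rd d)"
      using ge2(3)[of "node t j - t" "[]"] node_diff_in[OF ge2(4) that] by simp
    then show ?thesis
      by (intro measurable_Pair vadd_measurable measurable_fst measurable_snd) (rule measurable_compose[OF measurable_snd])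
  qed
  have ev: "(\<lambda>q. f (node t j) (Y \<kappa> B k (\<theta> @ p') (node t j) (vadd d (fst q) (B \<theta> m i (node t j - t) (snd q))) (snd q)))
      \<in> borel_measurable (Rd d \<Otimes>\<^sub>M S)" if "j \<in> {1..Q}" "k = n \<or> k = Suc n" for m i j k p'
  proof -
    have "(\<lambda>q. Y \<kappa> B k (\<theta> @ p') (node t j) (fst q) (snd q)) \<in> borel_measurable (Rd d \<Otimes>\<^sub>M S)"
      using that(2) ge2(1)[OF ext node_in[OF ge2(4) that(1)], of p'] ge2(2)[OF ext node_in[OF ge2(4) that(1)], of p'] by auto
    from measurable_compose[OF measurable_compose[OF pt[OF that(1)] this] f_measurable[OF node_in[OF ge2(4) that(1)]]]
    show ?thesis by simp
  qed
  show ?case unfolding mlp.simps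
    by (intro borel_measurable_add borel_measurable_diff borel_measurable_times borel_measurable_sum measurable_const ge2(2)[OF ext ge2(4)] ev)
       auto
qed

lemma mlp_measurable_section:
  assumes "\<And>p n i s. s \<in> {0..T} \<Longrightarrow> B (\<theta> @ p) n i s \<in> measurable S (Rd d)" "t \<in> {0..T}" "x \<in> space (Rd d)"
  shows "Y \<kappa> B n \<theta> t x \<in> borel_measurable S"
proof -
  have "(\<lambda>q. Y \<kappa> B n \<theta> t (fst q) (snd q)) \<in> borel_measurable (Rd d \<Otimes>\<^sub>M S)"
    by (rule mlp_measurable) fact+
  from measurable_compose[OF measurable_Pair1'[OF assms(3)] this] show ?thesis by simp
qed

text \<open>
  The realization labelled \<open>\<theta>\<close> depends on the motions whose labels extend \<open>\<theta>\<close> only.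
\<close>

lemma mlp_cong:
  assumes "\<And>p n i s. s \<in> {0..T} \<Longrightarrow> B (\<theta> @ p) n i s \<omega> = B' (\<theta> @ p) n i s \<omega>'" "t \<in> {0..T}"
  shows "Y \<kappa> B n \<theta> t x \<omega> = Y \<kappa> B' n \<theta> t x \<omega>'"
  using assms
proof (induction n arbitrary: \<theta> t x rule: induct_nat_012)
  case 0
  show ?case by simp
next
  case 1
  have "B \<theta> 1 i (T - t) \<omega> = B' \<theta> 1 i (T - t) \<omega>'" for i using 1(1)[of "T - t" "[]"] 1(2) by simp
  then show ?case unfolding mlp.simps by (simp only:)
next
  case (ge2 n)
  have ext: "B ((\<theta> @ p') @ p) m i s \<omega> = B' ((\<theta> @ p') @ p) m i s \<omega>'" if "s \<in> {0..T}" for p p' m i s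
    using ge2(3)[OF that] by simp
  have pt: "B \<theta> m i (node t j - t) \<omega> = B' \<theta> m i (node t j - t) \<omega>'" if "j \<in> {1..Q}" for m i j
    using ge2(3)[of "node t j - t" "[]"] node_diff_in[OF ge2(4) that] by simp
  have sub: "Y \<kappa> B n (\<theta> @ p') s x' \<omega> = Y \<kappa> B' n (\<theta> @ p') s x' \<omega>'"
    "Y \<kappa> B (Suc n) (\<theta> @ p') s x' \<omega> = Y \<kappa> B' (Suc n) (\<theta> @ p') s x' \<omega>'" if "s \<in> {0..T}" for p' s x'
    using ge2(1)[OF ext that, of p'] ge2(2)[OF ext that, of p'] by auto
  show ?case unfolding mlp.simps
    using ge2(4) node_in[OF ge2(4)] by (intro arg_cong2[of _ _ _ _ "(+)"] arg_cong2[of _ _ _ _ "(*)"] sum.cong refl) (simp_all add: sub pt)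
qed


definition correction where
  "correction \<kappa> B n \<theta> t x i \<omega> = (\<Sum>j=1..Q. weight t j *
     (f (node t j) (Y \<kappa> B (Suc n) (\<theta> @ [Eval i j]) (node t j)
         (vadd d x (B \<theta> (Suc (Suc n)) i (node t j - t) \<omega>)) \<omega>)
      - f (node t j) (Y \<kappa> B n (\<theta> @ [Eval i j, Copy (\<kappa> (\<theta> @ [Eval i j]))]) (node t j)
         (vadd d x (B \<theta> (Suc (Suc n)) i (node t j - t) \<omega>)) \<omega>)))"

text \<open>
  The correction is regrouped so that the whole field is a mean over \<open>i\<close>; these summands will be
  independent, whereas the nodes \<open>j\<close> share a motion.
\<close>

lemma mlp_Suc_Suc:
  "Y \<kappa> B (Suc (Suc n)) \<theta> t x \<omega> =
     1 / real M * (\<Sum>i=1..M. Y \<kappa> B (Suc n) (\<theta> @ [Copy i]) t x \<omega> + correction \<kappa> B n \<theta> t x i \<omega>)"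
proof -
  have "(\<Sum>j=1..Q. weight t j / real M * (\<Sum>i=1..M. a i j)) = 1 / real M * (\<Sum>i=1..M. \<Sum>j=1..Q. weight t j * a i j)" for a
    by (subst sum.swap) (simp add: sum_distrib_left mult.assoc)
  then show ?thesis by (simp only: mlp.simps correction_def sum.distrib distrib_left)
qed

lemma abs_mean_le:
  assumes "\<And>i. i \<in> {1..M} \<Longrightarrow> \<bar>a i\<bar> \<le> c" shows "\<bar>1 / real M * (\<Sum>i=1..M. a i)\<bar> \<le> c"
proof -
  have "\<bar>\<Sum>i=1..M. a i\<bar> \<le> (\<Sum>i=1..M. c)" using assms by (intro order_trans[OF sum_abs sum_mono])
  then show ?thesis using M by (simp add: abs_mult field_simps)
qed

lemma mean_const: "1 / real M * (\<Sum>i=1..M. c) = c"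
  using M by simp

lemma abs_weighted_sum_le:
  assumes "t \<in> {0..T}" "\<And>j. j \<in> {1..Q} \<Longrightarrow> \<bar>a j\<bar> \<le> b j"
  shows "\<bar>\<Sum>j=1..Q. weight t j * a j\<bar> \<le> (\<Sum>j=1..Q. weight t j * b j)"
proof (rule order_trans[OF sum_abs sum_mono])
  fix j assume j: "j \<in> {1..Q}"
  show "\<bar>weight t j * a j\<bar> \<le> weight t j * b j"
    unfolding abs_mult abs_of_nonneg[OF weight_ge_0[OF assms(1) j]]
    by (rule mult_left_mono[OF assms(2)[OF j] weight_ge_0[OF assms(1) j]])
qed

lemma abs_weighted_sum_le_const:
  assumes "t \<in> {0..T}" "\<And>j. j \<in> {1..Q} \<Longrightarrow> \<bar>a j\<bar> \<le> c" "0 \<le> c"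
  shows "\<bar>\<Sum>j=1..Q. weight t j * a j\<bar> \<le> T * c"
proof -
  have "\<bar>\<Sum>j=1..Q. weight t j * a j\<bar> \<le> (\<Sum>j=1..Q. weight t j * c)"
    using assms by (intro abs_weighted_sum_le) auto
  also have "\<dots> = (\<Sum>j=1..Q. weight t j) * c" by (simp add: sum_distrib_right)
  also have "\<dots> \<le> T * c" using weight_sum_le[OF assms(1)] assms(3) by (rule mult_right_mono)
  finally show ?thesis .
qed

lemma mlp_1_le: "t \<in> {0..T} \<Longrightarrow> \<bar>Y \<kappa> B (Suc 0) \<theta> t x \<omega>\<bar> \<le> C\<phi> + T * C0"
proof -
  assume t: "t \<in> {0..T}"
  have "\<bar>1 / real M * (\<Sum>i = 1..M. \<phi> (vadd d x (B \<theta> 1 i (T - t) \<omega>)))\<bar> \<le> C\<phi>"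
    by (intro abs_mean_le \<phi>_le vadd_in_space)
  moreover have "\<bar>\<Sum>j = 1..Q. weight t j * f (node t j) 0\<bar> \<le> T * C0"
    using t C0 by (intro abs_weighted_sum_le_const f_0 node_in) auto
  ultimately show ?thesis unfolding mlp.simps by linarith
qed

lemma mlp_bounded: "\<exists>C\<ge>0. \<forall>\<theta>. \<forall>t\<in>{0..T}. \<forall>x \<omega>. \<bar>Y \<kappa> B n \<theta> t x \<omega>\<bar> \<le> C"
proof (induction n rule: induct_nat_012)
  case 0
  show ?case by (intro exI[of _ 0]) simp
next
  case 1
  have "0 \<le> C\<phi> + T * C0" using T C0 C\<phi> by simp
  then show ?case by (intro exI[of _ "C\<phi> + T * C0"]) (blast intro: mlp_1_le)
next
  case (ge2 n)
  then obtain c c' where c: "c \<ge> 0" "\<And>\<theta> t x \<omega>. t \<in> {0..T} \<Longrightarrow> \<bar>Y \<kappa> B n \<theta> t x \<omega>\<bar> \<le> c"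
    and c': "c' \<ge> 0" "\<And>\<theta> t x \<omega>. t \<in> {0..T} \<Longrightarrow> \<bar>Y \<kappa> B (Suc n) \<theta> t x \<omega>\<bar> \<le> c'" by metis
  have "\<bar>Y \<kappa> B (Suc (Suc n)) \<theta> t x \<omega>\<bar> \<le> c' + T * (Cf * (c' + c))" if t: "t \<in> {0..T}" for \<theta> t x \<omega>
    unfolding mlp_Suc_Suc
  proof (intro abs_mean_le order_trans[OF abs_triangle_ineq add_mono] c' t)
    fix i
    show "\<bar>correction \<kappa> B n \<theta> t x i \<omega>\<bar> \<le> T * (Cf * (c' + c))"
      unfolding correction_def
    proof (intro abs_weighted_sum_le_const t order_trans[OF f_lip] node_in mult_left_mono
        order_trans[OF abs_triangle_ineq4 add_mono] c c')
      show "0 \<le> Cf * (c' + c)" using c c' Cf by simp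
    qed (use Cf in auto)
  qed
  moreover have "0 \<le> c' + T * (Cf * (c' + c))" using c c' Cf T by simp
  ultimately show ?case by blast
qed

end

text \<open>
  Copy \<open>1\<close> is exchanged with copy \<open>\<kappa>\<close> after each prefix, so that the scheme with arbitrary pairing \<open>\<kappa>\<close>
  becomes, along the relabelled motions, the one that always pairs with copy \<open>1\<close>. The last argument is the
  reversed list of steps below the root \<open>\<theta>\<close>.
\<close>

fun relabel :: "(branch list \<Rightarrow> nat) \<Rightarrow> branch list \<Rightarrow> branch list \<Rightarrow> branch list" where
  "relabel \<kappa> \<theta> [] = \<theta>"
| "relabel \<kappa> \<theta> (Copy i # q) =
     relabel \<kappa> \<theta> q @ [Copy (Transposition.transpose 1 (\<kappa> (relabel \<kappa> \<theta> q)) i)]"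
| "relabel \<kappa> \<theta> (Eval i j # q) = relabel \<kappa> \<theta> q @ [Eval i j]"

lemma length_relabel: "length (relabel \<kappa> \<theta> q) = length \<theta> + length q"
  by (induction \<kappa> \<theta> q rule: relabel.induct) auto

lemma relabel_inj: "relabel \<kappa> \<theta> q = relabel \<kappa> \<theta> q' \<Longrightarrow> q = q'"
proof (induction q arbitrary: q')
  case Nil
  then have "length q' = 0" using length_relabel[of \<kappa> \<theta> q'] by simp
  then show ?case by simp
next
  case (Cons b q)
  obtain b' r where q': "q' = b' # r"
    using Cons.prems length_relabel[of \<kappa> \<theta> q'] length_relabel[of \<kappa> \<theta> "b # q"] by (cases q') auto
  have "q = r"
    using Cons.prems unfolding q' by (intro Cons.IH) (cases b; cases b'; simp)
  then show ?case using Cons.prems unfolding q'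
    by (cases b; cases b') (auto dest: injD[OF inj_transpose])
qed

context mlp_scheme
begin

text \<open>
  Exchanging copies is harmless in the mean over all copies, which is invariant under permutations of
  \<open>{1..M}\<close>; in the correction it sends the constant pairing \<open>1\<close> to \<open>\<kappa>\<close>.
\<close>

lemma mlp_relabel:
  assumes \<kappa>: "\<And>\<theta>. \<kappa> \<theta> \<in> {1..M}"
  shows "Y (\<lambda>_. 1) (\<lambda>p. B (relabel \<kappa> \<theta> (rev p))) n p t x \<omega> = Y \<kappa> B n (relabel \<kappa> \<theta> (rev p)) t x \<omega>"
proof (induction n arbitrary: p t x rule: induct_nat_012)
  case 0
  show ?case by simp
next
  case 1
  show ?case by simp
next
  case (ge2 n)
  let ?\<sigma> = "\<lambda>p. relabel \<kappa> \<theta> (rev p)"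
  let ?tr = "Transposition.transpose 1 (\<kappa> (?\<sigma> p))"
  have "?tr permutes {1..M}" using \<kappa> M by (intro permutes_swap_id) auto
  then have perm: "(\<Sum>i=1..M. g (?tr i)) = (\<Sum>i=1..M. g i)" for g :: "nat \<Rightarrow> real"
    by (subst (2) sum.permute[of ?tr]) (auto simp: o_def)
  have "(\<Sum>i=1..M. Y (\<lambda>_. 1) (\<lambda>p. B (?\<sigma> p)) (Suc n) (p @ [Copy i]) t x \<omega>)
      = (\<Sum>i=1..M. Y \<kappa> B (Suc n) (?\<sigma> p @ [Copy (?tr i)]) t x \<omega>)" by (simp add: ge2(2))
  also have "\<dots> = (\<Sum>i=1..M. Y \<kappa> B (Suc n) (?\<sigma> p @ [Copy i]) t x \<omega>)" by (rule perm)
  finally show ?case unfolding mlp.simps by (simp add: ge2)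
qed

end


section \<open>Independence and laws of the random fields\<close>

type_synonym motion_label = "branch list \<times> nat \<times> nat"

definition subtree :: "branch list \<Rightarrow> motion_label set" where
  "subtree \<theta> = {(\<theta> @ p, n, i) | p n i. True}"

text \<open>
  The coordinate process on families of paths, which allows a realization of the scheme to be viewed as
  a measurable function of the paths that drive it.
\<close>

definition coord :: "branch list \<Rightarrow> nat \<Rightarrow> nat \<Rightarrow> real \<Rightarrow> (motion_label \<Rightarrow> real \<Rightarrow> nat \<Rightarrow> real) \<Rightarrow> nat \<Rightarrow> real" where
  "coord \<theta> n i s b = b (\<theta>, n, i) s"

lemma subtree_append: "subtree (\<theta> @ p) \<subseteq> subtree \<theta>"
  by (auto simp: subtree_def)

lemma in_subtree: "(\<theta> @ p, n, i) \<in> subtree \<theta>"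
  by (auto simp: subtree_def)

locale mlp_random = mlp_scheme Q \<xi> \<beta> T Cf C0 C\<phi> d M f \<phi>
  for Q \<xi> \<beta> T Cf C0 C\<phi> d M f \<phi> +
  fixes N :: "'b measure" and B :: "branch list \<Rightarrow> nat \<Rightarrow> nat \<Rightarrow> real \<Rightarrow> 'b \<Rightarrow> nat \<Rightarrow> real"
    and \<kappa> :: "branch list \<Rightarrow> nat"
  assumes ibm: "independent_brownian_motions N T d B" and \<kappa>: "\<And>\<theta>. \<kappa> \<theta> \<in> {1..M}"
begin

sublocale N: prob_space N
  using ibm by (simp add: independent_brownian_motions_def)

abbreviation paths :: "motion_label set \<Rightarrow> (motion_label \<Rightarrow> real \<Rightarrow> nat \<Rightarrow> real) measure" where
  "paths K \<equiv> \<Pi>\<^sub>M l\<in>K. path_space T d"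

definition path :: "motion_label \<Rightarrow> 'b \<Rightarrow> real \<Rightarrow> nat \<Rightarrow> real" where
  "path = (\<lambda>(\<theta>, n, i) \<omega>. \<lambda>t\<in>{0..T}. B \<theta> n i t \<omega>)"

definition block :: "motion_label set \<Rightarrow> 'b \<Rightarrow> motion_label \<Rightarrow> real \<Rightarrow> nat \<Rightarrow> real" where
  "block K \<omega> = (\<lambda>l\<in>K. path l \<omega>)"

abbreviation Yn where "Yn \<equiv> Y \<kappa> B"

lemma bm: "brownian_motion N T d (B \<theta> n i)"
  using ibm by (simp add: independent_brownian_motions_def)

lemma B_measurable: "s \<in> {0..T} \<Longrightarrow> B \<theta> n i s \<in> measurable N (Rd d)"
  by (rule brownian_motion_measurable[OF bm])

lemma path_measurable: "path l \<in> measurable N (path_space T d)"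
  by (cases l) (simp add: path_def brownian_path_measurable[OF bm])

lemma indep_paths: "N.indep_vars (\<lambda>_. path_space T d) path UNIV"
  using ibm by (simp add: independent_brownian_motions_def path_def)

lemma indep_blocks:
  "disjoint_family_on K I \<Longrightarrow> N.indep_vars (\<lambda>i. paths (K i)) (\<lambda>i. block (K i)) I"
  unfolding block_def by (rule N.indep_vars_restrict[OF indep_paths]) auto

lemma indep_two_blocks: "K \<inter> L = {} \<Longrightarrow> N.indep_var (paths K) (block K) (paths L) (block L)"
  unfolding block_def by (rule N.indep_var_restrict[OF indep_paths]) auto

lemma block_measurable: "block K \<in> measurable N (paths K)"
  unfolding block_def by (intro measurable_restrict path_measurable)

lemma coord_measurable:
  assumes "(\<theta>, n, i) \<in> K" "s \<in> {0..T}" shows "coord \<theta> n i s \<in> measurable (paths K) (Rd d)"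
  unfolding coord_def
  using measurable_compose[OF measurable_component_singleton[of "(\<theta>, n, i)" K "\<lambda>_. path_space T d"]
      measurable_component_singleton[of s "{0..T}" "\<lambda>_. Rd d"]] assms by simp

lemma coord_block: "(\<theta>, n, i) \<in> K \<Longrightarrow> s \<in> {0..T} \<Longrightarrow> coord \<theta> n i s (block K \<omega>) = B \<theta> n i s \<omega>"
  by (simp add: coord_def block_def path_def)

lemma mlp_block:
  assumes "subtree \<theta> \<subseteq> K" "t \<in> {0..T}"
  shows "Yn n \<theta> t x \<omega> = Y \<kappa> coord n \<theta> t x (block K \<omega>)"
  using assms in_subtree[of \<theta>] by (intro mlp_cong coord_block[symmetric]) auto

lemma mlp_coord_measurable:
  assumes "subtree \<theta> \<subseteq> K" "t \<in> {0..T}"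
  shows "(\<lambda>q. Y k coord n \<theta> t (fst q) (snd q)) \<in> borel_measurable (Rd d \<Otimes>\<^sub>M paths K)"
  using assms in_subtree[of \<theta>] by (intro mlp_measurable coord_measurable) auto

lemma mlp_coord_measurable_section:
  assumes "subtree \<theta> \<subseteq> K" "t \<in> {0..T}" "x \<in> space (Rd d)"
  shows "Y k coord n \<theta> t x \<in> borel_measurable (paths K)"
  using assms in_subtree[of \<theta>] by (intro mlp_measurable_section coord_measurable) auto

lemma Yn_bounded_rv:
  assumes "t \<in> {0..T}" "x \<in> space (Rd d)" shows "N.bounded_rv (Yn n \<theta> t x)"
proof -
  obtain C where "\<And>\<theta> t x \<omega>. t \<in> {0..T} \<Longrightarrow> \<bar>Yn n \<theta> t x \<omega>\<bar> \<le> C" using mlp_bounded[of \<kappa> B n] by metis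
  then show ?thesis using assms
    by (intro N.bounded_rvI[of _ C] mlp_measurable_section B_measurable) auto
qed

lemma f_Yn_bounded_rv:
  assumes s: "s \<in> {0..T}" and x: "x \<in> space (Rd d)" shows "N.bounded_rv (\<lambda>\<omega>. f s (Yn n \<theta> s x \<omega>))"
proof -
  obtain C where C: "\<And>\<omega>. \<omega> \<in> space N \<Longrightarrow> \<bar>Yn n \<theta> s x \<omega>\<bar> \<le> C"
    using Yn_bounded_rv[OF s x, of n \<theta>] unfolding N.bounded_rv_def by blast
  show ?thesis
  proof (rule N.bounded_rvI)
    show "(\<lambda>\<omega>. f s (Yn n \<theta> s x \<omega>)) \<in> borel_measurable N"
      by (rule measurable_compose[OF N.bounded_rv_measurable[OF Yn_bounded_rv[OF s x]] f_measurable[OF s]])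
    fix \<omega> assume "\<omega> \<in> space N"
    then show "\<bar>f s (Yn n \<theta> s x \<omega>)\<bar> \<le> Cf * C + C0"
      using f_growth[OF s, of "Yn n \<theta> s x \<omega>"] mult_left_mono[OF C[of \<omega>], of Cf] Cf by linarith
  qed
qed

lemma relabelled_paths_measurable: "(\<lambda>\<omega> l. path (h l) \<omega>) \<in> measurable N (paths UNIV)"
proof -
  have "(\<lambda>\<omega>. \<lambda>l\<in>UNIV. path (h l) \<omega>) \<in> measurable N (paths UNIV)"
    by (intro measurable_restrict path_measurable)
  then show ?thesis by (simp only: restrict_UNIV)
qed

text \<open>
  All motions have the same path law, and an injective choice of labels selects independent ones.
\<close>

lemma relabelled_law:
  assumes "inj h"
  shows "distr N (paths UNIV) (\<lambda>\<omega> l. path (h l) \<omega>) = (\<Pi>\<^sub>M l\<in>UNIV. distr N (path_space T d) (path ([], 0, 0)))"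
proof -
  define \<mu> where "\<mu> = distr N (path_space T d) (path ([], 0, 0))"
  have prob: "prob_space \<mu>" unfolding \<mu>_def by (rule N.prob_space_distr[OF path_measurable])
  have same: "distr N (path_space T d) (path l) = \<mu>" for l
    using brownian_path_law_unique[OF T bm bm] unfolding \<mu>_def by (cases l) (simp add: path_def)
  have fam: "(\<lambda>\<omega> l. path l \<omega>) \<in> measurable N (paths UNIV)"
    by (rule relabelled_paths_measurable)
  have base: "distr N (paths UNIV) (\<lambda>\<omega> l. path l \<omega>) = (\<Pi>\<^sub>M l\<in>UNIV. \<mu>)"
  proof -
    have "distr N (paths UNIV) (\<lambda>\<omega>. \<lambda>l\<in>UNIV. path l \<omega>) = (\<Pi>\<^sub>M l\<in>UNIV. distr N (path_space T d) (path l))"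
      using N.indep_vars_iff_distr_eq_PiM'[where I = UNIV and M' = "\<lambda>_. path_space T d" and X = path]
        indep_paths path_measurable by blast
    then show ?thesis by (simp only: same restrict_UNIV)
  qed
  have sets: "sets (\<Pi>\<^sub>M l\<in>UNIV. \<mu>) = sets (paths UNIV)" by (intro sets_PiM_cong) (auto simp: \<mu>_def)
  have re: "(\<lambda>b. \<lambda>l\<in>UNIV. b (h l)) \<in> measurable (paths UNIV) (paths UNIV)"
    by (intro measurable_restrict measurable_component_singleton) auto
  have "distr (\<Pi>\<^sub>M l\<in>UNIV. \<mu>) (paths UNIV) (\<lambda>b. \<lambda>l\<in>UNIV. b (h l))
      = distr (\<Pi>\<^sub>M l\<in>UNIV. \<mu>) (\<Pi>\<^sub>M l\<in>UNIV. \<mu>) (\<lambda>b. \<lambda>l\<in>UNIV. b (h l))"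
    by (intro distr_cong refl sets[symmetric])
  also have "\<dots> = (\<Pi>\<^sub>M l\<in>UNIV. \<mu>)" using assms prob by (intro distr_PiM_reindex) auto
  finally have "distr (distr N (paths UNIV) (\<lambda>\<omega> l. path l \<omega>)) (paths UNIV) (\<lambda>b. \<lambda>l\<in>UNIV. b (h l)) = (\<Pi>\<^sub>M l\<in>UNIV. \<mu>)"
    unfolding base .
  then show ?thesis unfolding \<mu>_def[symmetric] by (subst (asm) distr_distr[OF re fam]) (simp only: o_def restrict_UNIV)
qed

text \<open>
  All realizations of a field have the same law, wherever they occur in the scheme and whichever copies
  they are paired with: after relabelling, each is the same function of a family of independent
  Brownian motions.
\<close>

lemma Yn_law:
  assumes t: "t \<in> {0..T}" and x: "x \<in> space (Rd d)"
  shows "distr N borel (Yn n \<theta> t x) = distr N borel (Yn n [] t x)"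
proof -
  \<comment> \<open>A description of the law that does not mention \<open>\<theta>\<close> or \<open>\<kappa>\<close>.\<close>
  let ?\<mu> = "\<Pi>\<^sub>M l\<in>UNIV. distr N (path_space T d) (path ([], 0, 0))"
  have "distr N borel (Yn n \<theta> t x) = distr ?\<mu> borel (Y (\<lambda>_. 1) coord n [] t x)" for \<theta>
  proof -
    let ?\<sigma> = "\<lambda>p. relabel \<kappa> \<theta> (rev p)"
    define h where "h = (\<lambda>(p, m, i). (?\<sigma> p, m :: nat, i :: nat))"
    have "inj h" unfolding h_def by (intro injI) (auto dest!: relabel_inj)
    have "Yn n \<theta> t x \<omega> = Y (\<lambda>_. 1) coord n [] t x (\<lambda>l. path (h l) \<omega>)" for \<omega>
    proof -
      have "Yn n \<theta> t x \<omega> = Y (\<lambda>_. 1) (\<lambda>p. B (?\<sigma> p)) n [] t x \<omega>"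
        using mlp_relabel[OF \<kappa>, where B = B and \<theta> = \<theta> and p = "[]" and n = n and t = t and x = x and \<omega> = \<omega>] by simp
      also have "\<dots> = Y (\<lambda>_. 1) coord n [] t x (\<lambda>l. path (h l) \<omega>)"
        using t by (intro mlp_cong) (simp_all add: coord_def h_def path_def)
      finally show ?thesis .
    qed
    then have "distr N borel (Yn n \<theta> t x) = distr N borel (Y (\<lambda>_. 1) coord n [] t x \<circ> (\<lambda>\<omega> l. path (h l) \<omega>))"
      by (intro distr_cong) auto
    also have "\<dots> = distr (distr N (paths UNIV) (\<lambda>\<omega> l. path (h l) \<omega>)) borel (Y (\<lambda>_. 1) coord n [] t x)"
      using t x by (intro distr_distr[symmetric] relabelled_paths_measurable mlp_coord_measurable_section) auto
    also have "\<dots> = distr ?\<mu> borel (Y (\<lambda>_. 1) coord n [] t x)" unfolding relabelled_law[OF \<open>inj h\<close>] ..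
    finally show ?thesis .
  qed
  from this[of \<theta>] this[of "[]"] show ?thesis by simp
qed

lemma expectation_Yn_eq:
  assumes t: "t \<in> {0..T}" and x: "x \<in> space (Rd d)" and g: "g \<in> borel_measurable borel"
  shows "N.expectation (\<lambda>\<omega>. g (Yn n \<theta> t x \<omega>)) = N.expectation (\<lambda>\<omega>. g (Yn n [] t x \<omega>) :: real)"
proof -
  have "N.expectation (\<lambda>\<omega>. g (Yn n \<theta> t x \<omega>)) = (\<integral>u. g u \<partial>distr N borel (Yn n \<theta> t x))" for \<theta>
    using Yn_bounded_rv[OF t x] g by (subst integral_distr) (auto dest: N.bounded_rv_measurable)
  then show ?thesis using Yn_law[OF t x] by metis
qed

lemma evaluation_pair_measurable:
  assumes s: "s \<in> {0..T}" and x: "x \<in> space (Rd d)"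
    and h: "h \<in> borel_measurable (Rd d \<Otimes>\<^sub>M paths K)"
  shows "(\<lambda>q. h (vadd d x (coord \<theta> n i s (fst q)), snd q)) \<in> borel_measurable (paths {(\<theta>, n, i)} \<Otimes>\<^sub>M paths K)"
proof -
  have "(\<lambda>q. coord \<theta> n i s (fst q)) \<in> measurable (paths {(\<theta>, n, i)} \<Otimes>\<^sub>M paths K) (Rd d)"
    using s by (intro measurable_compose[OF measurable_fst coord_measurable]) auto
  then have "(\<lambda>q. (vadd d x (coord \<theta> n i s (fst q)), snd q)) \<in> measurable (paths {(\<theta>, n, i)} \<Otimes>\<^sub>M paths K) (Rd d \<Otimes>\<^sub>M paths K)"
    using x by (intro measurable_Pair vadd_measurable measurable_snd) auto
  from measurable_compose[OF this h] show ?thesis .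
qed

lemma L2_le_evaluation:
  assumes l: "(\<theta>, n, i) \<notin> K" and s: "s \<in> {0..T}" and x: "x \<in> space (Rd d)"
    and h: "h \<in> borel_measurable (Rd d \<Otimes>\<^sub>M paths K)" and bd: "\<And>q. \<bar>h q\<bar> \<le> C"
    and le: "\<And>x'. x' \<in> space (Rd d) \<Longrightarrow> N.L2_le (\<lambda>\<omega>. h (x', block K \<omega>)) a" and a: "0 \<le> a"
  shows "N.L2_le (\<lambda>\<omega>. h (vadd d x (B \<theta> n i s \<omega>), block K \<omega>)) a"
proof -
  let ?l = "(\<theta>, n, i)"
  have "N.indep_var (paths {?l}) (block {?l}) (paths K) (block K)" using l by (intro indep_two_blocks) auto
  from N.L2_le_indep_pair[OF this evaluation_pair_measurable[OF s x h], of C a]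
  have "N.L2_le (\<lambda>\<omega>. h (vadd d x (coord \<theta> n i s (block {?l} \<omega>)), block K \<omega>)) a"
    using bd a le vadd_in_space by auto
  then show ?thesis using s by (simp add: coord_block)
qed

text \<open>
  The motion that produces the evaluation point may be replaced by any Brownian motion, since only its
  law at time \<open>s\<close> matters.
\<close>

lemma expectation_evaluation:
  fixes h :: "(nat \<Rightarrow> real) \<times> (motion_label \<Rightarrow> real \<Rightarrow> nat \<Rightarrow> real) \<Rightarrow> real"
  assumes l: "(\<theta>, n, i) \<notin> K" and s: "s \<in> {0..T}" and x: "x \<in> space (Rd d)"
    and h: "h \<in> borel_measurable (Rd d \<Otimes>\<^sub>M paths K)" and bd: "\<And>q. \<bar>h q\<bar> \<le> C"
    and W: "brownian_motion P T d W"
  shows "N.expectation (\<lambda>\<omega>. h (vadd d x (B \<theta> n i s \<omega>), block K \<omega>))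
    = (\<integral>\<omega>'. N.expectation (\<lambda>\<omega>. h (vadd d x (W s \<omega>'), block K \<omega>)) \<partial>P)"
proof -
  let ?l = "(\<theta>, n, i)"
  define H where "H = (\<lambda>v. N.expectation (\<lambda>\<omega>. h (vadd d x v, block K \<omega>)))"
  have Hm: "H \<in> borel_measurable (Rd d)"
  proof -
    have "(\<lambda>q. (vadd d x (fst q), block K (snd q))) \<in> measurable (Rd d \<Otimes>\<^sub>M N) (Rd d \<Otimes>\<^sub>M paths K)"
      using x by (intro measurable_Pair vadd_measurable measurable_fst measurable_const measurable_compose[OF measurable_snd block_measurable])
    from measurable_compose[OF this h]
    have "(\<lambda>(v, \<omega>). h (vadd d x v, block K \<omega>)) \<in> borel_measurable (Rd d \<Otimes>\<^sub>M N)" by (simp add: case_prod_beta')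
    from N.borel_measurable_lebesgue_integral[OF this] show ?thesis unfolding H_def .
  qed
  have "N.indep_var (paths {?l}) (block {?l}) (paths K) (block K)" using l by (intro indep_two_blocks) auto
  from N.expectation_indep_pair(2)[OF this evaluation_pair_measurable[OF s x h], of C] bd
  have "N.expectation (\<lambda>\<omega>. h (vadd d x (coord \<theta> n i s (block {?l} \<omega>)), block K \<omega>))
      = (\<integral>b. H (coord \<theta> n i s b) \<partial>distr N (paths {?l}) (block {?l}))"
    by (simp add: H_def)
  also have "\<dots> = N.expectation (\<lambda>\<omega>'. H (coord \<theta> n i s (block {?l} \<omega>')))"
    using s by (intro integral_distr block_measurable measurable_compose[OF coord_measurable Hm]) auto
  also have "\<dots> = N.expectation (\<lambda>\<omega>'. H (B \<theta> n i s \<omega>'))" using s by (simp add: coord_block)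
  also have "\<dots> = (\<integral>v. H v \<partial>distr N (Rd d) (B \<theta> n i s))"
    by (intro integral_distr[symmetric] B_measurable s Hm)
  also have "\<dots> = (\<integral>v. H v \<partial>distr P (Rd d) (W s))"
    using brownian_marginal_unique[OF T bm W s] by simp
  also have "\<dots> = (\<integral>\<omega>'. H (W s \<omega>') \<partial>P)"
    by (intro integral_distr brownian_motion_measurable[OF W] s Hm)
  finally show ?thesis using s by (simp add: H_def coord_block)
qed


end

section \<open>Second moments of the random fields\<close>

context mlp_random
begin

abbreviation mean :: "nat \<Rightarrow> real \<Rightarrow> (nat \<Rightarrow> real) \<Rightarrow> real" where
  "mean n t x \<equiv> N.expectation (Yn n [] t x)"

lemma expectation_Yn:
  "t \<in> {0..T} \<Longrightarrow> x \<in> space (Rd d) \<Longrightarrow> N.expectation (Yn n \<theta> t x) = mean n t x"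
  using expectation_Yn_eq[of t x "\<lambda>u. u"] by simp

text \<open>
  Both evaluations take place at the same random point, which is why a bound on the distance of
  paired realizations at fixed points suffices.
\<close>

definition level_diff where
  "level_diff n \<theta> t x i j \<omega> = f (node t j) (Yn (Suc n) (\<theta> @ [Eval i j]) (node t j)
         (vadd d x (B \<theta> (Suc (Suc n)) i (node t j - t) \<omega>)) \<omega>)
      - f (node t j) (Yn n (\<theta> @ [Eval i j, Copy (\<kappa> (\<theta> @ [Eval i j]))]) (node t j)
         (vadd d x (B \<theta> (Suc (Suc n)) i (node t j - t) \<omega>)) \<omega>)"

lemma correction_eq: "correction \<kappa> B n \<theta> t x i \<omega> = (\<Sum>j=1..Q. weight t j * level_diff n \<theta> t x i j \<omega>)"
  by (simp add: correction_def level_diff_def)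

lemma fresh_label: "(\<theta>, m, i) \<notin> subtree (\<theta> @ b # p)"
  by (auto simp: subtree_def)

lemma f_coord_measurable:
  assumes "subtree \<theta> \<subseteq> K" "s \<in> {0..T}"
  shows "(\<lambda>q. f s (Y \<kappa> coord n \<theta> s (fst q) (snd q))) \<in> borel_measurable (Rd d \<Otimes>\<^sub>M paths K)"
  by (rule measurable_compose[OF mlp_coord_measurable[OF assms] f_measurable[OF assms(2)]])

lemma f_coord_bounded:
  assumes "s \<in> {0..T}" shows "\<exists>C. \<forall>x b. \<bar>f s (Y \<kappa> coord n \<theta> s x b)\<bar> \<le> C"
proof -
  obtain C where C: "\<And>\<theta> t x b. t \<in> {0..T} \<Longrightarrow> \<bar>Y \<kappa> coord n \<theta> t x b\<bar> \<le> C" using mlp_bounded[of \<kappa> coord n] by metis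
  have "\<bar>f s (Y \<kappa> coord n \<theta> s x b)\<bar> \<le> Cf * C + C0" for x b
    using f_growth[OF assms, of "Y \<kappa> coord n \<theta> s x b"] mult_left_mono[OF C[OF assms, of \<theta> x b], of Cf] Cf by linarith
  then show ?thesis by blast
qed

lemma L2_le_level_diff:
  assumes t: "t \<in> {0..T}" and x: "x \<in> space (Rd d)" and j: "j \<in> {1..Q}"
    and D: "\<And>\<theta> k x. k \<in> {1..M} \<Longrightarrow> x \<in> space (Rd d) \<Longrightarrow>
      N.L2_le (\<lambda>\<omega>. Yn (Suc n) \<theta> (node t j) x \<omega> - Yn n (\<theta> @ [Copy k]) (node t j) x \<omega>) D"
  shows "N.L2_le (level_diff n \<theta> t x i j) (Cf * D)"
proof -
  define s where "s = node t j"
  have s: "s \<in> {0..T}" "s - t \<in> {0..T}" unfolding s_def by (rule node_in[OF t j] node_diff_in[OF t j])+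
  define \<theta>1 where "\<theta>1 = \<theta> @ [Eval i j]"
  define \<theta>2 where "\<theta>2 = \<theta>1 @ [Copy (\<kappa> \<theta>1)]"
  have sub: "subtree \<theta>1 \<subseteq> subtree \<theta>1" "subtree \<theta>2 \<subseteq> subtree \<theta>1" unfolding \<theta>2_def by (rule order_refl subtree_append)+
  define h where "h q = f s (Y \<kappa> coord (Suc n) \<theta>1 s (fst q) (snd q)) - f s (Y \<kappa> coord n \<theta>2 s (fst q) (snd q))" for q
  have hm: "h \<in> borel_measurable (Rd d \<Otimes>\<^sub>M paths (subtree \<theta>1))"
    unfolding h_def by (intro borel_measurable_diff f_coord_measurable sub s)
  obtain a b where ab: "\<And>x c. \<bar>f s (Y \<kappa> coord (Suc n) \<theta>1 s x c)\<bar> \<le> a" "\<And>x c. \<bar>f s (Y \<kappa> coord n \<theta>2 s x c)\<bar> \<le> b"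
    using f_coord_bounded[OF s(1)] by metis
  have hb: "\<bar>h q\<bar> \<le> a + b" for q unfolding h_def by (intro order_trans[OF abs_triangle_ineq4 add_mono] ab)
  have hY: "h (x', block (subtree \<theta>1) \<omega>) = f s (Yn (Suc n) \<theta>1 s x' \<omega>) - f s (Yn n \<theta>2 s x' \<omega>)" for x' \<omega>
    unfolding h_def using mlp_block[OF sub(1) s(1)] mlp_block[OF sub(2) s(1)] by simp
  have D0: "0 \<le> D" using N.L2_le_nonneg[OF D[of 1 x]] M x by auto
  have sec: "N.L2_le (\<lambda>\<omega>. h (x', block (subtree \<theta>1) \<omega>)) (Cf * D)" if x': "x' \<in> space (Rd d)" for x'
  proof (rule N.L2_le_pointwise)
    show "N.L2_le (\<lambda>\<omega>. Yn (Suc n) \<theta>1 s x' \<omega> - Yn n \<theta>2 s x' \<omega>) D"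
      using D[OF \<kappa> x', of \<theta>1] by (simp add: s_def \<theta>2_def)
    show "(\<lambda>\<omega>. h (x', block (subtree \<theta>1) \<omega>)) \<in> borel_measurable N"
      unfolding hY by (intro borel_measurable_diff N.bounded_rv_measurable f_Yn_bounded_rv s x')
  qed (use Cf f_lip[OF s(1)] in \<open>auto simp: hY\<close>)
  have "N.L2_le (\<lambda>\<omega>. h (vadd d x (B \<theta> (Suc (Suc n)) i (s - t) \<omega>), block (subtree \<theta>1) \<omega>)) (Cf * D)"
    using Cf D0 unfolding \<theta>1_def
    by (intro L2_le_evaluation[of _ _ _ _ _ _ _ "a + b"] fresh_label s x hm[unfolded \<theta>1_def] hb sec[unfolded \<theta>1_def]) auto
  then show ?thesis unfolding hY level_diff_def[abs_def] by (simp add: s_def \<theta>1_def \<theta>2_def)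
qed

lemma L2_le_correction:
  assumes t: "t \<in> {0..T}" and x: "x \<in> space (Rd d)"
    and D: "\<And>\<theta> k s x. k \<in> {1..M} \<Longrightarrow> s \<in> {0..T} \<Longrightarrow> x \<in> space (Rd d) \<Longrightarrow>
      N.L2_le (\<lambda>\<omega>. Yn (Suc n) \<theta> s x \<omega> - Yn n (\<theta> @ [Copy k]) s x \<omega>) (D s)"
  shows "N.L2_le (correction \<kappa> B n \<theta> t x i) (Cf * (\<Sum>j=1..Q. weight t j * D (node t j)))"
proof -
  have "N.L2_le (\<lambda>\<omega>. \<Sum>j=1..Q. weight t j * level_diff n \<theta> t x i j \<omega>) (\<Sum>j=1..Q. \<bar>weight t j\<bar> * (Cf * D (node t j)))"
    by (intro N.L2_le_sum N.L2_le_cmult L2_le_level_diff t x D node_in) auto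
  moreover have "(\<Sum>j=1..Q. \<bar>weight t j\<bar> * (Cf * D (node t j))) = Cf * (\<Sum>j=1..Q. weight t j * D (node t j))"
    unfolding sum_distrib_left using weight_ge_0[OF t] by (intro sum.cong) auto
  ultimately show ?thesis unfolding correction_eq[abs_def] by simp
qed

text \<open>
  The motions that enter the \<open>i\<close>-th summand of the mean over \<open>{1..M}\<close>.
\<close>

definition summand_labels :: "nat \<Rightarrow> branch list \<Rightarrow> nat \<Rightarrow> motion_label set" where
  "summand_labels n \<theta> i = subtree (\<theta> @ [Copy i]) \<union> {(\<theta>, n, i)} \<union> (\<Union>j. subtree (\<theta> @ [Eval i j]))"

lemma disjoint_summand_labels: "disjoint_family_on (summand_labels n \<theta>) I"
  by (auto simp: disjoint_family_on_def summand_labels_def subtree_def)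

lemma indep_summands:
  assumes t: "t \<in> {0..T}" and x: "x \<in> space (Rd d)"
  shows "N.indep_vars (\<lambda>_. borel) (\<lambda>i \<omega>. Yn (Suc n) (\<theta> @ [Copy i]) t x \<omega> + correction \<kappa> B n \<theta> t x i \<omega>) {1..M}"
proof -
  define K where "K = summand_labels (Suc (Suc n)) \<theta>"
  define g where "g i b = Y \<kappa> coord (Suc n) (\<theta> @ [Copy i]) t x b + correction \<kappa> coord n \<theta> t x i b" for i b
  have sub: "subtree (\<theta> @ [Copy i]) \<subseteq> K i" "(\<theta>, Suc (Suc n), i) \<in> K i" "subtree (\<theta> @ [Eval i j]) \<subseteq> K i"
    "subtree (\<theta> @ [Eval i j, c]) \<subseteq> K i" for i j c
    using subtree_append[of "\<theta> @ [Eval i j]" "[c]"] by (auto simp: K_def summand_labels_def)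
  have gm: "g i \<in> borel_measurable (paths (K i))" for i
  proof -
    have ev: "(\<lambda>b. f (node t j) (Y \<kappa> coord m \<theta>' (node t j) (vadd d x (coord \<theta> (Suc (Suc n)) i (node t j - t) b)) b))
      \<in> borel_measurable (paths (K i))" if "j \<in> {1..Q}" "subtree \<theta>' \<subseteq> K i" for j m \<theta>'
    proof -
      have "(\<lambda>b. (vadd d x (coord \<theta> (Suc (Suc n)) i (node t j - t) b), b)) \<in> measurable (paths (K i)) (Rd d \<Otimes>\<^sub>M paths (K i))"
        using x t that by (intro measurable_Pair vadd_measurable coord_measurable sub node_diff_in) auto
      from measurable_compose[OF this f_coord_measurable[OF that(2) node_in[OF t that(1)]]] show ?thesis by simp
    qed
    show ?thesis unfolding g_def correction_def
      by (intro borel_measurable_add borel_measurable_sum borel_measurable_times borel_measurable_diff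
          mlp_coord_measurable_section sub t x ev) auto
  qed
  have "N.indep_vars (\<lambda>_. borel) (\<lambda>i \<omega>. g i (block (K i) \<omega>)) {1..M}"
    unfolding K_def using gm[unfolded K_def]
    by (intro N.indep_vars_compose2[OF indep_blocks[OF disjoint_summand_labels]]) auto
  moreover have "g i (block (K i) \<omega>) = Yn (Suc n) (\<theta> @ [Copy i]) t x \<omega> + correction \<kappa> B n \<theta> t x i \<omega>" for i \<omega>
  proof -
    have "coord \<theta> (Suc (Suc n)) i (node t j - t) (block (K i) \<omega>) = B \<theta> (Suc (Suc n)) i (node t j - t) \<omega>" if "j \<in> {1..Q}" for j
      using sub(2) node_diff_in[OF t that] by (rule coord_block)
    moreover have "Y \<kappa> coord m \<theta>' (node t j) x' (block (K i) \<omega>) = Yn m \<theta>' (node t j) x' \<omega>" if "j \<in> {1..Q}" "subtree \<theta>' \<subseteq> K i" for j m \<theta>' x'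
      using mlp_block[OF that(2) node_in[OF t that(1)]] by simp
    ultimately have "correction \<kappa> coord n \<theta> t x i (block (K i) \<omega>) = correction \<kappa> B n \<theta> t x i \<omega>"
      unfolding correction_def by (intro sum.cong refl) (simp only: sub)
    then show ?thesis unfolding g_def using mlp_block[OF sub(1) t, of "Suc n" i x \<omega>] by simp
  qed
  ultimately show ?thesis by simp
qed

text \<open>
  The lower bound \<open>3\<close> closes the induction for the second moments, and the second entry bounds the
  first field.
\<close>

definition base_const :: real where "base_const = max 3 (C\<phi> + T * C0)"
definition ratio :: real where "ratio = base_const / sqrt (real M)"
definition growth :: "real \<Rightarrow> real" where "growth t = exp (Cf * sqrt (real M) * (T - t))"

lemma base_const_ge: "3 \<le> base_const" "C\<phi> + T * C0 \<le> base_const" "C\<phi> \<le> base_const"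
proof -
  have "0 \<le> T * C0" using T C0 by simp
  then show "3 \<le> base_const" "C\<phi> + T * C0 \<le> base_const" "C\<phi> \<le> base_const" by (auto simp: base_const_def)
qed

lemma sqrt_M: "1 \<le> sqrt (real M)" using M by simp

lemma ratio_bounds: "0 < ratio" "ratio \<le> base_const"
  using base_const_ge sqrt_M by (auto simp: ratio_def field_simps)

lemma growth_ge_1: "t \<in> {0..T} \<Longrightarrow> 1 \<le> growth t"
  using Cf by (simp add: growth_def)

text \<open>
  The exponential grows so fast that a quadrature step gains a factor \<open>1 / sqrt M\<close>. This turns the
  distance of two consecutive levels, which is of order \<open>ratio ^ n\<close>, into a contribution of order
  \<open>ratio ^ Suc n\<close>.
\<close>

lemma weighted_growth_le:
  assumes "t \<in> {0..T}" shows "Cf * (\<Sum>j=1..Q. weight t j * growth (node t j)) \<le> growth t / sqrt (real M)"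
proof -
  have "(\<Sum>j=1..Q. weight t j * growth (node t j)) \<le> growth t / (Cf * sqrt (real M))"
    unfolding growth_def using assms Cf sqrt_M by (intro gl_exp_le) auto
  then show ?thesis using Cf sqrt_M by (simp add: field_simps)
qed


lemma mean_step:
  assumes t: "t \<in> {0..T}" and x: "x \<in> space (Rd d)"
    and b: "\<And>i. i \<in> {1..M} \<Longrightarrow> N.bounded_rv (correction \<kappa> B n [] t x i)"
  shows "mean (Suc (Suc n)) t x = mean (Suc n) t x + 1 / real M * (\<Sum>i=1..M. N.expectation (correction \<kappa> B n [] t x i))"
proof -
  let ?Z = "\<lambda>i \<omega>. Yn (Suc n) ([] @ [Copy i]) t x \<omega> + correction \<kappa> B n [] t x i \<omega>"
  have Z: "N.bounded_rv (?Z i)" if "i \<in> {1..M}" for i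
    by (rule N.bounded_rv_add[OF Yn_bounded_rv[OF t x] b[OF that]])
  have "mean (Suc (Suc n)) t x = N.expectation (\<lambda>\<omega>. 1 / real M * (\<Sum>i=1..M. ?Z i \<omega>))"
    unfolding mlp_Suc_Suc[abs_def] by simp
  also have "\<dots> = 1 / real M * (\<Sum>i=1..M. N.expectation (?Z i))"
    by (subst integral_mult_right_zero, subst Bochner_Integration.integral_sum)
       (use N.bounded_rv_integrable[OF Z] in auto)
  also have "(\<Sum>i=1..M. N.expectation (?Z i)) = (\<Sum>i=1..M. mean (Suc n) t x + N.expectation (correction \<kappa> B n [] t x i))"
  proof (intro sum.cong refl)
    fix i assume "i \<in> {1..M}"
    then show "N.expectation (?Z i) = mean (Suc n) t x + N.expectation (correction \<kappa> B n [] t x i)"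
      using expectation_Yn[OF t x, of "Suc n" "[] @ [Copy i]"]
      by (subst Bochner_Integration.integral_add) (use N.bounded_rv_integrable[OF Yn_bounded_rv[OF t x]] N.bounded_rv_integrable[OF b] in auto)
  qed
  finally show ?thesis unfolding sum.distrib distrib_left mean_const .
qed

lemma L2_le_mlp_1:
  assumes t: "t \<in> {0..T}" and x: "x \<in> space (Rd d)"
  shows "N.L2_le (\<lambda>\<omega>. Yn (Suc 0) \<theta> t x \<omega> - mean (Suc 0) t x) (C\<phi> / sqrt (real M))"
proof -
  define c where "c = (\<Sum>j=1..Q. weight t j * f (node t j) 0)"
  define Z where "Z i \<omega> = \<phi> (vadd d x (B \<theta> 1 i (T - t) \<omega>)) + c" for i \<omega>
  have Tt: "T - t \<in> {0..T}" using t by auto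
  have Yeq: "Yn (Suc 0) \<theta> t x \<omega> = 1 / real M * (\<Sum>i=1..M. Z i \<omega>)" for \<omega>
    unfolding mlp.simps Z_def sum.distrib distrib_left mean_const c_def ..
  have \<phi>m: "(\<lambda>\<omega>. \<phi> (vadd d x (B \<theta> 1 i (T - t) \<omega>))) \<in> borel_measurable N" for i
    using x by (intro measurable_compose[OF vadd_measurable \<phi>_meas] B_measurable Tt) auto
  have L: "N.L2_le (\<lambda>\<omega>. \<phi> (vadd d x (B \<theta> 1 i (T - t) \<omega>))) C\<phi>" for i
    by (intro N.L2_le_bound \<phi>m \<phi>_le vadd_in_space)
  have Zc: "Z i \<omega> - N.expectation (Z i) = \<phi> (vadd d x (B \<theta> 1 i (T - t) \<omega>)) - N.expectation (\<lambda>\<omega>. \<phi> (vadd d x (B \<theta> 1 i (T - t) \<omega>)))" for i \<omega>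
    unfolding Z_def using N.bounded_rv_integrable[OF N.L2_le_bounded[OF L[of i]]]
    by (subst Bochner_Integration.integral_add) (auto simp: N.prob_space)
  have "N.indep_vars (\<lambda>_. borel) (\<lambda>i \<omega>. \<phi> (vadd d x (coord \<theta> 1 i (T - t) (block {(\<theta>, 1, i)} \<omega>))) + c) {1..M}"
  proof (intro N.indep_vars_compose2[OF indep_blocks, where Y = "\<lambda>i b. \<phi> (vadd d x (coord \<theta> 1 i (T - t) b)) + c"])
    show "disjoint_family_on (\<lambda>i. {(\<theta>, 1, i)}) {1..M}" by (auto simp: disjoint_family_on_def)
    show "(\<lambda>b. \<phi> (vadd d x (coord \<theta> 1 i (T - t) b)) + c) \<in> borel_measurable (paths {(\<theta>, 1, i)})" for i
      using x by (intro borel_measurable_add measurable_compose[OF vadd_measurable \<phi>_meas] coord_measurable Tt) auto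
  qed
  then have "N.indep_vars (\<lambda>_. borel) Z {1..M}" unfolding Z_def[abs_def] by (simp only: coord_block[OF singletonI Tt])
  moreover have "N.bounded_rv (Z i)" for i
    unfolding Z_def by (intro N.bounded_rv_add N.bounded_rv_const N.L2_le_bounded[OF L])
  moreover have "N.L2_le (\<lambda>\<omega>. Z i \<omega> - N.expectation (Z i)) C\<phi>" for i
    unfolding Zc by (rule N.L2_le_center[OF L])
  ultimately have "N.L2_le (\<lambda>\<omega>. 1 / real M * (\<Sum>i=1..M. Z i \<omega>) - N.expectation (\<lambda>\<omega>. 1 / real M * (\<Sum>i=1..M. Z i \<omega>))) (C\<phi> / sqrt (real M))"
    by (intro N.L2_le_indep_mean M)
  then show ?thesis unfolding Yeq[symmetric] by (simp only: expectation_Yn[OF t x, of _ \<theta>])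
qed

text \<open>
  Fluctuation and distance of paired consecutive levels are estimated together. The distance at level \<open>n\<close>
  controls the correction of the next level; averaging over \<open>M\<close> samples then yields the fluctuation of
  the next level, since \<open>1 + 2 <= base_const\<close>. The next distance consists of two fluctuations and a
  difference of means, \<open>ratio + 1 + 2 <= 2 * base_const\<close> in units of \<open>ratio ^ Suc n * growth t\<close>. The
  initial distance is of order one and not small in \<open>M\<close>, hence its exponent lags by one.
\<close>

lemma second_moments:
  "(\<forall>\<theta>. \<forall>t\<in>{0..T}. \<forall>x\<in>space (Rd d).
      N.L2_le (\<lambda>\<omega>. Yn (Suc n) \<theta> t x \<omega> - mean (Suc n) t x) (ratio ^ Suc n * growth t)) \<and>
   (\<forall>\<theta>. \<forall>k\<in>{1..M}. \<forall>t\<in>{0..T}. \<forall>x\<in>space (Rd d).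
      N.L2_le (\<lambda>\<omega>. Yn (Suc n) \<theta> t x \<omega> - Yn n (\<theta> @ [Copy k]) t x \<omega>) (2 * base_const * ratio ^ n * growth t))"
  (is "?V n \<and> ?D n")
proof (induction n)
  case 0
  have "?V 0"
  proof (intro allI ballI)
    fix \<theta> t x assume t: "t \<in> {0..T}" and x: "x \<in> space (Rd d)"
    have "C\<phi> / sqrt (real M) \<le> ratio" unfolding ratio_def using base_const_ge by (intro divide_right_mono) auto
    also have "\<dots> \<le> ratio ^ Suc 0 * growth t" using mult_left_mono[OF growth_ge_1[OF t], of ratio] ratio_bounds by simp
    finally show "N.L2_le (\<lambda>\<omega>. Yn (Suc 0) \<theta> t x \<omega> - mean (Suc 0) t x) (ratio ^ Suc 0 * growth t)"
      by (rule N.L2_le_mono[OF L2_le_mlp_1[OF t x]])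
  qed
  moreover have "?D 0"
  proof (intro allI ballI)
    fix \<theta> k t x assume t: "t \<in> {0..T}" and x: "x \<in> space (Rd d)"
    have "base_const * 1 \<le> base_const * growth t" using base_const_ge growth_ge_1[OF t] by (intro mult_left_mono) auto
    then have "C\<phi> + T * C0 \<le> 2 * base_const * growth t" using base_const_ge by linarith
    moreover
    have "N.L2_le (Yn (Suc 0) \<theta> t x) (C\<phi> + T * C0)"
      by (rule N.L2_le_bound[OF N.bounded_rv_measurable[OF Yn_bounded_rv[OF t x]] mlp_1_le[OF t]])
    ultimately show "N.L2_le (\<lambda>\<omega>. Yn (Suc 0) \<theta> t x \<omega> - Yn 0 (\<theta> @ [Copy k]) t x \<omega>) (2 * base_const * ratio ^ 0 * growth t)"
      unfolding mlp.simps(1) diff_0_right power_0 mult_1_right by (rule N.L2_le_mono[rotated])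
  qed
  ultimately show ?case by (rule conjI)
next
  case (Suc n)
  note V = Suc.IH[THEN conjunct1, rule_format] and D = Suc.IH[THEN conjunct2, rule_format]
  have R: "N.L2_le (correction \<kappa> B n \<theta> t x i) (2 * ratio ^ Suc n * growth t)" if t: "t \<in> {0..T}" and x: "x \<in> space (Rd d)" for \<theta> t x i
  proof (rule N.L2_le_mono)
    show "N.L2_le (correction \<kappa> B n \<theta> t x i) (Cf * (\<Sum>j=1..Q. weight t j * (2 * base_const * ratio ^ n * growth (node t j))))"
      by (intro L2_le_correction t x D)
    have "Cf * (\<Sum>j=1..Q. weight t j * (2 * base_const * ratio ^ n * growth (node t j)))
        = 2 * base_const * ratio ^ n * (Cf * (\<Sum>j=1..Q. weight t j * growth (node t j)))"
      by (simp add: sum_distrib_left mult_ac)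
    also have "\<dots> \<le> 2 * base_const * ratio ^ n * (growth t / sqrt (real M))"
      using base_const_ge ratio_bounds by (intro mult_left_mono weighted_growth_le t) auto
    also have "\<dots> = 2 * ratio ^ Suc n * growth t" by (simp add: ratio_def)
    finally show "Cf * (\<Sum>j=1..Q. weight t j * (2 * base_const * ratio ^ n * growth (node t j))) \<le> 2 * ratio ^ Suc n * growth t" .
  qed
  have V': "N.L2_le (\<lambda>\<omega>. Yn (Suc (Suc n)) \<theta> t x \<omega> - mean (Suc (Suc n)) t x) (ratio ^ Suc (Suc n) * growth t)"
    if t: "t \<in> {0..T}" and x: "x \<in> space (Rd d)" for \<theta> t x
  proof (rule N.L2_le_mono)
    let ?Z = "\<lambda>i \<omega>. Yn (Suc n) (\<theta> @ [Copy i]) t x \<omega> + correction \<kappa> B n \<theta> t x i \<omega>"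
    note bY = Yn_bounded_rv[OF t x] and bR = N.L2_le_bounded[OF R[OF t x]]
    have "N.L2_le (\<lambda>\<omega>. ?Z i \<omega> - N.expectation (?Z i)) (ratio ^ Suc n * growth t + 2 * ratio ^ Suc n * growth t)" for i
    proof -
      have "?Z i \<omega> - N.expectation (?Z i) = (Yn (Suc n) (\<theta> @ [Copy i]) t x \<omega> - mean (Suc n) t x) +
          (correction \<kappa> B n \<theta> t x i \<omega> - N.expectation (correction \<kappa> B n \<theta> t x i))" for \<omega>
        by (subst Bochner_Integration.integral_add) (auto intro: N.bounded_rv_integrable bY bR simp: expectation_Yn[OF t x, of _ "\<theta> @ [Copy i]"])
      then show ?thesis by (simp only:) (intro N.L2_le_add V t x N.L2_le_center R)
    qed
    then have "N.L2_le (\<lambda>\<omega>. 1 / real M * (\<Sum>i=1..M. ?Z i \<omega>) - N.expectation (\<lambda>\<omega>. 1 / real M * (\<Sum>i=1..M. ?Z i \<omega>)))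
        ((ratio ^ Suc n * growth t + 2 * ratio ^ Suc n * growth t) / sqrt (real M))"
      by (intro N.L2_le_indep_mean M indep_summands t x N.bounded_rv_add bY bR)
    then show "N.L2_le (\<lambda>\<omega>. Yn (Suc (Suc n)) \<theta> t x \<omega> - mean (Suc (Suc n)) t x)
        ((ratio ^ Suc n * growth t + 2 * ratio ^ Suc n * growth t) / sqrt (real M))"
      unfolding mlp_Suc_Suc[symmetric] by (simp only: expectation_Yn[OF t x, of _ \<theta>])
    have "(ratio ^ Suc n * growth t + 2 * ratio ^ Suc n * growth t) / sqrt (real M) = (3 / sqrt (real M)) * (ratio ^ Suc n * growth t)"
      by simp
    also have "\<dots> \<le> ratio * (ratio ^ Suc n * growth t)"
      unfolding ratio_def using base_const_ge growth_ge_1[OF t] by (intro mult_right_mono divide_right_mono) auto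
    finally show "(ratio ^ Suc n * growth t + 2 * ratio ^ Suc n * growth t) / sqrt (real M) \<le> ratio ^ Suc (Suc n) * growth t"
      by (simp only: power_Suc mult.assoc)
  qed
  have D': "N.L2_le (\<lambda>\<omega>. Yn (Suc (Suc n)) \<theta> t x \<omega> - Yn (Suc n) (\<theta> @ [Copy k]) t x \<omega>) (2 * base_const * ratio ^ Suc n * growth t)"
    if t: "t \<in> {0..T}" and x: "x \<in> space (Rd d)" for \<theta> k t x
  proof (rule N.L2_le_mono)
    have recenter: "(a - p) - (b - q) + (p - q) = a - b" for a b p q :: real by simp
    have "\<bar>N.expectation (correction \<kappa> B n [] t x i)\<bar> \<le> 2 * ratio ^ Suc n * growth t" for i
      using integral_abs_bound[of N "correction \<kappa> B n [] t x i"] N.abs_expectation_L2_le[OF R[OF t x, of "[]" i]] by linarith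
    then have "\<bar>1 / real M * (\<Sum>i=1..M. N.expectation (correction \<kappa> B n [] t x i))\<bar> \<le> 2 * ratio ^ Suc n * growth t"
      by (rule abs_mean_le)
    then have "\<bar>mean (Suc (Suc n)) t x - mean (Suc n) t x\<bar> \<le> 2 * ratio ^ Suc n * growth t"
      using mean_step[OF t x N.L2_le_bounded[OF R[OF t x]]] by simp
    then have "N.L2_le (\<lambda>\<omega>. (Yn (Suc (Suc n)) \<theta> t x \<omega> - mean (Suc (Suc n)) t x)
        - (Yn (Suc n) (\<theta> @ [Copy k]) t x \<omega> - mean (Suc n) t x) + (mean (Suc (Suc n)) t x - mean (Suc n) t x))
      (ratio ^ Suc (Suc n) * growth t + ratio ^ Suc n * growth t + 2 * ratio ^ Suc n * growth t)"
      by (intro N.L2_le_add N.L2_le_diff V' V t x N.L2_le_const)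
    then show "N.L2_le (\<lambda>\<omega>. Yn (Suc (Suc n)) \<theta> t x \<omega> - Yn (Suc n) (\<theta> @ [Copy k]) t x \<omega>)
      (ratio ^ Suc (Suc n) * growth t + ratio ^ Suc n * growth t + 2 * ratio ^ Suc n * growth t)"
      unfolding recenter .
    have "ratio ^ Suc (Suc n) * growth t + ratio ^ Suc n * growth t + 2 * ratio ^ Suc n * growth t
        = (ratio + 3) * (ratio ^ Suc n * growth t)" by (simp add: algebra_simps)
    also have "\<dots> \<le> (2 * base_const) * (ratio ^ Suc n * growth t)"
      using base_const_ge ratio_bounds growth_ge_1[OF t] by (intro mult_right_mono) auto
    finally show "ratio ^ Suc (Suc n) * growth t + ratio ^ Suc n * growth t + 2 * ratio ^ Suc n * growth t
        \<le> 2 * base_const * ratio ^ Suc n * growth t" by (simp only: mult.assoc)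
  qed
  show ?case using V' D' by blast
qed

lemma variance_bound:
  assumes t: "t \<in> {0..T}" and x: "x \<in> space (Rd d)"
  shows "N.L2_le (\<lambda>\<omega>. Yn n \<theta> t x \<omega> - mean n t x) (ratio ^ n * growth t)"
proof (cases n)
  case 0
  have "Yn 0 \<theta> t x = (\<lambda>_. 0)" for \<theta> by (rule ext) simp
  then show ?thesis using growth_ge_1[OF t] 0 by (simp add: N.L2_le_const)
next
  case (Suc m)
  then show ?thesis using second_moments[of m] t x by blast
qed


lemma correction_bounded_rv:
  assumes "t \<in> {0..T}" "x \<in> space (Rd d)" shows "N.bounded_rv (correction \<kappa> B n \<theta> t x i)"
  by (rule N.L2_le_bounded[OF L2_le_correction[OF assms]]) (use second_moments[of n] in blast)

end

section \<open>The bias\<close>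

context mlp_random
begin

text \<open>
  By equality of laws the root realization may stand for any other.
\<close>

definition Ef :: "nat \<Rightarrow> real \<Rightarrow> (nat \<Rightarrow> real) \<Rightarrow> real" where
  "Ef n s x = N.expectation (\<lambda>\<omega>. f s (Yn n [] s x \<omega>))"

lemma Ef_measurable:
  assumes s: "s \<in> {0..T}" shows "Ef n s \<in> borel_measurable (Rd d)"
proof -
  have "(\<lambda>q. Yn n [] s (fst q) (snd q)) \<in> borel_measurable (Rd d \<Otimes>\<^sub>M N)"
    using s by (intro mlp_measurable B_measurable)
  from measurable_compose[OF this f_measurable[OF s]]
  have "(\<lambda>(x, \<omega>). f s (Yn n [] s x \<omega>)) \<in> borel_measurable (Rd d \<Otimes>\<^sub>M N)" by (simp add: case_prod_beta')
  from N.borel_measurable_lebesgue_integral[OF this] show ?thesis unfolding Ef_def .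
qed

lemma f_evaluation:
  assumes l: "(\<theta>', m, i) \<notin> subtree \<theta>" and s: "s \<in> {0..T}" and r: "r \<in> {0..T}" and x: "x \<in> space (Rd d)"
    and W: "brownian_motion P T d W"
  shows "N.bounded_rv (\<lambda>\<omega>. f s (Yn n \<theta> s (vadd d x (B \<theta>' m i r \<omega>)) \<omega>))"
    "N.expectation (\<lambda>\<omega>. f s (Yn n \<theta> s (vadd d x (B \<theta>' m i r \<omega>)) \<omega>)) = (\<integral>\<omega>'. Ef n s (vadd d x (W r \<omega>')) \<partial>P)"
proof -
  define h where "h q = f s (Y \<kappa> coord n \<theta> s (fst q) (snd q))" for q
  have hm: "h \<in> borel_measurable (Rd d \<Otimes>\<^sub>M paths (subtree \<theta>))"
    unfolding h_def by (rule f_coord_measurable[OF order_refl s])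
  obtain C where hb: "\<And>q. \<bar>h q\<bar> \<le> C" using f_coord_bounded[OF s, of n \<theta>] unfolding h_def by metis
  have hY: "h (x', block (subtree \<theta>) \<omega>) = f s (Yn n \<theta> s x' \<omega>)" for x' \<omega>
    unfolding h_def using mlp_block[OF order_refl s] by simp
  have "(\<lambda>\<omega>. (vadd d x (B \<theta>' m i r \<omega>), block (subtree \<theta>) \<omega>)) \<in> measurable N (Rd d \<Otimes>\<^sub>M paths (subtree \<theta>))"
    using x by (intro measurable_Pair vadd_measurable B_measurable block_measurable r) auto
  from measurable_compose[OF this hm]
  show "N.bounded_rv (\<lambda>\<omega>. f s (Yn n \<theta> s (vadd d x (B \<theta>' m i r \<omega>)) \<omega>))"
    using hb unfolding hY[symmetric] by (rule N.bounded_rvI)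
  have "N.expectation (\<lambda>\<omega>. h (vadd d x (B \<theta>' m i r \<omega>), block (subtree \<theta>) \<omega>))
      = (\<integral>\<omega>'. N.expectation (\<lambda>\<omega>. h (vadd d x (W r \<omega>'), block (subtree \<theta>) \<omega>)) \<partial>P)"
    by (rule expectation_evaluation[OF l r x hm hb W])
  then show "N.expectation (\<lambda>\<omega>. f s (Yn n \<theta> s (vadd d x (B \<theta>' m i r \<omega>)) \<omega>)) = (\<integral>\<omega>'. Ef n s (vadd d x (W r \<omega>')) \<partial>P)"
    unfolding hY Ef_def using expectation_Yn_eq[OF s vadd_in_space f_measurable[OF s], of n \<theta>] by simp
qed

text \<open>
  In expectation the corrections telescope: the subtracted field has the law of the field
  evaluated one level before. This is the discrete analogue of the Feynman-Kac formula.
\<close>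

lemma mean_recursion:
  fixes P :: "'c measure"
  assumes W: "brownian_motion P T d W" and t: "t \<in> {0..T}" and x: "x \<in> space (Rd d)"
  shows "mean (Suc n) t x = (\<integral>\<omega>. \<phi> (vadd d x (W (T - t) \<omega>)) \<partial>P) +
    (\<Sum>j=1..Q. weight t j * (\<integral>\<omega>. Ef n (node t j) (vadd d x (W (node t j - t) \<omega>)) \<partial>P))"
proof (induction n)
  case 0
  interpret P: prob_space P using W by (rule brownian_motion_prob)
  have Tt: "T - t \<in> {0..T}" using t by auto
  define c where "c = (\<Sum>j=1..Q. weight t j * f (node t j) 0)"
  have \<phi>v: "(\<lambda>v. \<phi> (vadd d x v)) \<in> borel_measurable (Rd d)"
    using x by (intro measurable_compose[OF vadd_measurable \<phi>_meas]) auto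
  have E\<phi>: "N.expectation (\<lambda>\<omega>. \<phi> (vadd d x (B [] 1 i (T - t) \<omega>))) = (\<integral>\<omega>. \<phi> (vadd d x (W (T - t) \<omega>)) \<partial>P)" for i
  proof -
    have "N.expectation (\<lambda>\<omega>. \<phi> (vadd d x (B [] 1 i (T - t) \<omega>))) = (\<integral>v. \<phi> (vadd d x v) \<partial>distr N (Rd d) (B [] 1 i (T - t)))"
      by (intro integral_distr[symmetric] B_measurable Tt \<phi>v)
    also have "\<dots> = (\<integral>v. \<phi> (vadd d x v) \<partial>distr P (Rd d) (W (T - t)))"
      using brownian_marginal_unique[OF T bm W Tt] by simp
    also have "\<dots> = (\<integral>\<omega>. \<phi> (vadd d x (W (T - t) \<omega>)) \<partial>P)"
      by (intro integral_distr brownian_motion_measurable[OF W] Tt \<phi>v)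
    finally show ?thesis .
  qed
  have int: "integrable N (\<lambda>\<omega>. \<phi> (vadd d x (B [] 1 i (T - t) \<omega>)))" for i
    by (intro N.bounded_rv_integrable N.bounded_rvI[of _ C\<phi>] measurable_compose[OF B_measurable \<phi>v] Tt \<phi>_le vadd_in_space)
  have "mean (Suc 0) t x = N.expectation (\<lambda>\<omega>. 1 / real M * (\<Sum>i=1..M. \<phi> (vadd d x (B [] 1 i (T - t) \<omega>))) + c)"
    unfolding mlp.simps c_def ..
  also have "\<dots> = N.expectation (\<lambda>\<omega>. 1 / real M * (\<Sum>i=1..M. \<phi> (vadd d x (B [] 1 i (T - t) \<omega>)))) + c"
    by (subst Bochner_Integration.integral_add) (auto simp: N.prob_space intro!: int)
  also have "N.expectation (\<lambda>\<omega>. 1 / real M * (\<Sum>i=1..M. \<phi> (vadd d x (B [] 1 i (T - t) \<omega>))))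
      = 1 / real M * (\<Sum>i=1..M. (\<integral>\<omega>. \<phi> (vadd d x (W (T - t) \<omega>)) \<partial>P))"
    by (subst integral_mult_right_zero, subst Bochner_Integration.integral_sum) (simp_all only: int E\<phi>)
  also have "c = (\<Sum>j=1..Q. weight t j * (\<integral>\<omega>. Ef 0 (node t j) (vadd d x (W (node t j - t) \<omega>)) \<partial>P))"
    unfolding c_def Ef_def by (simp add: N.prob_space P.prob_space)
  finally show ?case unfolding mean_const .
next
  case (Suc n)
  let ?I = "\<lambda>n j. \<integral>\<omega>. Ef n (node t j) (vadd d x (W (node t j - t) \<omega>)) \<partial>P"
  have ld: "N.bounded_rv (level_diff n [] t x i j) \<and> N.expectation (level_diff n [] t x i j) = ?I (Suc n) j - ?I n j"
    if j: "j \<in> {1..Q}" for i j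
  proof -
    note s = node_in[OF t j] and r = node_diff_in[OF t j]
    note e1 = f_evaluation[OF fresh_label[of "[]" "Suc (Suc n)" i "Eval i j" "[]"] s r x W, of "Suc n"]
    note e2 = f_evaluation[OF fresh_label[of "[]" "Suc (Suc n)" i "Eval i j" "[Copy (\<kappa> ([] @ [Eval i j]))]"] s r x W, of n]
    show ?thesis
      unfolding level_diff_def[abs_def] e1(2)[symmetric] e2(2)[symmetric]
      using N.bounded_rv_diff[OF e1(1) e2(1)] N.bounded_rv_integrable[OF e1(1)] N.bounded_rv_integrable[OF e2(1)]
      by simp
  qed
  have "N.expectation (correction \<kappa> B n [] t x i) = (\<Sum>j=1..Q. weight t j * (?I (Suc n) j - ?I n j))" for i
    unfolding correction_eq[abs_def]
    by (subst Bochner_Integration.integral_sum) (auto simp: ld intro: N.bounded_rv_integrable)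
  then have "mean (Suc (Suc n)) t x = mean (Suc n) t x + (\<Sum>j=1..Q. weight t j * (?I (Suc n) j - ?I n j))"
    using mean_step[OF t x correction_bounded_rv[OF t x], of n] by (simp only: mean_const)
  then show ?case unfolding Suc.IH by (simp only: right_diff_distrib sum_subtractf)
qed

definition taylor_term :: "nat \<Rightarrow> real \<Rightarrow> real" where
  "taylor_term k t = (Cf * (T - t)) ^ k / fact k"

definition bias_growth :: "real \<Rightarrow> real" where
  "bias_growth t = exp (Cf * sqrt (real M) * (1 + 1 / base_const) * (T - t))"

lemma weighted_taylor_term_le:
  assumes "t \<in> {0..T}"
  shows "Cf * (\<Sum>j=1..Q. weight t j * taylor_term k (node t j)) \<le> taylor_term (Suc k) t"
proof -
  have "Cf * (\<Sum>j=1..Q. weight t j * taylor_term k (node t j))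
      = Cf ^ Suc k / fact k * (\<Sum>j=1..Q. weight t j * (T - node t j) ^ k)"
    by (simp add: taylor_term_def sum_distrib_left power_mult_distrib mult_ac)
  also have "\<dots> \<le> Cf ^ Suc k / fact k * ((T - t) ^ Suc k / real (Suc k))"
    using assms Cf by (intro mult_left_mono gl_power_le) auto
  also have "\<dots> = taylor_term (Suc k) t"
    unfolding taylor_term_def power_mult_distrib fact_Suc by (simp del: power_Suc add: mult_ac)
  finally show ?thesis .
qed

text \<open>
  The extra factor \<open>1 + 1 / base_const\<close> in the exponent makes room for the sum of bias and fluctuation,
  as \<open>2 / (base_const + 1) <= 1\<close>.
\<close>

lemma weighted_bias_growth_le:
  assumes t: "t \<in> {0..T}"
  shows "Cf * (\<Sum>j=1..Q. weight t j * (bias_growth (node t j) + growth (node t j))) \<le> ratio * bias_growth t"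
proof -
  define a where "a = Cf * sqrt (real M) * (1 + 1 / base_const)"
  have a: "a > 0" using Cf sqrt_M base_const_ge by (auto simp: a_def intro!: mult_pos_pos add_pos_nonneg)
  have gb: "growth s \<le> bias_growth s" if "s \<in> {0..T}" for s
  proof -
    have "Cf * sqrt (real M) * (T - s) * 1 \<le> Cf * sqrt (real M) * (T - s) * (1 + 1 / base_const)"
      using that Cf base_const_ge by (intro mult_left_mono) auto
    then show ?thesis by (simp add: growth_def bias_growth_def mult_ac)
  qed
  have "(\<Sum>j=1..Q. weight t j * (bias_growth (node t j) + growth (node t j)))
      \<le> (\<Sum>j=1..Q. weight t j * (2 * bias_growth (node t j)))"
  proof (intro sum_mono mult_left_mono weight_ge_0 t)
    fix j assume "j \<in> {1..Q}"
    from gb[OF node_in[OF t this]]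
    show "bias_growth (node t j) + growth (node t j) \<le> 2 * bias_growth (node t j)" by simp
  qed
  also have "\<dots> = 2 * (\<Sum>j=1..Q. weight t j * exp (a * (T - node t j)))"
    by (simp add: bias_growth_def a_def sum_distrib_left mult_ac)
  also have "\<dots> \<le> 2 * (exp (a * (T - t)) / a)" using t a by (intro mult_left_mono gl_exp_le) auto
  finally have "Cf * (\<Sum>j=1..Q. weight t j * (bias_growth (node t j) + growth (node t j)))
      \<le> Cf * (2 * (exp (a * (T - t)) / a))" using Cf by (intro mult_left_mono) auto
  also have "\<dots> = 2 * Cf / a * bias_growth t" by (simp add: bias_growth_def a_def)
  also have "\<dots> \<le> ratio * bias_growth t"
  proof (rule mult_right_mono)
    have "2 * Cf / a = 2 / (sqrt (real M) * (1 + 1 / base_const))" using Cf by (simp add: a_def mult.assoc)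
    also have "1 + 1 / base_const = (base_const + 1) / base_const" using base_const_ge by (simp add: field_simps)
    also have "2 / (sqrt (real M) * ((base_const + 1) / base_const)) = 2 * base_const / (sqrt (real M) * (base_const + 1))" by simp
    also have "\<dots> = 2 / (base_const + 1) * (base_const / sqrt (real M))" by simp
    also have "\<dots> \<le> 1 * (base_const / sqrt (real M))" using base_const_ge by (intro mult_right_mono) auto
    also have "\<dots> = base_const / sqrt (real M)" by simp
    finally show "2 * Cf / a \<le> ratio" by (simp add: ratio_def)
  qed (simp add: bias_growth_def)
  finally show ?thesis .
qed

lemma abs_diff_integral_le:
  fixes g h :: "'c \<Rightarrow> real"
  assumes "prob_space P" "integrable P g" "integrable P h" "\<And>\<omega>. \<omega> \<in> space P \<Longrightarrow> \<bar>g \<omega> - h \<omega>\<bar> \<le> c"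
  shows "\<bar>(\<integral>\<omega>. g \<omega> \<partial>P) - (\<integral>\<omega>. h \<omega> \<partial>P)\<bar> \<le> c"
proof -
  interpret P: prob_space P by fact
  have "\<bar>\<integral>\<omega>. g \<omega> - h \<omega> \<partial>P\<bar> \<le> (\<integral>\<omega>. \<bar>g \<omega> - h \<omega>\<bar> \<partial>P)" by (rule integral_abs_bound)
  also have "\<dots> \<le> c" using assms by (intro P.integral_le_const) auto
  finally show ?thesis using assms by simp
qed

text \<open>
  Subtracting the recursion for the mean from the Feynman-Kac formula leaves the quadrature error of
  the source term and a quadrature sum of the bias and the fluctuation of the preceding level. Since the
  rule does not overestimate integrals of powers of \<open>T - s\<close>, iteration produces the terms of the
  exponential series, as in a Picard iteration.
\<close>

lemma bias_bound:
  fixes P :: "'c measure"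
  assumes W: "brownian_motion P T d W"
    and y_meas: "\<And>s. s \<in> {0..T} \<Longrightarrow> y s \<in> borel_measurable (Rd d)"
    and y_le: "\<And>s x. s \<in> {0..T} \<Longrightarrow> x \<in> space (Rd d) \<Longrightarrow> \<bar>y s x\<bar> \<le> Cy"
    and fk: "feynman_kac P T d W f \<phi> y"
    and smooth: "\<And>t x. t \<in> {0..T} \<Longrightarrow> x \<in> space (Rd d) \<Longrightarrow>
      \<exists>D. derivatives_on {t..T} (F_fun P d W f y t x) D \<and> (\<forall>k. \<forall>s\<in>{t..T}. \<bar>D k s\<bar> \<le> Cd)"
    and t: "t \<in> {0..T}" and x: "x \<in> space (Rd d)"
  defines "\<epsilon> \<equiv> 2 * Cd * T ^ (2 * Q + 1) * sqrt (real Q) * (exp 1 / (8 * real Q)) ^ (2 * Q)"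
  shows "\<bar>y t x - mean n t x\<bar> \<le> \<epsilon> * (\<Sum>k<n. taylor_term k t) + Cy * taylor_term n t + ratio ^ n * bias_growth t"
  using t x
proof (induction n arbitrary: t x)
  case 0
  have "Yn 0 [] t x = (\<lambda>_. 0)" by (rule ext) simp
  then have "\<bar>y t x - mean 0 t x\<bar> \<le> Cy" using y_le[OF 0] by simp
  moreover have "Cy = \<epsilon> * (\<Sum>k<0. taylor_term k t) + Cy * taylor_term 0 t" by (simp add: taylor_term_def)
  moreover have "0 \<le> ratio ^ 0 * bias_growth t" by (simp add: bias_growth_def)
  ultimately show ?case by linarith
next
  case (Suc n)
  note t = Suc.prems(1) and x = Suc.prems(2)
  interpret P: prob_space P using W by (rule brownian_motion_prob)
  define bd where "bd s = \<epsilon> * (\<Sum>k<n. taylor_term k s) + Cy * taylor_term n s + ratio ^ n * bias_growth s" for s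
  have local: "\<bar>f s (y s x') - Ef n s x'\<bar> \<le> Cf * (bd s + ratio ^ n * growth s)" if s: "s \<in> {0..T}" and x': "x' \<in> space (Rd d)" for s x'
  proof -
    note bY = Yn_bounded_rv[OF s x', of n "[]"]
    have "\<bar>f s (y s x') - Ef n s x'\<bar> = \<bar>N.expectation (\<lambda>\<omega>. f s (y s x') - f s (Yn n [] s x' \<omega>))\<bar>"
      unfolding Ef_def
      by (subst Bochner_Integration.integral_diff) (auto intro: N.bounded_rv_integrable f_Yn_bounded_rv s x' simp: N.prob_space)
    also have "\<dots> \<le> N.expectation (\<lambda>\<omega>. \<bar>f s (y s x') - f s (Yn n [] s x' \<omega>)\<bar>)" by (rule integral_abs_bound)
    also have "\<dots> \<le> N.expectation (\<lambda>\<omega>. Cf * (\<bar>y s x' - mean n s x'\<bar> + \<bar>Yn n [] s x' \<omega> - mean n s x'\<bar>))"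
    proof (rule integral_mono)
      show "integrable N (\<lambda>\<omega>. \<bar>f s (y s x') - f s (Yn n [] s x' \<omega>)\<bar>)"
        by (intro integrable_abs N.bounded_rv_integrable N.bounded_rv_diff N.bounded_rv_const f_Yn_bounded_rv s x')
      show "integrable N (\<lambda>\<omega>. Cf * (\<bar>y s x' - mean n s x'\<bar> + \<bar>Yn n [] s x' \<omega> - mean n s x'\<bar>))"
        by (intro integrable_mult_right Bochner_Integration.integrable_add integrable_abs N.bounded_rv_integrable N.bounded_rv_diff N.bounded_rv_const bY)
      fix \<omega>
      have "\<bar>f s (y s x') - f s (Yn n [] s x' \<omega>)\<bar> \<le> Cf * \<bar>y s x' - Yn n [] s x' \<omega>\<bar>" by (rule f_lip[OF s])
      also have "\<dots> \<le> Cf * (\<bar>y s x' - mean n s x'\<bar> + \<bar>Yn n [] s x' \<omega> - mean n s x'\<bar>)"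
        using Cf by (intro mult_left_mono) auto
      finally show "\<bar>f s (y s x') - f s (Yn n [] s x' \<omega>)\<bar> \<le> Cf * (\<bar>y s x' - mean n s x'\<bar> + \<bar>Yn n [] s x' \<omega> - mean n s x'\<bar>)" .
    qed
    also have "\<dots> = Cf * (\<bar>y s x' - mean n s x'\<bar> + N.expectation (\<lambda>\<omega>. \<bar>Yn n [] s x' \<omega> - mean n s x'\<bar>))"
    proof -
      have "integrable N (\<lambda>\<omega>. \<bar>Yn n [] s x' \<omega> - mean n s x'\<bar>)"
        by (intro integrable_abs N.bounded_rv_integrable N.bounded_rv_diff N.bounded_rv_const bY)
      then show ?thesis by (subst integral_mult_right_zero, subst Bochner_Integration.integral_add) (simp_all add: N.prob_space)
    qed
    also have "\<dots> \<le> Cf * (bd s + ratio ^ n * growth s)"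
      using Suc.IH[OF s x'] N.abs_expectation_L2_le[OF variance_bound[OF s x', of n "[]"]] Cf
      unfolding bd_def by (intro mult_left_mono add_mono) auto
    finally show ?thesis .
  qed
  have Fdiff: "\<bar>F_fun P d W f y t x (node t j) - (\<integral>\<omega>. Ef n (node t j) (vadd d x (W (node t j - t) \<omega>)) \<partial>P)\<bar>
      \<le> Cf * (bd (node t j) + ratio ^ n * growth (node t j))" if j: "j \<in> {1..Q}" for j
  proof -
    note r = node_diff_in[OF t j]
    define s where "s = node t j"
    have s: "s \<in> {0..T}" unfolding s_def by (rule node_in[OF t j])
    define V where "V = (\<lambda>\<omega>. vadd d x (W (s - t) \<omega>))"
    have Vm: "V \<in> measurable P (Rd d)"
      unfolding V_def using x r by (intro vadd_measurable brownian_motion_measurable[OF W]) (auto simp: s_def)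
    have fy: "\<bar>f s (y s (V \<omega>))\<bar> \<le> Cf * Cy + C0" for \<omega>
      using f_growth[OF s, of "y s (V \<omega>)"] mult_left_mono[OF y_le[OF s vadd_in_space], of Cf x "W (s - t) \<omega>"] Cf
      unfolding V_def by linarith
    have lc: "\<bar>f s (y s (V \<omega>)) - Ef n s (V \<omega>)\<bar> \<le> Cf * (bd s + ratio ^ n * growth s)" for \<omega>
      unfolding V_def by (rule local[OF s vadd_in_space])
    have i1: "integrable P (\<lambda>\<omega>. f s (y s (V \<omega>)))"
      by (rule P.bounded_rv_integrable[OF P.bounded_rvI[OF measurable_compose[OF measurable_compose[OF Vm y_meas[OF s]] f_measurable[OF s]] fy]])
    have i2: "integrable P (\<lambda>\<omega>. Ef n s (V \<omega>))"
    proof (rule P.bounded_rv_integrable[OF P.bounded_rvI[OF measurable_compose[OF Vm Ef_measurable[OF s]]]])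
      fix \<omega>
      show "\<bar>Ef n s (V \<omega>)\<bar> \<le> (Cf * Cy + C0) + Cf * (bd s + ratio ^ n * growth s)"
        using fy[of \<omega>] lc[of \<omega>] by linarith
    qed
    have "\<bar>(\<integral>\<omega>. f s (y s (V \<omega>)) \<partial>P) - (\<integral>\<omega>. Ef n s (V \<omega>) \<partial>P)\<bar> \<le> Cf * (bd s + ratio ^ n * growth s)"
      by (rule abs_diff_integral_le[OF P.prob_space_axioms i1 i2 lc])
    then show ?thesis by (simp add: F_fun_def V_def s_def)
  qed
  obtain D where D: "derivatives_on {t..T} (F_fun P d W f y t x) D" "\<And>k s. s \<in> {t..T} \<Longrightarrow> \<bar>D k s\<bar> \<le> Cd"
    using smooth[OF t x] by blast
  have quad: "\<bar>integral {t..T} (F_fun P d W f y t x) - (\<Sum>j=1..Q. weight t j * F_fun P d W f y t x (node t j))\<bar> \<le> \<epsilon>"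
    unfolding \<epsilon>_def using t by (intro gl_error_le[OF _ _ D(1)] D(2)) auto
  have lb: "(LBINT s:{t..T}. F_fun P d W f y t x s) = integral {t..T} (F_fun P d W f y t x)"
    by (intro set_borel_integral_eq_integral borel_integrable_atLeastAtMost' derivatives_on_continuous[OF D(1)])
  have "y t x = (\<integral>\<omega>. \<phi> (vadd d x (W (T - t) \<omega>)) \<partial>P) + integral {t..T} (F_fun P d W f y t x)"
    using fk t x unfolding feynman_kac_def lb[symmetric] by blast
  then have split: "y t x - mean (Suc n) t x =
      (integral {t..T} (F_fun P d W f y t x) - (\<Sum>j=1..Q. weight t j * F_fun P d W f y t x (node t j))) +
      (\<Sum>j=1..Q. weight t j * (F_fun P d W f y t x (node t j) - (\<integral>\<omega>. Ef n (node t j) (vadd d x (W (node t j - t) \<omega>)) \<partial>P)))"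
    unfolding mean_recursion[OF W t x] by (simp add: right_diff_distrib sum_subtractf)
  have "\<bar>y t x - mean (Suc n) t x\<bar> \<le> \<epsilon> + (\<Sum>j=1..Q. weight t j * (Cf * (bd (node t j) + ratio ^ n * growth (node t j))))"
    unfolding split by (intro order_trans[OF abs_triangle_ineq add_mono] quad abs_weighted_sum_le[OF t] Fdiff)
  also have "(\<Sum>j=1..Q. weight t j * (Cf * (bd (node t j) + ratio ^ n * growth (node t j)))) =
      \<epsilon> * (\<Sum>k<n. Cf * (\<Sum>j=1..Q. weight t j * taylor_term k (node t j))) +
      Cy * (Cf * (\<Sum>j=1..Q. weight t j * taylor_term n (node t j))) +
      ratio ^ n * (Cf * (\<Sum>j=1..Q. weight t j * (bias_growth (node t j) + growth (node t j))))"
  proof -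
    have "(\<Sum>k<n. Cf * (\<Sum>j=1..Q. weight t j * taylor_term k (node t j))) = (\<Sum>j=1..Q. Cf * weight t j * (\<Sum>k<n. taylor_term k (node t j)))"
      unfolding sum_distrib_left by (subst sum.swap) (simp add: mult_ac)
    then show ?thesis unfolding bd_def
      by (simp add: sum_distrib_left sum.distrib[symmetric] algebra_simps)
  qed
  also have "\<epsilon> + (\<epsilon> * (\<Sum>k<n. Cf * (\<Sum>j=1..Q. weight t j * taylor_term k (node t j))) +
      Cy * (Cf * (\<Sum>j=1..Q. weight t j * taylor_term n (node t j))) +
      ratio ^ n * (Cf * (\<Sum>j=1..Q. weight t j * (bias_growth (node t j) + growth (node t j)))))
    \<le> \<epsilon> + (\<epsilon> * (\<Sum>k<n. taylor_term (Suc k) t) + Cy * taylor_term (Suc n) t + ratio ^ n * (ratio * bias_growth t))"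
  proof (intro add_left_mono add_mono mult_left_mono sum_mono weighted_taylor_term_le weighted_bias_growth_le t)
    show "0 \<le> \<epsilon>" using quad by linarith
    show "0 \<le> Cy" using y_le[OF t x] by linarith
    show "0 \<le> ratio ^ n" using ratio_bounds by simp
  qed
  also have "\<dots> = \<epsilon> * (\<Sum>k<Suc n. taylor_term k t) + Cy * taylor_term (Suc n) t + ratio ^ Suc n * bias_growth t"
    unfolding sum.lessThan_Suc_shift by (simp add: taylor_term_def algebra_simps)
  finally show ?case .
qed

end

theorem theorem3p4:
  fixes T Cf C0 C\<phi> Cy Cd :: real
  assumes "T > 0" "Cf > 0" "C0 > 0" "C\<phi> > 0" "Cy > 0" "Cd > 0"
  shows "\<exists>C1>0. \<exists>K>0. \<exists>C2 :: nat \<Rightarrow> real.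
    (\<forall>Q\<ge>1. 0 < C2 Q \<and> C2 Q \<le> K * max 1 T ^ (2 * Q)) \<and>
    (\<forall>d M Q f \<phi> y z W \<xi> \<beta> \<kappa> B. \<forall>(P :: 'a measure) F (N :: 'b measure).
      d \<ge> 1 \<and> M \<ge> 1 \<and> Q \<ge> 1 \<and>
      bsde_setting P F T d W f \<phi> y z \<and>
      (\<forall>s\<in>{0..T}. \<forall>u v. \<bar>f s u - f s v\<bar> \<le> Cf * \<bar>u - v\<bar>) \<and>
      (\<forall>s\<in>{0..T}. \<bar>f s 0\<bar> \<le> C0) \<and>
      (\<forall>x\<in>space (Rd d). \<bar>\<phi> x\<bar> \<le> C\<phi>) \<and>
      (\<forall>t\<in>{0..T}. \<forall>x\<in>space (Rd d). \<bar>y t x\<bar> \<le> Cy) \<and>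
      (\<forall>t\<in>{0..T}. \<forall>x\<in>space (Rd d).
        (\<exists>D. derivatives_on {t..T} (F_fun P d W f y t x) D \<and>
             (\<forall>k. \<forall>s\<in>{t..T}. \<bar>D k s\<bar> \<le> Cd)) \<and>
        (\<exists>D. (\<forall>i<d. derivatives_on {t<..T} (G_fun P d W f y t x i) (D i)) \<and>
             (\<forall>k. \<forall>s\<in>{t<..T}. L2_set (\<lambda>i. D i k s) {..<d} \<le> Cd))) \<and>
      gauss_legendre Q \<xi> \<beta> \<and>
      independent_brownian_motions N T d B \<and>
      (\<forall>\<theta>. \<kappa> \<theta> \<in> {1..M})
      \<longrightarrow>
      (\<forall>n\<ge>1. \<forall>t\<in>{0..<T}. \<forall>x\<in>space (Rd d).
        let yn = mlp T d M Q \<xi> \<beta> f \<phi> \<kappa> B n [] t x; En = (\<integral>\<omega>. yn \<omega> \<partial>N) in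
          integrable N yn \<and> integrable N (\<lambda>\<omega>. (yn \<omega> - En)\<^sup>2) \<and>
          \<bar>y t x - En\<bar> \<le>
            real n * C2 Q * Cd * sqrt (real Q) * (exp 1 / (8 * real Q)) ^ (2 * Q)
            + (C1 / sqrt (real M)) ^ n * exp (Cf * sqrt (real M) * (T - t) * (1 + 1 / C1))
            + Cy * (T - t) ^ n * Cf ^ n / fact n \<and>
          sqrt (\<integral>\<omega>. (yn \<omega> - En)\<^sup>2 \<partial>N) \<le>
            (C1 / sqrt (real M)) ^ n * exp (Cf * sqrt (real M) * (T - t))))"
proof -
  define C1 where "C1 = max 3 (C\<phi> + T * C0)"
  define K where "K = 2 * T * exp (Cf * T)"
  \<comment> \<open>\<open>exp (Cf * T)\<close> bounds the sum of the weights with which quadrature errors accumulate; the remaining \<open>2 * T\<close>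
    comes from the error bound of a single one, of which \<open>T ^ (2 * Q)\<close> is left to \<open>C2\<close>.\<close>
  define C2 where "C2 = (\<lambda>Q :: nat. K * max 1 T ^ (2 * Q))"
  have K: "K > 0" using assms by (simp add: K_def)
  have C2: "0 < C2 Q \<and> C2 Q \<le> K * max 1 T ^ (2 * Q)" for Q using K by (simp add: C2_def)
  have main: "(let yn = mlp T d M Q \<xi> \<beta> f \<phi> \<kappa> B n [] t x; En = (\<integral>\<omega>. yn \<omega> \<partial>N) in
          integrable N yn \<and> integrable N (\<lambda>\<omega>. (yn \<omega> - En)\<^sup>2) \<and>
          \<bar>y t x - En\<bar> \<le>
            real n * C2 Q * Cd * sqrt (real Q) * (exp 1 / (8 * real Q)) ^ (2 * Q)
            + (C1 / sqrt (real M)) ^ n * exp (Cf * sqrt (real M) * (T - t) * (1 + 1 / C1))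
            + Cy * (T - t) ^ n * Cf ^ n / fact n \<and>
          sqrt (\<integral>\<omega>. (yn \<omega> - En)\<^sup>2 \<partial>N) \<le>
            (C1 / sqrt (real M)) ^ n * exp (Cf * sqrt (real M) * (T - t)))"
    if MQ: "M \<ge> 1" "Q \<ge> 1" and setting: "bsde_setting P F T d W f \<phi> y z"
      and lip: "\<forall>s\<in>{0..T}. \<forall>u v. \<bar>f s u - f s v\<bar> \<le> Cf * \<bar>u - v\<bar>"
      and f0: "\<forall>s\<in>{0..T}. \<bar>f s 0\<bar> \<le> C0"
      and \<phi>: "\<forall>x\<in>space (Rd d). \<bar>\<phi> x\<bar> \<le> C\<phi>"
      and y: "\<forall>t\<in>{0..T}. \<forall>x\<in>space (Rd d). \<bar>y t x\<bar> \<le> Cy"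
      and smooth: "\<forall>t\<in>{0..T}. \<forall>x\<in>space (Rd d).
        (\<exists>D. derivatives_on {t..T} (F_fun P d W f y t x) D \<and> (\<forall>k. \<forall>s\<in>{t..T}. \<bar>D k s\<bar> \<le> Cd))"
      and gl: "gauss_legendre Q \<xi> \<beta>" and ibm: "independent_brownian_motions N T d B"
      and \<kappa>: "\<forall>\<theta>. \<kappa> \<theta> \<in> {1..M}"
      and n: "n \<ge> 1" and t: "t \<in> {0..<T}" and x: "x \<in> space (Rd d)"
    for d M Q n :: nat and f \<phi> y z W \<xi> \<beta> \<kappa> B t x and P :: "'a measure" and F and N :: "'b measure"
  proof -
    interpret mlp_random Q \<xi> \<beta> T Cf C0 C\<phi> d M f \<phi> N B \<kappa>
      using assms MQ lip f0 \<phi> gl ibm \<kappa> setting by unfold_locales (auto simp: bsde_setting_def)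
    have C1_eq: "C1 = base_const" by (simp only: C1_def base_const_def)
    have t': "t \<in> {0..T}" using t by auto
    have W: "brownian_motion P T d W" and fk: "feynman_kac P T d W f \<phi> y"
      and ym: "(\<lambda>(s, x). y s x) \<in> borel_measurable (restrict_space borel {0..T} \<Otimes>\<^sub>M Rd d)"
      using setting by (auto simp: bsde_setting_def brownian_motion_wrt_def)
    have ys: "y s \<in> borel_measurable (Rd d)" if "s \<in> {0..T}" for s
      using measurable_compose[OF measurable_Pair1' ym, of s] that by (simp add: space_restrict_space)
    define A where "A = sqrt (real Q) * (exp 1 / (8 * real Q)) ^ (2 * Q)"
    have A: "A \<ge> 0" by (simp add: A_def)
    have sd: "N.L2_le (\<lambda>\<omega>. Yn n [] t x \<omega> - mean n t x) (ratio ^ n * growth t)" by (rule variance_bound[OF t' x])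
    have "\<bar>y t x - mean n t x\<bar> \<le> 2 * Cd * T ^ (2 * Q + 1) * sqrt (real Q) * (exp 1 / (8 * real Q)) ^ (2 * Q) * (\<Sum>k<n. taylor_term k t)
        + Cy * taylor_term n t + ratio ^ n * bias_growth t"
      using y smooth by (intro bias_bound[OF W ys _ fk _ t' x]) auto
    also have "2 * Cd * T ^ (2 * Q + 1) * sqrt (real Q) * (exp 1 / (8 * real Q)) ^ (2 * Q) * (\<Sum>k<n. taylor_term k t)
        \<le> real n * C2 Q * Cd * sqrt (real Q) * (exp 1 / (8 * real Q)) ^ (2 * Q)"
    proof -
      have "(\<Sum>k<n. taylor_term k t) \<le> exp (Cf * T)"
      proof -
        have "(\<Sum>k<n. taylor_term k t) \<le> exp (Cf * (T - t))"
          using sum_le_suminf[OF summable_exp, of "{..<n}" "Cf * (T - t)"] assms t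
          by (simp add: taylor_term_def exp_def field_simps)
        also have "\<dots> \<le> exp (Cf * T)" using assms t by simp
        finally show ?thesis .
      qed
      also have "\<dots> \<le> real n * exp (Cf * T)" using n by simp
      finally have 1: "(\<Sum>k<n. taylor_term k t) \<le> real n * exp (Cf * T)" .
      have "T ^ (2 * Q) \<le> max 1 T ^ (2 * Q)" using assms by (intro power_mono) auto
      then have 2: "2 * Cd * T * A * T ^ (2 * Q) \<le> 2 * Cd * T * A * max 1 T ^ (2 * Q)"
        using assms A by (intro mult_left_mono) auto
      have "2 * Cd * T * A * T ^ (2 * Q) * (\<Sum>k<n. taylor_term k t) \<le> 2 * Cd * T * A * max 1 T ^ (2 * Q) * (real n * exp (Cf * T))"
        using assms A t by (intro mult_mono[OF 2 1] mult_nonneg_nonneg sum_nonneg) (auto simp: taylor_term_def)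
      then show ?thesis by (simp add: A_def C2_def K_def power_add mult_ac)
    qed
    also have "Cy * taylor_term n t = Cy * (T - t) ^ n * Cf ^ n / fact n"
      by (simp add: taylor_term_def power_mult_distrib mult_ac)
    also have "ratio ^ n * bias_growth t = (C1 / sqrt (real M)) ^ n * exp (Cf * sqrt (real M) * (T - t) * (1 + 1 / C1))"
      by (simp add: ratio_def bias_growth_def C1_eq mult_ac)
    finally have bias: "\<bar>y t x - mean n t x\<bar> \<le> real n * C2 Q * Cd * sqrt (real Q) * (exp 1 / (8 * real Q)) ^ (2 * Q)
            + (C1 / sqrt (real M)) ^ n * exp (Cf * sqrt (real M) * (T - t) * (1 + 1 / C1))
            + Cy * (T - t) ^ n * Cf ^ n / fact n" by linarith
    have "sqrt (N.expectation (\<lambda>\<omega>. (Yn n [] t x \<omega> - mean n t x)\<^sup>2)) \<le> ratio ^ n * growth t"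
      using sd unfolding N.L2_le_def by (intro real_le_lsqrt) auto
    then have var: "sqrt (N.expectation (\<lambda>\<omega>. (Yn n [] t x \<omega> - mean n t x)\<^sup>2))
        \<le> (C1 / sqrt (real M)) ^ n * exp (Cf * sqrt (real M) * (T - t))"
      by (simp only: ratio_def growth_def C1_eq)
    have "integrable N (Yn n [] t x)" by (rule N.bounded_rv_integrable[OF Yn_bounded_rv[OF t' x]])
    moreover have "integrable N (\<lambda>\<omega>. (Yn n [] t x \<omega> - mean n t x)\<^sup>2)"
      by (rule N.bounded_rv_integrable[OF N.bounded_rv_power2[OF N.L2_le_bounded[OF sd]]])
    ultimately show ?thesis using bias var unfolding Let_def by blast
  qed
  have C1: "C1 > 0" by (simp add: C1_def)
  show ?thesis
    by (rule exI[of _ C1], rule conjI[OF C1], rule exI[of _ K], rule conjI[OF K], rule exI[of _ C2],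
        rule conjI, use C2 in blast, intro allI impI ballI, elim conjE, rule main)
       (assumption | blast)+
qed

end
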